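(* Let $d\ge 2$, let $\mu$ be a probability distribution on $\mathbb{R}$, let $\omega=(\omega_e)_{e\in E^d}$ be i.i.d. with law $\mu$ (joint law $\mathbb{P}$), and let $\beta\ge 0$. Then for $\mathbb{P}$-almost every $\omega$ there exists a unique probability measure $\mathbf{P}^{\omega}_{\infty,\beta}$ on $\{0,1\}^{E^d}$, supported on cycle-free subgraphs of $\mathbb{L}^d$, such that both sequences $(\mathbf{P}^{\omega,F}_{\Lambda_n,\beta})_{n}$ and $(\mathbf{P}^{\omega,W}_{\Lambda_n,\beta})_{n}$ converge weakly to $\mathbf{P}^{\omega}_{\infty,\beta}$ as $n\to\infty$.
   Context: $\mathbb{L}^d=(\mathbb{Z}^d,E^d)$ is the nearest-neighbour lattice, $E^d=\{(u,v):u,v\in\mathbb{Z}^d,\ \|u-v\|_1=1\}$ (undirected edges), and $\Lambda_n=[-n,n]^d\cap\mathbb{Z}^d$. For finite $A\subset\mathbb{Z}^d$: the free graph $G^F_A$ has vertex set $A$ and all edges of $E^d$ with both endpoints in $A$; the wired graph $G^W_A$ is obtained from $\mathbb{L}^d$ by contracting all vertices outside $A$ to a single vertex $\dagger$ and removing the self-loops at $\dagger$ (multiple edges to $\dagger$ are kept, and each edge of $G_A^W$ is identified with the edge of $E^d$ it comes from). For $\#\in\{F,W\}$, $\mathbf{P}^{\omega,\#}_{A,\beta}$ is the probability measure on spanning trees $T$ of $G^\#_A$ proportional to $\prod_{e\in T}e^{-\beta\omega_e}$. Subgraphs of $\mathbb{L}^d$ are identified with elements of $\{0,1\}^{E^d}$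 via their edge sets, so these measures are viewed as measures on $\{0,1\}^{E^d}$. A sequence $(\nu_n)$ of probability measures on $\{0,1\}^{E^d}$ converges weakly to $\nu$ if for every finite $A\subset E^d$, $\nu_n(\text{all edges of }A\text{ are present})\to\nu(\text{all edges of }A\text{ are present})$. *)

theory Defs
  imports "HOL-Probability.Probability"
begin

section \<open>Multigraphs and spanning trees\<close>

text \<open>
  Undirected multigraphs: \<open>ends G e\<close> is the set of endpoints of the edge \<open>e\<close>, a singleton for a
  self-loop. Parallel edges are distinct elements of \<open>edges G\<close> with the same endpoints.
\<close>

record ('v, 'e) multigraph =
  verts :: "'v set"
  edges :: "'e set"
  ends :: "'e \<Rightarrow> 'v set"

definition connected_via :: "('v, 'e) multigraph \<Rightarrow> 'e set \<Rightarrow> bool" where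
  "connected_via G T \<longleftrightarrow>
     (\<forall>u\<in>verts G. \<forall>v\<in>verts G. (u, v) \<in> {(x, y). \<exists>e\<in>T. ends G e = {x, y}}\<^sup>*)"

text \<open>
  The cycle runs through \<open>vs ! 0, es ! 0, vs ! 1, es ! 1, \<dots>\<close> and back to \<open>vs ! 0\<close>. Length 1 is a
  self-loop, length 2 a pair of parallel edges.
\<close>

definition is_cycle :: "('v, 'e) multigraph \<Rightarrow> 'v list \<Rightarrow> 'e list \<Rightarrow> bool" where
  "is_cycle G vs es \<longleftrightarrow>
     es \<noteq> [] \<and> length vs = length es \<and> distinct vs \<and> distinct es \<and>
     (\<forall>i<length es. ends G (es ! i) = {vs ! i, vs ! (Suc i mod length es)})"

definition cycle_free :: "('v, 'e) multigraph \<Rightarrow> 'e set \<Rightarrow> bool" where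
  "cycle_free G T \<longleftrightarrow> \<not> (\<exists>vs es. set es \<subseteq> T \<and> is_cycle G vs es)"

definition spanning_trees :: "('v, 'e) multigraph \<Rightarrow> 'e set set" where
  "spanning_trees G = {T. T \<subseteq> edges G \<and> connected_via G T \<and> cycle_free G T}"


section \<open>The lattice and its finite subgraphs\<close>

definition lattice_edges :: "(int ^ 'd) set set" where
  "lattice_edges = {{u, v} | u v. (\<Sum>i\<in>UNIV. \<bar>u $ i - v $ i\<bar>) = 1}"

definition lattice :: "(int ^ 'd, (int ^ 'd) set) multigraph" where
  "lattice = \<lparr>verts = UNIV, edges = lattice_edges, ends = (\<lambda>e. e)\<rparr>"

definition lattice_box :: "nat \<Rightarrow> (int ^ 'd) set" where
  "lattice_box n = {x. \<forall>i. \<bar>x $ i\<bar> \<le> int n}"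

definition free_graph :: "(int ^ 'd) set \<Rightarrow> (int ^ 'd, (int ^ 'd) set) multigraph" where
  "free_graph A = \<lparr>verts = A, edges = {e \<in> lattice_edges. e \<subseteq> A}, ends = (\<lambda>e. e)\<rparr>"

text \<open>\<open>None\<close> is the vertex obtained by contracting the complement of \<open>A\<close>.\<close>

definition contract :: "(int ^ 'd) set \<Rightarrow> int ^ 'd \<Rightarrow> (int ^ 'd) option" where
  "contract A v = (if v \<in> A then Some v else None)"

definition wired_graph :: "(int ^ 'd) set \<Rightarrow> ((int ^ 'd) option, (int ^ 'd) set) multigraph" where
  "wired_graph A =
     \<lparr>verts = range (contract A),
      edges = {e \<in> lattice_edges. contract A ` e \<noteq> {None}},
      ends = (\<lambda>e. contract A ` e)\<rparr>"


section \<open>Measures on edge configurations\<close>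

definition config_space :: "((int ^ 'd) set \<Rightarrow> bool) measure" where
  "config_space = Pi\<^sub>M lattice_edges (\<lambda>_. count_space UNIV)"

definition config_of :: "(int ^ 'd) set set \<Rightarrow> (int ^ 'd) set \<Rightarrow> bool" where
  "config_of T = (\<lambda>e\<in>lattice_edges. e \<in> T)"

definition open_edges :: "((int ^ 'd) set \<Rightarrow> bool) \<Rightarrow> (int ^ 'd) set set" where
  "open_edges \<eta> = {e \<in> lattice_edges. \<eta> e}"

definition tree_weight :: "((int ^ 'd) set \<Rightarrow> real) \<Rightarrow> real \<Rightarrow> (int ^ 'd) set set \<Rightarrow> real" where
  "tree_weight \<omega> \<beta> T = (\<Prod>e\<in>T. exp (- \<beta> * \<omega> e))"

text \<open>Meaningful for graphs with finitely many edges, all of which are lattice edges.\<close>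

definition spanning_tree_measure ::
    "('v, (int ^ 'd) set) multigraph \<Rightarrow> ((int ^ 'd) set \<Rightarrow> real) \<Rightarrow> real
      \<Rightarrow> ((int ^ 'd) set \<Rightarrow> bool) measure" where
  "spanning_tree_measure G \<omega> \<beta> =
     distr
       (point_measure (spanning_trees G)
         (\<lambda>T. ennreal (tree_weight \<omega> \<beta> T / (\<Sum>S\<in>spanning_trees G. tree_weight \<omega> \<beta> S))))
       config_space config_of"

definition converges_weakly ::
    "(nat \<Rightarrow> ((int ^ 'd) set \<Rightarrow> bool) measure) \<Rightarrow> ((int ^ 'd) set \<Rightarrow> bool) measure \<Rightarrow> bool" where
  "converges_weakly \<nu>s \<nu> \<longleftrightarrow>
     (\<forall>A. finite A \<and> A \<subseteq> lattice_edges \<longrightarrow>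
        (\<lambda>n. measure (\<nu>s n) {\<eta> \<in> space (\<nu>s n). \<forall>e\<in>A. \<eta> e})
          \<longlonglongrightarrow> measure \<nu> {\<eta> \<in> space \<nu>. \<forall>e\<in>A. \<eta> e})"

end

theory Submission
  imports Defs "HOL-Real_Asymp.Real_Asymp"
begin

text \<open>
  Give the edge \<open>e\<close> the conductance \<open>exp (- \<beta> * \<omega> e)\<close>. For every fixed environment both sequences of tree
  measures converge, by monotonicity; randomness of the environment only serves to show that the two
  limits coincide.

  Monotonicity rests on negative correlation. By Kirchhoff's formula, the probability that an edge
  belongs to the random spanning tree is its conductance times the effective resistance between its
  ends, and by the Dirichlet principle this resistance cannot decrease when another edge is deleted
  (\<open>rayleigh_monotonicity\<close>). So any two edges are negatively correlated
  (\<open>negative_correlation_pair\<close>). Applied to all minors of the graph, this extends to an edge and an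
  event of the form ``the tree meets \<open>B\<close> or contains \<open>A\<close>'' (\<open>negative_correlation\<close>). Consequently the
  deletion of an edge raises, and the contraction of an edge lowers, the probability of such an event.
  Up to a pendant edge, the free graph on a smaller set of vertices arises by deletions from the free
  graph on a larger set, and likewise from the wired graph on the same set; the wired graph on a smaller
  box arises from that on a larger box by contractions. Hence free probabilities decrease in the box,
  wired ones increase, and the wired ones are at most the free ones.

  It suffices to compare the limiting probabilities of single edges: the events ``\<open>a\<close> is present or all
  of \<open>K\<close> is present'' are ordered as well, so the difference of the free and the wired probability that
  all of \<open>insert a K\<close> is present is at most the sum of the differences for \<open>{a}\<close> and for \<open>K\<close>
  (\<open>limit_defect_insert\<close>). For single edges a count decides. A spanning tree of the free graph on a
  box has one edge fewer than the box has vertices, and one of the wired graph has as many edges as the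
  box has vertices. The law of the environment is invariant under translations, so averaging over large boxes
  shows that the expected limiting number of tree edges per vertex is at most 1 in the free and at
  least 1 in the wired case (\<open>sum_mean_limits\<close>). Since wired is at most free edge by edge, both limits
  agree on every edge for almost every environment (\<open>AE_edge_limits_eq\<close>).

  The common limits of the probabilities that finitely many given edges are present are realised by a
  measure by the Daniell-Kolmogorov theorem (\<open>weak_limit_exists\<close>), and determine it because these events
  are stable under intersection and generate the product algebra (\<open>measure_eqI_cylinder\<close>). Each of the countably many finite edge
  sets that contain a cycle has probability zero to be present, which gives the absence of cycles.
\<close>

section \<open>Spanning trees of contracted graphs\<close>

text \<open>
  The orientation of the edges serves to write discrete gradients. Vertices and edges of the graphs are
  passed as sets, so that one orientation serves all minors of a graph.
\<close>

locale oriented_edges =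
  fixes src tgt :: "'e \<Rightarrow> 'v"
begin

text \<open>
  Contraction is represented by a relation \<open>R\<close> on vertices instead of a quotient: \<open>joined T R\<close> is the
  connectivity of \<open>T\<close> in the graph in which vertices related by \<open>R\<close> have been identified. Contracting
  an edge then just moves it from \<open>T\<close> to \<open>R\<close>, and \<open>V // joined {} R\<close> is the vertex set of the
  contracted graph.
\<close>

definition joined :: "'e set \<Rightarrow> 'v rel \<Rightarrow> 'v rel" where
  "joined T R = (R \<union> R\<inverse> \<union> {(x, y). \<exists>e\<in>T. {src e, tgt e} = {x, y}})\<^sup>*"

lemma joined_refl [simp]: "(x, x) \<in> joined T R"
  by (simp add: joined_def)

lemma joined_sym: "(x, y) \<in> joined T R \<Longrightarrow> (y, x) \<in> joined T R"
proof -
  have "sym (R \<union> R\<inverse> \<union> {(x, y). \<exists>e\<in>T. {src e, tgt e} = {x, y}})"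
    by (auto simp: sym_def insert_commute)
  then show "(x, y) \<in> joined T R \<Longrightarrow> (y, x) \<in> joined T R"
    unfolding joined_def by (meson sym_rtrancl symD)
qed

lemma joined_trans: "(x, y) \<in> joined T R \<Longrightarrow> (y, z) \<in> joined T R \<Longrightarrow> (x, z) \<in> joined T R"
  unfolding joined_def by (rule rtrancl_trans)

lemma equiv_joined: "equiv UNIV (joined T R)"
  by (auto intro!: equivI refl_onI symI transI intro: joined_sym joined_trans)

lemma joined_edge: "e \<in> T \<Longrightarrow> (src e, tgt e) \<in> joined T R"
  unfolding joined_def by (rule r_into_rtrancl) auto

lemma joined_rel: "(x, y) \<in> R \<Longrightarrow> (x, y) \<in> joined T R"
  unfolding joined_def by (rule r_into_rtrancl) auto

lemma joined_mono: "T \<subseteq> T' \<Longrightarrow> R \<subseteq> R' \<Longrightarrow> joined T R \<subseteq> joined T' R'"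
  unfolding joined_def by (rule rtrancl_mono) auto

lemma joined_monoD: "(x, y) \<in> joined T R \<Longrightarrow> T \<subseteq> T' \<Longrightarrow> R \<subseteq> R' \<Longrightarrow> (x, y) \<in> joined T' R'"
  using joined_mono by blast

lemma joined_induct [consumes 1, case_names refl rel edge sym trans]:
  assumes "(x, y) \<in> joined T R"
    and refl: "\<And>x. P x x" and rel: "\<And>x y. (x, y) \<in> R \<Longrightarrow> P x y"
    and edge: "\<And>e. e \<in> T \<Longrightarrow> P (src e) (tgt e)"
    and sym: "\<And>x y. P x y \<Longrightarrow> P y x"
    and trans: "\<And>x y z. P x y \<Longrightarrow> P y z \<Longrightarrow> P x z"
  shows "P x y"
  using assms(1) unfolding joined_def
proof (induction rule: rtrancl_induct)
  case base
  then show ?case by (rule refl)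
next
  case (step y z)
  have "P y z"
    using step(2) rel edge sym by (auto simp: doubleton_eq_iff)
  with step(3) show ?case by (rule trans)
qed

lemma joined_insert:
  "(x, y) \<in> joined (insert e T) R \<longleftrightarrow>
     (x, y) \<in> joined T R \<or>
     (x, src e) \<in> joined T R \<and> (tgt e, y) \<in> joined T R \<or>
     (x, tgt e) \<in> joined T R \<and> (src e, y) \<in> joined T R"
  (is "?l \<longleftrightarrow> ?r")
proof
  assume ?l
  then show ?r
  proof (induction rule: joined_induct)
    case (rel x y)
    then show ?case by (blast intro: joined_rel)
  next
    case (edge g)
    then show ?case by (cases "g = e") (auto intro: joined_edge)
  next
    case (sym x y)
    then show ?case by (meson joined_sym)
  next
    case (trans x y z)
    then show ?case by (smt (verit) joined_sym joined_trans)
  qed simp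
next
  have e: "(src e, tgt e) \<in> joined (insert e T) R" by (rule joined_edge) simp
  have m: "(x, y) \<in> joined (insert e T) R" if "(x, y) \<in> joined T R" for x y
    using that by (rule joined_monoD) auto
  assume ?r
  then show ?l
    using m joined_trans[OF m joined_trans[OF e m]] joined_trans[OF m joined_trans[OF joined_sym[OF e] m]]
    by blast
qed

lemma joined_insert_redundant:
  assumes "(src e, tgt e) \<in> joined T R"
  shows "joined (insert e T) R = joined T R"
proof -
  have "(x, y) \<in> joined T R" if "(x, y) \<in> joined (insert e T) R" for x y
    using that[unfolded joined_insert] assms by (meson joined_sym joined_trans)
  then show ?thesis using joined_mono[of T "insert e T" R R] by auto
qed

lemma joined_insert_rel: "joined T (insert (src e, tgt e) R) = joined (insert e T) R"
proof -
  have "insert (src e, tgt e) R \<union> (insert (src e, tgt e) R)\<inverse> \<union>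
          {(x, y). \<exists>g\<in>T. {src g, tgt g} = {x, y}} =
        R \<union> R\<inverse> \<union> {(x, y). \<exists>g\<in>insert e T. {src g, tgt g} = {x, y}}"
    by (auto simp: doubleton_eq_iff)
  then show ?thesis by (simp add: joined_def)
qed

lemma joined_const:
  assumes "(x, y) \<in> joined T R" and "\<And>e. e \<in> T \<Longrightarrow> h (src e) = h (tgt e)"
    and "\<And>x y. (x, y) \<in> R \<Longrightarrow> h x = h y"
  shows "h x = h y"
  using assms by (induction rule: joined_induct) auto

text \<open>
  The two classes that contain the ends of \<open>e\<close> are merged, and no others.
\<close>

lemma card_quotient_insert:
  assumes fin: "finite (V // joined T R)"
    and e: "src e \<in> V" "tgt e \<in> V" and ne: "(src e, tgt e) \<notin> joined T R"
  shows "Suc (card (V // joined (insert e T) R)) = card (V // joined T R)"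
proof -
  define cl where "cl x = joined T R `` {x}" for x
  define cl' where "cl' x = joined (insert e T) R `` {x}" for x
  have q: "V // joined T R = cl ` V" "V // joined (insert e T) R = cl' ` V"
    by (auto simp: cl_def cl'_def quotient_def)
  have cl_eq: "cl x = cl y \<longleftrightarrow> (x, y) \<in> joined T R" for x y
    unfolding cl_def using eq_equiv_class_iff[OF equiv_joined, of x y] by simp
  have mem: "y \<in> cl x \<longleftrightarrow> cl x = cl y" for x y
    unfolding cl_eq by (simp add: cl_def)
  have mem': "y \<in> cl' x \<longleftrightarrow> cl x = cl y \<or> cl x = cl (src e) \<and> cl (tgt e) = cl y \<or>
      cl x = cl (tgt e) \<and> cl (src e) = cl y" for x y
    unfolding cl_eq using joined_insert[of x y e T R] by (simp add: cl'_def)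
  have cl': "cl' x = (if cl x = cl (src e) \<or> cl x = cl (tgt e) then cl (src e) \<union> cl (tgt e) else cl x)" for x
    by (rule set_eqI) (auto simp: mem mem')
  have st: "cl (src e) \<noteq> cl (tgt e)" using ne by (simp add: cl_eq)
  let ?m = "cl (src e) \<union> cl (tgt e)"
  have "cl' ` V = insert ?m (cl ` V - {cl (src e), cl (tgt e)})"
    using e by (auto simp: cl' image_iff)
  moreover have "?m \<notin> cl ` V"
  proof
    assume "?m \<in> cl ` V"
    then obtain x where "cl x = ?m" by auto
    then have "src e \<in> cl x" "tgt e \<in> cl x" by (auto simp: mem)
    then show False using st by (simp add: mem)
  qed
  moreover have "card (cl ` V - {cl (src e), cl (tgt e)}) = card (cl ` V) - 2"
    using st e by (subst card_Diff_subset) auto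
  moreover have "card {cl (src e), cl (tgt e)} \<le> card (cl ` V)"
    using fin e unfolding q by (intro card_mono) auto
  ultimately show ?thesis using fin st unfolding q by simp
qed

lemma finite_quotient_joined:
  assumes "finite (V // joined {} R)" "R \<subseteq> R'"
  shows "finite (V // joined T R')"
proof -
  have "V // joined T R' = (\<lambda>C. joined T R' `` C) ` (V // joined {} R)"
  proof (intro equalityI subsetI)
    have *: "joined T R' `` (joined {} R `` {x}) = joined T R' `` {x}" for x
      using joined_mono[of "{}" T R R'] assms(2) by (auto intro: joined_trans)
    fix C
    show "C \<in> (\<lambda>C. joined T R' `` C) ` (V // joined {} R)" if "C \<in> V // joined T R'"
      using that * by (auto simp: quotient_def image_iff)
    show "C \<in> V // joined T R'" if "C \<in> (\<lambda>C. joined T R' `` C) ` (V // joined {} R)"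
      using that * by (auto simp: quotient_def image_iff)
  qed
  then show ?thesis using assms(1) by simp
qed

lemma card_quotient_le_insert:
  assumes "finite (V // joined {} R)" "src e \<in> V" "tgt e \<in> V"
  shows "card (V // joined T R) \<le> Suc (card (V // joined (insert e T) R))"
proof (cases "(src e, tgt e) \<in> joined T R")
  case True
  then show ?thesis by (simp add: joined_insert_redundant)
next
  case False
  then show ?thesis
    using card_quotient_insert[OF finite_quotient_joined[OF assms(1) order_refl] assms(2,3) False] by simp
qed

lemma card_quotient_le:
  assumes "finite T" "finite (V // joined {} R)" "\<And>e. e \<in> T \<Longrightarrow> src e \<in> V \<and> tgt e \<in> V"
  shows "card (V // joined {} R) \<le> card (V // joined T R) + card T"
  using assms(1,3)
proof (induction T)
  case (insert e T)
  then show ?case using card_quotient_le_insert[OF assms(2), of e T] by fastforce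
qed simp

lemma card_quotient_full:
  assumes "V \<times> V \<subseteq> joined T R" "V \<noteq> {}"
  shows "card (V // joined T R) = 1"
proof -
  obtain x where x: "x \<in> V" using assms by auto
  have "V // joined T R = {joined T R `` {x}}"
  proof -
    have "joined T R `` {y} = joined T R `` {x}" if "y \<in> V" for y
      using that x assms(1) by (intro equiv_class_eq[OF equiv_joined]) auto
    then show ?thesis using x unfolding quotient_def by blast
  qed
  then show ?thesis by simp
qed

text \<open>
  Counting edges instead of forbidding cycles makes deletion and contraction immediate; agreement with
  acyclicity is shown in \<open>trees_eq_independent\<close> and \<open>cycle_free_iff_independent\<close>.
\<close>

definition trees :: "'v set \<Rightarrow> 'e set \<Rightarrow> 'v rel \<Rightarrow> 'e set set" where
  "trees V E R =
     {T. T \<subseteq> E \<and> V \<times> V \<subseteq> joined T R \<and> Suc (card T) = card (V // joined {} R)}"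

lemma finite_trees: "finite E \<Longrightarrow> finite (trees V E R)"
  unfolding trees_def by (rule finite_subset[of _ "Pow E"]) auto

lemma trees_delete: "trees V (E - B) R = {T \<in> trees V E R. T \<inter> B = {}}"
  by (auto simp: trees_def)

lemma not_spanning_if_small:
  assumes "finite T" "finite (V // joined {} R)" "\<And>e. e \<in> T \<Longrightarrow> src e \<in> V \<and> tgt e \<in> V" "V \<noteq> {}"
    and "Suc (card T) < card (V // joined {} R)"
  shows "\<not> V \<times> V \<subseteq> joined T R"
  using card_quotient_le[OF assms(1-3)] card_quotient_full[of V T R] assms(4,5) by auto

definition finite_graph :: "'v set \<Rightarrow> 'e set \<Rightarrow> 'v rel \<Rightarrow> bool" where
  "finite_graph V E R \<longleftrightarrow>
     finite E \<and> V \<noteq> {} \<and> finite (V // joined {} R) \<and> (\<forall>e\<in>E. src e \<in> V \<and> tgt e \<in> V)"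

lemma finite_graphD:
  assumes "finite_graph V E R"
  shows "finite E" "finite (V // joined {} R)" "\<And>e. e \<in> E \<Longrightarrow> src e \<in> V \<and> tgt e \<in> V" "V \<noteq> {}"
  using assms by (auto simp: finite_graph_def)

lemma finite_graph_subset: "finite_graph V E R \<Longrightarrow> E' \<subseteq> E \<Longrightarrow> finite_graph V E' R"
  by (auto simp: finite_graph_def intro: finite_subset)

lemma tree_edge_bridge:
  assumes fg: "finite_graph V E R" and T: "T \<in> trees V E R" "f \<in> T"
  shows "(src f, tgt f) \<notin> joined (T - {f}) R"
proof
  assume "(src f, tgt f) \<in> joined (T - {f}) R"
  then have "joined (insert f (T - {f})) R = joined (T - {f}) R" by (rule joined_insert_redundant)
  then have span: "V \<times> V \<subseteq> joined (T - {f}) R" using T by (auto simp: trees_def insert_absorb)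
  have "finite T" using T finite_graphD(1)[OF fg] by (auto simp: trees_def intro: finite_subset)
  then have "Suc (card (T - {f})) = card T" using T by (intro card_Suc_Diff1)
  then have "Suc (card (T - {f})) < card (V // joined {} R)" using T by (auto simp: trees_def)
  moreover have "src e \<in> V \<and> tgt e \<in> V" if "e \<in> T - {f}" for e
    using that T finite_graphD(3)[OF fg] by (auto simp: trees_def)
  ultimately show False
    using not_spanning_if_small[of "T - {f}" V R] finite_graphD[OF fg] \<open>finite T\<close> span by auto
qed

text \<open>
  Independence in the graphic matroid.
\<close>

definition independent :: "'e set \<Rightarrow> 'v rel \<Rightarrow> bool" where
  "independent T R \<longleftrightarrow> (\<forall>e\<in>T. (src e, tgt e) \<notin> joined (T - {e}) R)"

lemma card_quotient_independent:
  assumes "finite T" "finite (V // joined {} R)" "\<And>e. e \<in> T \<Longrightarrow> src e \<in> V \<and> tgt e \<in> V"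
    and "independent T R"
  shows "card (V // joined {} R) = card (V // joined T R) + card T"
  using assms(1,3,4)
proof (induction T)
  case (insert e T)
  have "independent T R"
    unfolding independent_def
  proof
    fix g assume "g \<in> T"
    then have "(src g, tgt g) \<notin> joined (insert e T - {g}) R"
      using insert by (auto simp: independent_def)
    then show "(src g, tgt g) \<notin> joined (T - {g}) R"
      by (meson joined_monoD order_refl Diff_mono subset_insertI)
  qed
  moreover have "(src e, tgt e) \<notin> joined T R"
    using insert by (auto simp: independent_def)
  ultimately show ?case
    using card_quotient_insert[OF finite_quotient_joined[OF assms(2) order_refl], of e T] insert
    by auto
qed simp

lemma trees_eq_independent:
  assumes fg: "finite_graph V E R"
  shows "trees V E R = {T. T \<subseteq> E \<and> V \<times> V \<subseteq> joined T R \<and> independent T R}"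
proof (intro equalityI subsetI)
  fix T assume T: "T \<in> trees V E R"
  then show "T \<in> {T. T \<subseteq> E \<and> V \<times> V \<subseteq> joined T R \<and> independent T R}"
    using tree_edge_bridge[OF fg T] by (auto simp: trees_def independent_def)
next
  fix T assume T: "T \<in> {T. T \<subseteq> E \<and> V \<times> V \<subseteq> joined T R \<and> independent T R}"
  then have "card (V // joined {} R) = card (V // joined T R) + card T"
    using finite_graphD[OF fg] by (intro card_quotient_independent) (auto intro: finite_subset)
  then show "T \<in> trees V E R"
    using T card_quotient_full[of V T R] finite_graphD[OF fg] by (auto simp: trees_def)
qed

text \<open>
  A minimal spanning subset of \<open>E\<close> is independent.
\<close>

lemma trees_nonempty:
  assumes fg: "finite_graph V E R"
    and span: "V \<times> V \<subseteq> joined E R"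
  shows "trees V E R \<noteq> {}"
proof -
  define S where "S = {T. T \<subseteq> E \<and> V \<times> V \<subseteq> joined T R}"
  have "finite S" "E \<in> S" using span finite_graphD(1)[OF fg] by (auto simp: S_def)
  then obtain T where T: "T \<in> S" "\<And>T'. T' \<in> S \<Longrightarrow> T' \<subseteq> T \<Longrightarrow> T' = T"
    using finite_has_minimal[of S] by (metis empty_iff)
  have "independent T R"
    unfolding independent_def
  proof (intro ballI notI)
    fix e assume e: "e \<in> T" "(src e, tgt e) \<in> joined (T - {e}) R"
    from joined_insert_redundant[OF e(2)] e(1) have "joined (T - {e}) R = joined T R"
      by (simp add: insert_absorb)
    then have "T - {e} \<in> S" using T(1) by (auto simp: S_def)
    then show False using T(2) e(1) by blast
  qed
  then show ?thesis using T(1) trees_eq_independent[OF fg] by (auto simp: S_def)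
qed

lemma finite_graph_contract:
  "finite_graph V E R \<Longrightarrow> finite_graph V (E - {f}) (insert (src f, tgt f) R)"
  using finite_quotient_joined[of V R "insert (src f, tgt f) R" "{}"]
  by (auto simp: finite_graph_def)

lemma trees_contract:
  assumes fg: "finite_graph V E R"
    and nl: "(src f, tgt f) \<notin> joined {} R" and f: "f \<notin> T"  "f \<in> E"
  shows "insert f T \<in> trees V E R \<longleftrightarrow> T \<in> trees V (E - {f}) (insert (src f, tgt f) R)"
proof (cases "T \<subseteq> E")
  case True
  have "Suc (card (V // joined {f} R)) = card (V // joined {} R)"
    using card_quotient_insert[OF _ _ _ nl] finite_graphD[OF fg] f by simp
  moreover have "card (insert f T) = Suc (card T)"
    using True f finite_graphD(1)[OF fg] finite_subset by (subst card_insert_disjoint) auto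
  ultimately show ?thesis using f True by (auto simp: trees_def joined_insert_rel)
qed (use f in \<open>auto simp: trees_def\<close>)

lemma loop_not_in_tree:
  assumes "finite_graph V E R" "(src f, tgt f) \<in> joined {} R" "T \<in> trees V E R"
  shows "f \<notin> T"
  using tree_edge_bridge[OF assms(1,3)] assms(2) by (meson joined_monoD empty_subsetI order_refl)

lemma joined_joined: "joined T (joined {} R) = joined T R"
proof (intro equalityI subrelI)
  fix x y
  show "(x, y) \<in> joined T R" if "(x, y) \<in> joined T (joined {} R)"
    using that
  proof (induction rule: joined_induct)
    case (rel x y)
    then show ?case by (rule joined_monoD) auto
  qed (auto intro: joined_edge joined_sym dest: joined_trans)
  show "(x, y) \<in> joined T (joined {} R)" if "(x, y) \<in> joined T R"
    using that by (rule joined_monoD) (auto intro: joined_rel)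
qed

text \<open>
  Only the partition generated by \<open>R\<close> matters, so different ways to perform the same contraction may
  be compared.
\<close>

lemma trees_cong_rel:
  assumes "joined {} R = joined {} R'"
  shows "trees V E R = trees V E R'"
proof -
  have "joined T R = joined T R'" for T
    using joined_joined[of T R] joined_joined[of T R'] unfolding assms by (rule trans[OF sym])
  then show ?thesis unfolding trees_def by simp
qed

section \<open>Kirchhoff potentials and effective resistance\<close>

abbreviation drop_at :: "('v \<Rightarrow> real) \<Rightarrow> 'e \<Rightarrow> real" where
  "drop_at \<psi> f \<equiv> \<psi> (src f) - \<psi> (tgt f)"

text \<open>
  These are the functions on the vertices of the contracted graph.
\<close>

definition invariant :: "'v rel \<Rightarrow> ('v \<Rightarrow> real) \<Rightarrow> bool" where
  "invariant R \<psi> \<longleftrightarrow> (\<forall>(x, y)\<in>R. \<psi> x = \<psi> y)"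

lemma invariantD: "invariant R \<psi> \<Longrightarrow> (x, y) \<in> R \<Longrightarrow> \<psi> x = \<psi> y"
  unfolding invariant_def by blast

text \<open>
  The coefficients form a unit flow from \<open>x\<close> to \<open>y\<close> in \<open>T\<close>, expressed by duality: edges of \<open>R\<close> carry
  flow as well, but do not contribute because \<open>\<psi>\<close> is constant along them.
\<close>

lemma joined_flow:
  assumes "(x, y) \<in> joined T R" "finite T"
  shows "\<exists>\<alpha>. \<forall>\<psi>. invariant R \<psi> \<longrightarrow> \<psi> x - \<psi> y = (\<Sum>f\<in>T. \<alpha> f * drop_at \<psi> f)"
  using assms(1)
proof (induction rule: joined_induct)
  case (refl x)
  show ?case by (rule exI[of _ "\<lambda>_. 0"]) simp
next
  case (rel x y)
  then show ?case by (intro exI[of _ "\<lambda>_. 0"]) (simp add: invariantD)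
next
  case (edge e)
  have "(\<Sum>f\<in>T. of_bool (f = e) * drop_at \<psi> f) = drop_at \<psi> e" for \<psi> :: "'v \<Rightarrow> real"
    using edge assms(2) by (subst sum.remove[of T e]) auto
  then show ?case by (intro exI[of _ "\<lambda>f. of_bool (f = e)"]) simp
next
  case (sym x y)
  then obtain \<alpha> where \<alpha>: "\<forall>\<psi>. invariant R \<psi> \<longrightarrow> \<psi> x - \<psi> y = (\<Sum>f\<in>T. \<alpha> f * drop_at \<psi> f)"
    by (elim exE)
  have "\<psi> y - \<psi> x = (\<Sum>f\<in>T. - \<alpha> f * drop_at \<psi> f)" if "invariant R \<psi>" for \<psi>
    using \<alpha>[rule_format, OF that] by (simp add: sum_negf)
  then show ?case by (intro exI[of _ "\<lambda>f. - \<alpha> f"]) simp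
next
  case (trans x y z)
  then obtain \<alpha> \<alpha>' where
    \<alpha>: "\<forall>\<psi>. invariant R \<psi> \<longrightarrow> \<psi> x - \<psi> y = (\<Sum>f\<in>T. \<alpha> f * drop_at \<psi> f)"
      "\<forall>\<psi>. invariant R \<psi> \<longrightarrow> \<psi> y - \<psi> z = (\<Sum>f\<in>T. \<alpha>' f * drop_at \<psi> f)"
    by (elim exE)
  have "\<psi> x - \<psi> z = (\<Sum>f\<in>T. (\<alpha> f + \<alpha>' f) * drop_at \<psi> f)" if "invariant R \<psi>" for \<psi>
    using \<alpha>[rule_format, OF that] by (simp add: sum.distrib distrib_right)
  then show ?case by (intro exI[of _ "\<lambda>f. \<alpha> f + \<alpha>' f"]) simp
qed

text \<open>
  The indicator of the component of \<open>src e\<close>.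
\<close>

definition side :: "'e \<Rightarrow> 'v rel \<Rightarrow> 'e set \<Rightarrow> 'v \<Rightarrow> real" where
  "side e R F v = of_bool ((src e, v) \<in> joined F R)"

lemma joined_cong:
  "(u, v) \<in> joined T R \<Longrightarrow> (x, u) \<in> joined T R \<longleftrightarrow> (x, v) \<in> joined T R"
  by (meson joined_sym joined_trans)

lemma invariant_class: "invariant R (\<lambda>v. of_bool ((x, v) \<in> joined F R))"
proof -
  have "(of_bool ((x, a) \<in> joined F R) :: real) = of_bool ((x, b) \<in> joined F R)"
    if "(a, b) \<in> R" for a b
    using joined_cong[OF joined_rel[OF that]] by simp
  then show ?thesis unfolding invariant_def by blast
qed

lemma class_drop_zero: "f \<in> F \<Longrightarrow> drop_at (\<lambda>v. of_bool ((x, v) \<in> joined F R)) f = 0"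
  using joined_cong[OF joined_edge[of f F R], of x] by simp

context
  fixes V E R e
  assumes fg: "finite_graph V (insert e E) R" and e: "e \<notin> E"
begin

text \<open>
  The spanning forests with two components that separate the ends of \<open>e\<close>. Summing their weights gives
  the effective resistance between the ends of \<open>e\<close>, up to division by the sum over spanning trees.
\<close>

definition two_forests :: "'e set set" where
  "two_forests = {F. F \<subseteq> E \<and> insert e F \<in> trees V (insert e E) R}"

lemma finite_graph_rest: "finite_graph V E R"
  using fg by (rule finite_graph_subset) auto

lemma finite_two_forests: "finite two_forests"
proof (rule finite_subset)
  show "two_forests \<subseteq> Pow E" by (auto simp: two_forests_def)
  show "finite (Pow E)" using finite_graphD(1)[OF finite_graph_rest] by simp
qed

lemma two_forest_separates:
  assumes "F \<in> two_forests" shows "(src e, tgt e) \<notin> joined F R"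
proof -
  have "insert e F - {e} = F" using assms e by (auto simp: two_forests_def)
  then show ?thesis
    using tree_edge_bridge[OF fg, of "insert e F" e] assms by (auto simp: two_forests_def)
qed

lemma two_forest_cover:
  assumes "F \<in> two_forests" "v \<in> V"
  shows "(src e, v) \<in> joined F R \<or> (tgt e, v) \<in> joined F R"
proof -
  have "(src e, v) \<in> joined (insert e F) R"
    using assms finite_graphD(3)[OF fg, of e] by (auto simp: two_forests_def trees_def)
  then show ?thesis by (auto simp: joined_insert)
qed

lemma two_forest_card:
  assumes "F \<in> two_forests" shows "Suc (Suc (card F)) = card (V // joined {} R)"
proof -
  have "e \<notin> F" "finite F"
    using assms e finite_graphD(1)[OF fg] by (auto simp: two_forests_def intro: finite_subset)
  then show ?thesis using assms by (auto simp: two_forests_def trees_def)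
qed

text \<open>
  A two-component forest becomes a spanning tree exactly when an edge between its components is added.
\<close>

lemma two_forest_insert:
  assumes F: "F \<in> two_forests" and f: "f \<in> E"
  shows "f \<notin> F \<and> insert f F \<in> trees V E R \<longleftrightarrow> drop_at (side e R F) f \<noteq> 0"
proof -
  have FE: "F \<subseteq> E" "finite F"
    using F finite_graphD(1)[OF fg] by (auto simp: two_forests_def intro: finite_subset)
  have fV: "src f \<in> V" "tgt f \<in> V" using finite_graphD(3)[OF fg, of f] f by auto
  have eV: "src e \<in> V" "tgt e \<in> V" using finite_graphD(3)[OF fg, of e] by auto
  show ?thesis
  proof
    assume "f \<notin> F \<and> insert f F \<in> trees V E R"
    then have "(src e, tgt e) \<in> joined (insert f F) R" using eV by (auto simp: trees_def)
    then have "(src e, src f) \<in> joined F R \<and> (tgt f, tgt e) \<in> joined F R \<or>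
        (src e, tgt f) \<in> joined F R \<and> (src f, tgt e) \<in> joined F R"
      using two_forest_separates[OF F] by (auto simp: joined_insert)
    then have "(src e, src f) \<in> joined F R \<longleftrightarrow> (src e, tgt f) \<notin> joined F R"
      using two_forest_separates[OF F] joined_trans[of "src e" _ F R "tgt e"] by blast
    then show "drop_at (side e R F) f \<noteq> 0" by (auto simp: side_def)
  next
    assume d: "drop_at (side e R F) f \<noteq> 0"
    then have "f \<notin> F" using class_drop_zero[of f F "src e" R] by (auto simp: side_def)
    have "(src e, tgt e) \<in> joined (insert f F) R"
      using d two_forest_cover[OF F fV(1)] two_forest_cover[OF F fV(2)]
        joined_sym[of "tgt e" "src f" F R] joined_sym[of "tgt e" "tgt f" F R]
      by (auto simp: joined_insert side_def)
    moreover have "V \<times> V \<subseteq> joined (insert e F) R"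
      using F by (auto simp: two_forests_def trees_def)
    ultimately have "V \<times> V \<subseteq> joined (insert f F) R"
      using joined_insert_redundant[of e "insert f F" R] joined_mono[of "insert e F" "insert e (insert f F)" R R]
      by auto
    then have "insert f F \<in> trees V E R"
      using FE f two_forest_card[OF F] \<open>f \<notin> F\<close> by (auto simp: trees_def)
    with \<open>f \<notin> F\<close> show "f \<notin> F \<and> insert f F \<in> trees V E R" by simp
  qed
qed

text \<open>
  The unique unit flow between the ends of \<open>e\<close> inside a tree: its value on \<open>f\<close> is read off by testing
  with the indicator of one component of \<open>T - {f}\<close>, whose gradient vanishes on all other edges of the
  tree. It is nonzero precisely when \<open>T - {f}\<close> separates the ends of \<open>e\<close>, and it is then the gradient of
  the component of \<open>src e\<close>.
\<close>

lemma tree_unit_flow: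
  assumes T: "T \<in> trees V E R" and \<psi>: "invariant R \<psi>"
  shows "drop_at \<psi> e =
    (\<Sum>f\<in>T. (if T - {f} \<in> two_forests then drop_at (side e R (T - {f})) f else 0) * drop_at \<psi> f)"
proof -
  have eV: "src e \<in> V" "tgt e \<in> V" using finite_graphD(3)[OF fg, of e] by auto
  have TE: "T \<subseteq> E" "finite T"
    using T finite_graphD(1)[OF fg] by (auto simp: trees_def intro: finite_subset)
  have eT: "(src e, tgt e) \<in> joined T R" using T eV by (auto simp: trees_def)
  obtain \<alpha> where \<alpha>: "\<And>\<psi>. invariant R \<psi> \<Longrightarrow> drop_at \<psi> e = (\<Sum>f\<in>T. \<alpha> f * drop_at \<psi> f)"
    using joined_flow[OF eT TE(2)] by blast
  have "\<alpha> f = (if T - {f} \<in> two_forests then drop_at (side e R (T - {f})) f else 0)" if f: "f \<in> T" for f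
  proof -
    let ?F = "T - {f}"
    let ?\<chi> = "\<lambda>v. of_bool ((src f, v) \<in> joined ?F R) :: real"
    have st: "(src f, tgt f) \<notin> joined ?F R" by (rule tree_edge_bridge[OF finite_graph_rest T f])
    have TF: "insert f ?F = T" using f by auto
    have "drop_at ?\<chi> e = (\<Sum>g\<in>T. \<alpha> g * drop_at ?\<chi> g)"
      by (rule \<alpha>[OF invariant_class])
    also have "\<dots> = \<alpha> f * drop_at ?\<chi> f + (\<Sum>g\<in>?F. \<alpha> g * drop_at ?\<chi> g)"
      using f TE(2) by (rule sum.remove[rotated])
    also have "(\<Sum>g\<in>?F. \<alpha> g * drop_at ?\<chi> g) = 0"
      by (intro sum.neutral ballI) (simp only: class_drop_zero mult_zero_right)
    finally have \<alpha>f: "\<alpha> f = drop_at ?\<chi> e" using st by simp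
    show ?thesis
    proof (cases "(src e, tgt e) \<in> joined ?F R")
      case True
      then have "?F \<notin> two_forests" using two_forest_separates by auto
      moreover have "drop_at ?\<chi> e = 0" using joined_cong[OF True, of "src f"] by simp
      ultimately show ?thesis using \<alpha>f by simp
    next
      case False
      have e': "(src e, src f) \<in> joined ?F R \<and> (tgt f, tgt e) \<in> joined ?F R \<or>
         (src e, tgt f) \<in> joined ?F R \<and> (src f, tgt e) \<in> joined ?F R"
        using eT False joined_insert[of "src e" "tgt e" f ?F R] unfolding TF by auto
      have "(src f, tgt f) \<in> joined (insert e ?F) R"
        using e' by (meson joined_insert joined_sym)
      then have "joined T R \<subseteq> joined (insert e ?F) R"
        using joined_insert_redundant[of f "insert e ?F" R] joined_mono[of T "insert f (insert e ?F)" R R]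
        by auto
      moreover have "Suc (card ?F) = card T" using TE(2) f by (rule card_Suc_Diff1)
      moreover have "e \<notin> ?F" "finite ?F" using TE e by auto
      ultimately have F: "?F \<in> two_forests"
        using T by (auto simp: two_forests_def trees_def)
      have "drop_at ?\<chi> e = drop_at (side e R ?F) f"
        using e'
      proof
        assume a: "(src e, src f) \<in> joined ?F R \<and> (tgt f, tgt e) \<in> joined ?F R"
        then have "(src f, tgt e) \<notin> joined ?F R" "(src e, tgt f) \<notin> joined ?F R"
          "(src f, src e) \<in> joined ?F R"
          using False joined_sym joined_trans by blast+
        then show ?thesis using a by (simp add: side_def)
      next
        assume a: "(src e, tgt f) \<in> joined ?F R \<and> (src f, tgt e) \<in> joined ?F R"
        then have "(src f, src e) \<notin> joined ?F R" "(src e, src f) \<notin> joined ?F R"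
          using False joined_sym joined_trans by blast+
        then show ?thesis using a by (simp add: side_def)
      qed
      then show ?thesis using F \<alpha>f by simp
    qed
  qed
  then show ?thesis using \<alpha>[OF \<psi>] by (simp cong: sum.cong)
qed

context
  fixes c :: "'e \<Rightarrow> real"
begin

text \<open>
  Up to normalisation, the electric potential of the unit current between the ends of \<open>e\<close>.
\<close>

definition potential :: "'v \<Rightarrow> real" where
  "potential v = (\<Sum>F\<in>two_forests. prod c F * side e R F v)"

lemma invariant_potential: "invariant R potential"
proof -
  have "side e R F x = side e R F y" if "(x, y) \<in> R" for F x y
    using joined_cong[OF joined_rel[OF that]] by (simp add: side_def)
  then have "potential x = potential y" if "(x, y) \<in> R" for x y
    using that unfolding potential_def by (intro sum.cong) auto
  then show ?thesis unfolding invariant_def by blast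
qed

lemma drop_potential:
  "drop_at potential f = (\<Sum>F\<in>two_forests. prod c F * drop_at (side e R F) f)"
  by (simp add: potential_def right_diff_distrib sum_subtractf)

lemma drop_potential_pole: "drop_at potential e = (\<Sum>F\<in>two_forests. prod c F)"
  unfolding drop_potential
  by (intro sum.cong) (auto simp: side_def two_forest_separates)

text \<open>
  Kirchhoff's theorem in weak form: \<open>potential\<close> represents the linear functional
  \<open>\<psi> \<mapsto> drop_at \<psi> e\<close> in the Dirichlet form. The unit flows in trees are summed over all trees, and the
  pairs (tree, edge of the tree) are exchanged for pairs (two-component forest, edge joining its
  components).
\<close>

lemma tree_sum_drop:
  assumes \<psi>: "invariant R \<psi>"
  shows "(\<Sum>T\<in>trees V E R. prod c T) * drop_at \<psi> e =
    (\<Sum>f\<in>E. c f * drop_at \<psi> f * drop_at potential f)"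
proof -
  have fin: "finite E" "finite (trees V E R)"
    using finite_graphD(1)[OF finite_graph_rest] finite_trees by auto
  have finT: "finite T" "T \<subseteq> E" if "T \<in> trees V E R" for T
    using that fin(1) by (auto simp: trees_def intro: finite_subset)
  have finF: "finite F" "F \<subseteq> E" if "F \<in> two_forests" for F
    using that fin(1) by (auto simp: two_forests_def intro: finite_subset)
  define S where "S = (SIGMA T:trees V E R. {f \<in> T. T - {f} \<in> two_forests})"
  define S' where "S' = (SIGMA F:two_forests. {f \<in> E. f \<notin> F \<and> insert f F \<in> trees V E R})"
  have "(\<Sum>T\<in>trees V E R. prod c T) * drop_at \<psi> e =
      (\<Sum>T\<in>trees V E R. prod c T *
        (\<Sum>f\<in>T. (if T - {f} \<in> two_forests then drop_at (side e R (T - {f})) f else 0) * drop_at \<psi> f))"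
    unfolding sum_distrib_right by (intro sum.cong refl arg_cong2[of _ _ _ _ "(*)"] tree_unit_flow \<psi>)
  also have "\<dots> = (\<Sum>T\<in>trees V E R. \<Sum>f | f \<in> T \<and> T - {f} \<in> two_forests.
        prod c T * (drop_at (side e R (T - {f})) f * drop_at \<psi> f))"
    unfolding sum_distrib_left
    by (intro sum.cong refl sum.mono_neutral_cong_right) (auto dest: finT)
  also have "\<dots> = (\<Sum>(T, f)\<in>S. prod c T * (drop_at (side e R (T - {f})) f * drop_at \<psi> f))"
    unfolding S_def using fin finT by (subst sum.Sigma) auto
  also have "\<dots> = (\<Sum>(F, f)\<in>S'. c f * drop_at \<psi> f * (prod c F * drop_at (side e R F) f))"
  proof (rule sum.reindex_bij_witness[where i = "\<lambda>(F, f). (insert f F, f)" and j = "\<lambda>(T, f). (T - {f}, f)"])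
    fix a assume a: "a \<in> S"
    obtain T f where Tf: "a = (T, f)" by force
    have "prod c T = c f * prod c (T - {f})"
      using a finT by (auto simp: S_def Tf intro: prod.remove)
    then show "(case case a of (T, f) \<Rightarrow> (T - {f}, f) of
          (F, f) \<Rightarrow> c f * drop_at \<psi> f * (prod c F * drop_at (side e R F) f)) =
        (case a of (T, f) \<Rightarrow> prod c T * (drop_at (side e R (T - {f})) f * drop_at \<psi> f))"
      by (simp add: Tf)
  qed (auto simp: S_def S'_def insert_absorb dest: finT)
  also have "\<dots> = (\<Sum>F\<in>two_forests. \<Sum>f | f \<in> E \<and> f \<notin> F \<and> insert f F \<in> trees V E R.
      c f * drop_at \<psi> f * (prod c F * drop_at (side e R F) f))"
    unfolding S'_def using fin finite_two_forests by (subst sum.Sigma) auto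
  also have "\<dots> = (\<Sum>F\<in>two_forests. \<Sum>f\<in>E. c f * drop_at \<psi> f * (prod c F * drop_at (side e R F) f))"
    using fin two_forest_insert by (intro sum.cong refl sum.mono_neutral_left) auto
  also have "\<dots> = (\<Sum>f\<in>E. c f * drop_at \<psi> f * drop_at potential f)"
    unfolding drop_potential sum_distrib_left by (rule sum.swap)
  finally show ?thesis .
qed

end

end

lemma weighted_Cauchy_Schwarz:
  fixes a b c :: "'b \<Rightarrow> real"
  assumes "\<And>x. c x > 0"
  shows "(\<Sum>x\<in>A. c x * a x * b x)\<^sup>2 \<le> (\<Sum>x\<in>A. c x * (a x)\<^sup>2) * (\<Sum>x\<in>A. c x * (b x)\<^sup>2)"
proof -
  have 1: "c x * a x * b x = (sqrt (c x) * a x) * (sqrt (c x) * b x)" for x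
  proof -
    have "(sqrt (c x) * a x) * (sqrt (c x) * b x) = (sqrt (c x) * sqrt (c x)) * a x * b x"
      by (simp only: mult_ac)
    then show ?thesis using assms[of x] by simp
  qed
  have 2: "c x * (a x)\<^sup>2 = (sqrt (c x) * a x)\<^sup>2" for a :: "'b \<Rightarrow> real" and x
    using assms[of x] by (simp add: power_mult_distrib)
  show ?thesis unfolding 1 2 by (rule Cauchy_Schwarz_ineq_sum)
qed

text \<open>
  The quotient of the sum over two-component forests by the sum over trees is the effective resistance,
  which is the supremum of \<open>(drop_at \<psi> e)\<^sup>2\<close> over the energy of \<open>\<psi>\<close>. The optimal potential for the graph
  with \<open>f\<close> has at most the same energy in the graph without \<open>f\<close>, so it is a competitor there.
\<close>

lemma rayleigh_monotonicity:
  fixes c :: "'e \<Rightarrow> real"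
  assumes fg: "finite_graph V (insert e (insert f E)) R" and ef: "e \<notin> insert f E" "f \<notin> E"
    and c: "\<And>x. c x > 0"
  shows "(\<Sum>T\<in>trees V E R. prod c T) * (\<Sum>F\<in>two_forests V (insert f E) R e. prod c F) \<le>
    (\<Sum>F\<in>two_forests V E R e. prod c F) * (\<Sum>T\<in>trees V (insert f E) R. prod c T)"
proof -
  have fg0: "finite_graph V (insert e E) R" and e0: "e \<notin> E"
    using fg ef by (auto intro: finite_graph_subset)
  have fin: "finite E" using finite_graphD(1)[OF fg] by simp
  let ?\<phi> = "potential V E R e c" and ?\<phi>' = "potential V (insert f E) R e c"
  let ?Z = "\<Sum>T\<in>trees V E R. prod c T" and ?Z' = "\<Sum>T\<in>trees V (insert f E) R. prod c T"
  let ?W = "\<Sum>F\<in>two_forests V E R e. prod c F" and ?W' = "\<Sum>F\<in>two_forests V (insert f E) R e. prod c F"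
  note pole = drop_potential_pole[OF fg0 e0, of c] drop_potential_pole[OF fg ef(1), of c]
  note inv = invariant_potential[OF fg0 e0, of c] invariant_potential[OF fg ef(1), of c]
  note ident = tree_sum_drop[OF fg0 e0, of _ c] tree_sum_drop[OF fg ef(1), of _ c]
  have 1: "?Z * ?W' = (\<Sum>g\<in>E. c g * drop_at ?\<phi>' g * drop_at ?\<phi> g)"
    using ident(1)[OF inv(2)] unfolding pole .
  have 2: "?Z * ?W = (\<Sum>g\<in>E. c g * (drop_at ?\<phi> g)\<^sup>2)"
    using ident(1)[OF inv(1)] unfolding pole by (simp add: power2_eq_square mult.assoc)
  have "?Z' * ?W' = (\<Sum>g\<in>insert f E. c g * (drop_at ?\<phi>' g)\<^sup>2)"
    using ident(2)[OF inv(2)] unfolding pole by (simp add: power2_eq_square mult.assoc)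
  also have "\<dots> \<ge> (\<Sum>g\<in>E. c g * (drop_at ?\<phi>' g)\<^sup>2)"
    using fin c by (intro sum_mono2) (auto simp: less_imp_le)
  finally have 3: "(\<Sum>g\<in>E. c g * (drop_at ?\<phi>' g)\<^sup>2) \<le> ?Z' * ?W'" .
  have pos: "prod c A > 0" for A using c by (intro prod_pos) auto
  have nonneg: "?Z \<ge> 0" "?Z' \<ge> 0" "?W \<ge> 0" "?W' \<ge> 0"
    by (intro sum_nonneg less_imp_le[OF pos])+
  \<comment> \<open>\<open>?Z * ?W'\<close> is the inner product of the two potentials in the smaller graph.\<close>
  have "(?Z * ?W')\<^sup>2 \<le> (\<Sum>g\<in>E. c g * (drop_at ?\<phi>' g)\<^sup>2) * (?Z * ?W)"
    unfolding 1 2 by (rule weighted_Cauchy_Schwarz[OF c])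
  also have "\<dots> \<le> (?Z' * ?W') * (?Z * ?W)"
    using 3 nonneg by (intro mult_right_mono) auto
  finally have "(?Z * ?W') * (?Z * ?W') \<le> (?Z * ?W') * (?W * ?Z')"
    by (simp add: power2_eq_square mult_ac)
  then show ?thesis
    using nonneg by (cases "?Z * ?W' = 0") (auto dest: mult_left_le_imp_le simp: less_le)
qed

section \<open>Negative correlation\<close>

definition tree_sum :: "('e \<Rightarrow> real) \<Rightarrow> 'v set \<Rightarrow> 'e set \<Rightarrow> 'v rel \<Rightarrow> ('e set \<Rightarrow> bool) \<Rightarrow> real" where
  "tree_sum c V E R D = (\<Sum>T | T \<in> trees V E R \<and> D T. prod c T)"

lemma tree_sum_cong:
  "(\<And>T. T \<in> trees V E R \<Longrightarrow> D T \<longleftrightarrow> D' T) \<Longrightarrow> tree_sum c V E R D = tree_sum c V E R D'"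
  unfolding tree_sum_def by (intro sum.cong) auto

lemma tree_sum_split:
  assumes "finite E"
  shows "tree_sum c V E R D = tree_sum c V E R (\<lambda>T. D T \<and> P T) + tree_sum c V E R (\<lambda>T. D T \<and> \<not> P T)"
  unfolding tree_sum_def using finite_trees[OF assms, of V R]
  by (subst sum.union_disjoint[symmetric]) (auto intro: sum.cong)

lemma tree_sum_nonneg: "(\<And>x. c x > 0) \<Longrightarrow> tree_sum c V E R D \<ge> 0"
  unfolding tree_sum_def by (intro sum_nonneg prod_nonneg) (simp add: less_imp_le)

lemma tree_sum_mono:
  assumes "finite E" "\<And>x. c x > 0" "\<And>T. T \<in> trees V E R \<Longrightarrow> D T \<Longrightarrow> D' T"
  shows "tree_sum c V E R D \<le> tree_sum c V E R D'"
  unfolding tree_sum_def using finite_trees[OF assms(1), of V R] assms(2,3)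
  by (intro sum_mono2) (auto simp: prod_nonneg less_imp_le)

lemma tree_sum_delete:
  "tree_sum c V (E - B) R D = tree_sum c V E R (\<lambda>T. D T \<and> T \<inter> B = {})"
  unfolding tree_sum_def trees_delete by (intro sum.cong) auto

text \<open>
  This is Rayleigh monotonicity for \<open>e\<close> in the graphs without and with \<open>f\<close>, written in terms of the four
  sums over the trees that contain or avoid \<open>e\<close> and \<open>f\<close>.
\<close>

lemma negative_correlation_pair:
  assumes fg: "finite_graph V E R" and ef: "e \<in> E" "f \<in> E" "e \<noteq> f" and c: "\<And>x. c x > 0"
  shows "tree_sum c V E R (\<lambda>T. e \<in> T \<and> f \<in> T) * tree_sum c V E R (\<lambda>_. True) \<le>
    tree_sum c V E R (\<lambda>T. e \<in> T) * tree_sum c V E R (\<lambda>T. f \<in> T)"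
proof -
  let ?S = "tree_sum c V E R"
  let ?E0 = "E - {e, f}"
  have fin: "finite E" using finite_graphD(1)[OF fg] .
  have E: "insert e (insert f ?E0) = E" "insert f ?E0 = E - {e}" "insert e ?E0 = E - {f}" using ef by auto
  have W: "c e * (\<Sum>F\<in>two_forests V (E - insert e B) R e. prod c F) = ?S (\<lambda>T. e \<in> T \<and> T \<inter> B = {})"
    if B: "e \<notin> B" for B
  proof -
    have E_B: "insert e (E - insert e B) = E - B" using ef B by auto
    then have "finite_graph V (insert e (E - insert e B)) R" "e \<notin> E - insert e B"
      using finite_graph_subset[OF fg, of "E - B"] by auto
    from two_forests_def[OF this] E_B
    have tf: "two_forests V (E - insert e B) R e = {F. F \<subseteq> E - insert e B \<and> insert e F \<in> trees V (E - B) R}"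
      by simp
    have "c e * prod c F = prod c (insert e F)" if "F \<in> two_forests V (E - insert e B) R e" for F
      using that fin finite_subset unfolding tf by (subst prod.insert) auto
    then have "c e * (\<Sum>F\<in>two_forests V (E - insert e B) R e. prod c F) =
        (\<Sum>F\<in>two_forests V (E - insert e B) R e. prod c (insert e F))"
      by (simp add: sum_distrib_left)
    also have "\<dots> = ?S (\<lambda>T. e \<in> T \<and> T \<inter> B = {})"
      unfolding tree_sum_def
      by (rule sum.reindex_bij_witness[where i = "\<lambda>T. T - {e}" and j = "insert e"])
        (auto simp: tf trees_delete insert_absorb, auto simp: trees_def)
    finally show ?thesis .
  qed
  have Z: "(\<Sum>T\<in>trees V (E - B) R. prod c T) = ?S (\<lambda>T. T \<inter> B = {})" for B
    unfolding tree_sum_def trees_delete by (rule sum.cong) auto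
  define a b p q where "a = ?S (\<lambda>T. e \<notin> T \<and> f \<notin> T)" and "b = ?S (\<lambda>T. e \<in> T \<and> f \<notin> T)"
    and "p = ?S (\<lambda>T. e \<notin> T \<and> f \<in> T)" and "q = ?S (\<lambda>T. e \<in> T \<and> f \<in> T)"
  have sums: "?S (\<lambda>T. e \<in> T) = q + b" "?S (\<lambda>T. e \<notin> T) = p + a"
    "?S (\<lambda>T. f \<in> T) = q + p" "?S (\<lambda>_. True) = (q + b) + (p + a)"
  proof -
    show 1: "?S (\<lambda>T. e \<in> T) = q + b" "?S (\<lambda>T. e \<notin> T) = p + a"
      unfolding a_def b_def p_def q_def by (rule tree_sum_split[OF fin])+
    show "?S (\<lambda>T. f \<in> T) = q + p"
      unfolding p_def q_def using tree_sum_split[OF fin, of c V R "\<lambda>T. f \<in> T" "\<lambda>T. e \<in> T"]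
      by (simp add: conj_commute)
    show "?S (\<lambda>_. True) = (q + b) + (p + a)"
      using tree_sum_split[OF fin, of c V R "\<lambda>_. True" "\<lambda>T. e \<in> T"] 1 by simp
  qed
  have "(\<Sum>T\<in>trees V ?E0 R. prod c T) * (\<Sum>F\<in>two_forests V (E - {e}) R e. prod c F) \<le>
    (\<Sum>F\<in>two_forests V ?E0 R e. prod c F) * (\<Sum>T\<in>trees V (E - {e}) R. prod c T)"
    using rayleigh_monotonicity[of V e f ?E0 R c] fg c ef unfolding E by (auto simp: insert_absorb)
  from mult_left_mono[OF this less_imp_le[OF c[of e]]]
  have "(\<Sum>T\<in>trees V ?E0 R. prod c T) * (c e * (\<Sum>F\<in>two_forests V (E - {e}) R e. prod c F)) \<le>
    (c e * (\<Sum>F\<in>two_forests V ?E0 R e. prod c F)) * (\<Sum>T\<in>trees V (E - {e}) R. prod c T)"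
    by (simp only: mult_ac)
  moreover have "?S (\<lambda>T. T \<inter> {e, f} = {}) = a" "?S (\<lambda>T. T \<inter> {e} = {}) = p + a"
    "?S (\<lambda>T. e \<in> T \<and> T \<inter> {} = {}) = q + b" "?S (\<lambda>T. e \<in> T \<and> T \<inter> {f} = {}) = b"
    using sums(1,2) by (auto simp: a_def b_def intro!: tree_sum_cong)
  \<comment> \<open>After cancellation of \<open>a * b\<close>, this is the usual form \<open>a * q \<le> b * p\<close> of negative correlation.\<close>
  ultimately have "a * (q + b) \<le> b * (p + a)"
    using W[of "{}"] W[of "{f}"] ef(3) unfolding Z by simp
  then show ?thesis unfolding sums q_def[symmetric] by (simp add: algebra_simps)
qed

lemma tree_sum_contract:
  assumes fg: "finite_graph V E R" and f: "f \<in> E"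
  shows "tree_sum c V E R (\<lambda>T. f \<in> T \<and> D T) =
    (if (src f, tgt f) \<in> joined {} R then 0
     else c f * tree_sum c V (E - {f}) (insert (src f, tgt f) R) (\<lambda>T. D (insert f T)))"
proof (cases "(src f, tgt f) \<in> joined {} R")
  case True
  have "{T. T \<in> trees V E R \<and> f \<in> T \<and> D T} = {}" using loop_not_in_tree[OF fg True] by auto
  then show ?thesis unfolding tree_sum_def by (simp only: True if_True sum.empty)
next
  case False
  note contract = trees_contract[OF fg False _ f]
  let ?R = "insert (src f, tgt f) R"
  have sub: "f \<notin> T" "finite T" if "T \<in> trees V (E - {f}) ?R" for T
    using that finite_graphD(1)[OF fg] by (auto simp: trees_def intro: finite_subset)
  have "tree_sum c V E R (\<lambda>T. f \<in> T \<and> D T) =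
      (\<Sum>T | T \<in> trees V (E - {f}) ?R \<and> D (insert f T). prod c (insert f T))"
    unfolding tree_sum_def
  proof (rule sum.reindex_bij_witness[where i = "insert f" and j = "\<lambda>T. T - {f}"])
    fix T assume T: "T \<in> {T \<in> trees V E R. f \<in> T \<and> D T}"
    then show "T - {f} \<in> {T \<in> trees V (E - {f}) ?R. D (insert f T)}"
      using contract[of "T - {f}"] by (auto simp: insert_absorb)
  qed (use contract sub in \<open>auto simp: insert_absorb\<close>)
  also have "\<dots> = (\<Sum>T | T \<in> trees V (E - {f}) ?R \<and> D (insert f T). c f * prod c T)"
    using sub by (intro sum.cong) (auto simp: prod.insert)
  finally show ?thesis using False by (simp add: tree_sum_def sum_distrib_left)
qed

lemma tree_sum_delete_edge:
  "tree_sum c V (E - {f}) R D = tree_sum c V E R (\<lambda>T. D T \<and> f \<notin> T)"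
proof -
  have "T \<inter> {f} = {} \<longleftrightarrow> f \<notin> T" for T by auto
  then show ?thesis using tree_sum_delete[of c V E "{f}" R D] by simp
qed

text \<open>
  Induction on \<open>A\<close>: contract one of its edges \<open>a\<close>, use the induction hypothesis in the contracted
  graph, and negative correlation of \<open>a\<close> and \<open>f\<close> in the original one.
\<close>

lemma negative_correlation_cylinder:
  assumes "finite_graph V E R" "A \<subseteq> E" "f \<in> E" "f \<notin> A" and c: "\<And>x. c x > 0"
  shows "tree_sum c V E R (\<lambda>T. A \<subseteq> T \<and> f \<in> T) * tree_sum c V E R (\<lambda>_. True) \<le>
    tree_sum c V E R (\<lambda>T. A \<subseteq> T) * tree_sum c V E R (\<lambda>T. f \<in> T)"
proof -
  have "finite A" using assms finite_graphD(1) finite_subset by blast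
  then show ?thesis using assms(1-4)
  proof (induction A arbitrary: E R)
    case empty
    then show ?case by (simp add: mult.commute)
  next
    case (insert a A)
    note fg = insert.prems(1)
    have a: "a \<in> E" "a \<noteq> f" using insert.prems by auto
    note contract = tree_sum_contract[OF fg a(1), of c]
    note nonneg = tree_sum_nonneg[OF c]
    let ?S = "tree_sum c V E R" and ?S' = "tree_sum c V (E - {a}) (insert (src a, tgt a) R)"
    show ?case
    proof (cases "(src a, tgt a) \<in> joined {} R")
      case True
      have "?S (\<lambda>T. insert a A \<subseteq> T \<and> f \<in> T) = ?S (\<lambda>T. a \<in> T \<and> (A \<subseteq> T \<and> f \<in> T))"
        by (intro tree_sum_cong) auto
      also have "\<dots> = 0" using contract True by simp
      finally show ?thesis using nonneg by simp
    next
      case False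
      have S: "?S (\<lambda>T. insert a A \<subseteq> T \<and> f \<in> T) = c a * ?S' (\<lambda>T. A \<subseteq> T \<and> f \<in> T)"
        "?S (\<lambda>T. insert a A \<subseteq> T) = c a * ?S' (\<lambda>T. A \<subseteq> T)"
        "?S (\<lambda>T. a \<in> T \<and> f \<in> T) = c a * ?S' (\<lambda>T. f \<in> T)"
        "?S (\<lambda>T. a \<in> T) = c a * ?S' (\<lambda>_. True)"
      proof -
        have "A \<subseteq> insert a T \<longleftrightarrow> A \<subseteq> T" for T using insert.hyps by auto
        then show "?S (\<lambda>T. insert a A \<subseteq> T \<and> f \<in> T) = c a * ?S' (\<lambda>T. A \<subseteq> T \<and> f \<in> T)"
          "?S (\<lambda>T. insert a A \<subseteq> T) = c a * ?S' (\<lambda>T. A \<subseteq> T)"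
          "?S (\<lambda>T. a \<in> T \<and> f \<in> T) = c a * ?S' (\<lambda>T. f \<in> T)"
          "?S (\<lambda>T. a \<in> T) = c a * ?S' (\<lambda>_. True)"
          using contract[of "\<lambda>T. A \<subseteq> T \<and> f \<in> T"] contract[of "\<lambda>T. A \<subseteq> T"]
            contract[of "\<lambda>T. f \<in> T"] contract[of "\<lambda>_. True"] False a by auto
      qed
      define q p y z where "q = ?S' (\<lambda>T. A \<subseteq> T \<and> f \<in> T)" and "p = ?S' (\<lambda>T. A \<subseteq> T)"
        and "y = ?S' (\<lambda>T. f \<in> T)" and "z = ?S' (\<lambda>_. True)"
      note defs = q_def p_def y_def z_def
      have IH: "q * z \<le> p * y"
        unfolding defs using insert.prems insert.hyps a
        by (intro insert.IH finite_graph_contract[OF fg]) auto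
      have "c a * y * ?S (\<lambda>_. True) \<le> c a * z * ?S (\<lambda>T. f \<in> T)"
        using negative_correlation_pair[OF fg a(1) insert.prems(3) a(2), of c] c unfolding S defs by blast
      then have pair: "y * ?S (\<lambda>_. True) \<le> z * ?S (\<lambda>T. f \<in> T)"
        using c[of a] by (simp add: mult.assoc)
      have nn: "0 \<le> q" "0 \<le> p" "0 \<le> y" "0 \<le> z" "q \<le> z"
        unfolding defs using finite_graphD(1)[OF fg]
        by (intro nonneg tree_sum_mono c; simp)+
      have "q * ?S (\<lambda>_. True) \<le> p * ?S (\<lambda>T. f \<in> T)"
      proof (cases "z = 0")
        case True
        then show ?thesis using nn nonneg by simp
      next
        case False
        have "z * (q * ?S (\<lambda>_. True)) = (q * z) * ?S (\<lambda>_. True)" by simp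
        also have "\<dots> \<le> (p * y) * ?S (\<lambda>_. True)" by (intro mult_right_mono IH nonneg)
        also have "\<dots> = p * (y * ?S (\<lambda>_. True))" by simp
        also have "\<dots> \<le> p * (z * ?S (\<lambda>T. f \<in> T))" by (intro mult_left_mono pair nn)
        also have "\<dots> = z * (p * ?S (\<lambda>T. f \<in> T))" by simp
        finally show ?thesis using False nn(4) by simp
      qed
      then show ?thesis using c[of a] unfolding S defs[symmetric] by (simp add: mult.assoc)
    qed
  qed
qed

text \<open>
  Besides the events \<open>A \<subseteq> T\<close> (empty \<open>B\<close>), whose probabilities define weak convergence, this family contains the
  events with a singleton \<open>B\<close> that are used to reduce the comparison of two tree measures to single edges.
\<close>

definition meets_or_contains :: "'e set \<Rightarrow> 'e set \<Rightarrow> 'e set \<Rightarrow> bool" where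
  "meets_or_contains B A T \<longleftrightarrow> B \<inter> T \<noteq> {} \<or> A \<subseteq> T"

text \<open>
  Induction on \<open>B\<close>: on the trees that avoid a given edge \<open>a\<close> of \<open>B\<close>, the induction hypothesis applies in the
  graph from which \<open>a\<close> has been deleted, and \<open>a\<close> and \<open>f\<close> themselves are negatively correlated.
\<close>

lemma negative_correlation:
  assumes "finite_graph V E R" "A \<subseteq> E" "B \<subseteq> E" "A \<inter> B = {}" "f \<in> E" "f \<notin> A" "f \<notin> B"
    and c: "\<And>x. c x > 0"
  shows "tree_sum c V E R (\<lambda>T. meets_or_contains B A T \<and> f \<in> T) * tree_sum c V E R (\<lambda>_. True) \<le>
    tree_sum c V E R (meets_or_contains B A) * tree_sum c V E R (\<lambda>T. f \<in> T)"
proof -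
  have "finite B" using assms finite_graphD(1) finite_subset by blast
  then show ?thesis using assms(1-7)
  proof (induction B arbitrary: E)
    case empty
    then show ?case using negative_correlation_cylinder[OF empty(1,2,5,6) c]
      by (simp add: meets_or_contains_def)
  next
    case (insert a B)
    note fg = insert.prems(1)
    have fin: "finite E" using finite_graphD(1)[OF fg] .
    have a: "a \<in> E" "a \<noteq> f" "a \<notin> A" using insert.prems by auto
    let ?S = "tree_sum c V E R" and ?S' = "tree_sum c V (E - {a}) R"
    let ?D = "meets_or_contains B A"
    have D: "meets_or_contains (insert a B) A T \<longleftrightarrow> a \<in> T \<or> ?D T" for T
      by (auto simp: meets_or_contains_def)
    have S': "?S' X = ?S (\<lambda>T. X T \<and> a \<notin> T)" for X
      by (rule tree_sum_delete_edge)
    define x X where "x = ?S (\<lambda>T. a \<in> T \<and> f \<in> T)" and "X = ?S (\<lambda>T. a \<in> T)"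
    define n nf nD nDf where "n = ?S' (\<lambda>_. True)" and "nf = ?S' (\<lambda>T. f \<in> T)" and "nD = ?S' ?D"
      and "nDf = ?S' (\<lambda>T. ?D T \<and> f \<in> T)"
    note defs = x_def X_def n_def nf_def nD_def nDf_def
    have IH: "nDf * n \<le> nD * nf"
      unfolding defs using insert.prems a insert.hyps
      by (intro insert.IH finite_graph_subset[OF fg]) auto
    have sums: "?S (\<lambda>_. True) = X + n" "?S (\<lambda>T. f \<in> T) = x + nf"
      "?S (meets_or_contains (insert a B) A) = X + nD"
      "?S (\<lambda>T. meets_or_contains (insert a B) A T \<and> f \<in> T) = x + nDf"
      unfolding defs S'
      by (subst tree_sum_split[OF fin, of _ _ _ _ "\<lambda>T. a \<in> T"];
          intro arg_cong2[of _ _ _ _ "(+)"] tree_sum_cong; auto simp: D)+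
    have "x * (X + n) \<le> X * (x + nf)"
      using negative_correlation_pair[OF fg a(1) insert.prems(5) a(2), of c] c
      unfolding sums x_def[symmetric] X_def[symmetric] by blast
    then have pair: "x * n \<le> X * nf" by (simp add: algebra_simps)
    have nn: "0 \<le> x" "0 \<le> X" "0 \<le> n" "0 \<le> nf" "0 \<le> nD" "0 \<le> nDf" "nD \<le> n" "nf \<le> n" "nDf \<le> n"
      unfolding defs using fin by (intro tree_sum_nonneg tree_sum_mono c; simp)+
    have "(x + nDf) * (X + n) \<le> (X + nD) * (x + nf)"
    proof (cases "n = 0")
      case True
      then show ?thesis using nn by simp
    next
      case False
      have "n * (x * (n - nD) + nDf * (X + n)) = (x * n) * (n - nD) + (nDf * n) * (X + n)"
        by (simp add: algebra_simps)
      also have "\<dots> \<le> (X * nf) * (n - nD) + (nD * nf) * (X + n)"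
        using nn by (intro add_mono mult_right_mono pair IH) auto
      also have "\<dots> = n * (X * nf + nD * nf)" by (simp add: algebra_simps)
      finally have "x * (n - nD) + nDf * (X + n) \<le> X * nf + nD * nf"
        using False nn by simp
      then show ?thesis by (simp add: algebra_simps)
    qed
    then show ?case unfolding sums .
  qed
qed

section \<open>Deletion, contraction and pendant edges\<close>

definition tree_prob :: "('e \<Rightarrow> real) \<Rightarrow> 'v set \<Rightarrow> 'e set \<Rightarrow> 'v rel \<Rightarrow> ('e set \<Rightarrow> bool) \<Rightarrow> real" where
  "tree_prob c V E R D = tree_sum c V E R D / tree_sum c V E R (\<lambda>_. True)"

lemma tree_sum_pos_iff:
  assumes "finite E" "\<And>x. c x > 0"
  shows "tree_sum c V E R (\<lambda>_. True) > 0 \<longleftrightarrow> trees V E R \<noteq> {}"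
proof
  assume "trees V E R \<noteq> {}"
  then show "tree_sum c V E R (\<lambda>_. True) > 0"
    unfolding tree_sum_def using finite_trees[OF assms(1)] assms(2)
    by (intro sum_pos) (auto intro: prod_pos)
qed (auto simp: tree_sum_def)

lemma tree_prob_nonneg: "(\<And>x. c x > 0) \<Longrightarrow> tree_prob c V E R D \<ge> 0"
  unfolding tree_prob_def by (simp add: tree_sum_nonneg)

lemma tree_prob_le_1: "finite E \<Longrightarrow> (\<And>x. c x > 0) \<Longrightarrow> tree_prob c V E R D \<le> 1"
  unfolding tree_prob_def using tree_sum_mono[of E c V R D "\<lambda>_. True"] tree_sum_nonneg[of c V E R "\<lambda>_. True"]
  by (auto simp: divide_le_eq_1)

text \<open>
  The graph without \<open>f\<close> carries the law of the tree conditioned to avoid \<open>f\<close>.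
\<close>

lemma tree_prob_delete_edge:
  assumes fg: "finite_graph V E R" and D: "A \<subseteq> E" "B \<subseteq> E" "A \<inter> B = {}" and f: "f \<in> E" "f \<notin> A" "f \<notin> B"
    and c: "\<And>x. c x > 0" and ne: "trees V (E - {f}) R \<noteq> {}"
  shows "tree_prob c V E R (meets_or_contains B A) \<le> tree_prob c V (E - {f}) R (meets_or_contains B A)"
proof -
  have fin: "finite E" using finite_graphD(1)[OF fg] .
  let ?S = "tree_sum c V E R" and ?S' = "tree_sum c V (E - {f}) R" and ?D = "meets_or_contains B A"
  have S': "?S' X = ?S (\<lambda>T. X T \<and> f \<notin> T)" for X
    by (rule tree_sum_delete_edge)
  have split: "?S X = ?S (\<lambda>T. X T \<and> f \<in> T) + ?S' X" for X
    unfolding S' by (rule tree_sum_split[OF fin])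
  have pos: "?S' (\<lambda>_. True) > 0" using tree_sum_pos_iff[of "E - {f}" c V R] fin c ne by auto
  have nc: "?S (\<lambda>T. ?D T \<and> f \<in> T) * ?S (\<lambda>_. True) \<le> ?S ?D * ?S (\<lambda>T. f \<in> T)"
    by (rule negative_correlation[OF fg D f c])
  have "?S ?D * ?S' (\<lambda>_. True) \<le> ?S' ?D * ?S (\<lambda>_. True)"
    using nc split[of ?D] split[of "\<lambda>_. True"] by (simp add: algebra_simps)
  moreover have "?S (\<lambda>_. True) > 0"
    using pos split[of "\<lambda>_. True"] tree_sum_nonneg[of c V E R "\<lambda>T. f \<in> T"] c by simp
  ultimately show ?thesis using pos unfolding tree_prob_def by (simp add: field_simps)
qed

lemma tree_prob_delete:
  assumes fg: "finite_graph V E R" and D: "A \<subseteq> E" "B \<subseteq> E" "A \<inter> B = {}"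
    and F: "F \<inter> A = {}" "F \<inter> B = {}" "F \<subseteq> E"
    and c: "\<And>x. c x > 0" and ne: "trees V (E - F) R \<noteq> {}"
  shows "tree_prob c V E R (meets_or_contains B A) \<le> tree_prob c V (E - F) R (meets_or_contains B A)"
proof -
  have "finite F" using F(3) finite_graphD(1)[OF fg] finite_subset by blast
  then show ?thesis using F ne
  proof (induction F)
    case (insert f F)
    have E: "E - insert f F = (E - F) - {f}" by auto
    have "trees V (E - F) R \<noteq> {}"
      using insert.prems(4) unfolding trees_delete by blast
    then have "tree_prob c V E R (meets_or_contains B A) \<le> tree_prob c V (E - F) R (meets_or_contains B A)"
      using insert by auto
    also have "\<dots> \<le> tree_prob c V (E - F - {f}) R (meets_or_contains B A)"
      using insert D by (intro tree_prob_delete_edge finite_graph_subset[OF fg] c) (auto simp flip: E)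
    finally show ?case unfolding E .
  qed simp
qed

text \<open>
  The graph with \<open>f\<close> contracted carries the law of the tree conditioned to contain \<open>f\<close>, unless \<open>f\<close> is a
  loop; then its contraction changes nothing.
\<close>

lemma tree_prob_contract_edge:
  assumes fg: "finite_graph V E R" and D: "A \<subseteq> E" "B \<subseteq> E" "A \<inter> B = {}" and f: "f \<in> E" "f \<notin> A" "f \<notin> B"
    and c: "\<And>x. c x > 0"
  shows "tree_prob c V (E - {f}) (insert (src f, tgt f) R) (meets_or_contains B A)
    \<le> tree_prob c V E R (meets_or_contains B A)"
proof -
  let ?S = "tree_sum c V E R" and ?D = "meets_or_contains B A"
  let ?S' = "tree_sum c V (E - {f}) (insert (src f, tgt f) R)"
  have fin: "finite E" using finite_graphD(1)[OF fg] .
  show ?thesis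
  proof (cases "(src f, tgt f) \<in> joined {} R")
    case True
    have "joined {} (insert (src f, tgt f) R) = joined {} R"
      unfolding joined_insert_rel by (rule joined_insert_redundant[OF True])
    then have "trees V (E - {f}) (insert (src f, tgt f) R) = trees V (E - {f}) R"
      by (rule trees_cong_rel)
    also have "\<dots> = trees V E R"
      unfolding trees_delete using loop_not_in_tree[OF fg True] by auto
    finally show ?thesis by (simp add: tree_prob_def tree_sum_def)
  next
    case False
    have ins: "?D (insert f T) = ?D T" for T
      using f by (auto simp: meets_or_contains_def)
    have SD: "?S (\<lambda>T. ?D T \<and> f \<in> T) = c f * ?S' ?D" "?S (\<lambda>T. f \<in> T) = c f * ?S' (\<lambda>_. True)"
      using tree_sum_contract[OF fg f(1), of c ?D] tree_sum_contract[OF fg f(1), of c "\<lambda>_. True"] False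
      by (simp_all add: ins conj_commute)
    have "(c f * ?S' ?D) * ?S (\<lambda>_. True) \<le> ?S ?D * (c f * ?S' (\<lambda>_. True))"
      using negative_correlation[OF fg D f, of c] c unfolding SD by blast
    then have le: "?S' ?D * ?S (\<lambda>_. True) \<le> ?S ?D * ?S' (\<lambda>_. True)"
      using c[of f] by (simp add: mult.assoc mult.left_commute)
    show ?thesis
    proof (cases "?S' (\<lambda>_. True) = 0")
      case True
      then show ?thesis using tree_prob_nonneg[OF c] by (simp add: tree_prob_def)
    next
      case False
      then have "?S' (\<lambda>_. True) > 0" using tree_sum_nonneg[OF c] by (simp add: less_le)
      moreover have "?S (\<lambda>_. True) > 0"
      proof -
        have "0 < c f * ?S' (\<lambda>_. True)" using calculation c by simp
        also have "\<dots> \<le> ?S (\<lambda>_. True)"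
          unfolding SD(2)[symmetric] using fin c by (intro tree_sum_mono) auto
        finally show ?thesis .
      qed
      ultimately show ?thesis using le unfolding tree_prob_def by (simp add: field_simps)
    qed
  qed
qed

lemma tree_prob_contract:
  assumes fg: "finite_graph V E R" and D: "A \<subseteq> E" "B \<subseteq> E" "A \<inter> B = {}"
    and F: "F \<inter> A = {}" "F \<inter> B = {}" "F \<subseteq> E" and c: "\<And>x. c x > 0"
  shows "tree_prob c V (E - F) ((\<lambda>e. (src e, tgt e)) ` F \<union> R) (meets_or_contains B A)
    \<le> tree_prob c V E R (meets_or_contains B A)"
proof -
  have "finite F" using F(3) finite_graphD(1)[OF fg] finite_subset by blast
  then have "finite_graph V (E - F) ((\<lambda>e. (src e, tgt e)) ` F \<union> R) \<and>
    tree_prob c V (E - F) ((\<lambda>e. (src e, tgt e)) ` F \<union> R) (meets_or_contains B A)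
    \<le> tree_prob c V E R (meets_or_contains B A)" using F
  proof (induction F)
    case empty
    then show ?case using fg by simp
  next
    case (insert f F)
    let ?R = "(\<lambda>e. (src e, tgt e)) ` F \<union> R"
    have E: "E - insert f F = (E - F) - {f}"
      "(\<lambda>e. (src e, tgt e)) ` insert f F \<union> R = insert (src f, tgt f) ?R" by auto
    have IH: "finite_graph V (E - F) ?R"
      "tree_prob c V (E - F) ?R (meets_or_contains B A) \<le> tree_prob c V E R (meets_or_contains B A)"
      using insert by auto
    have "tree_prob c V (E - F - {f}) (insert (src f, tgt f) ?R) (meets_or_contains B A)
        \<le> tree_prob c V (E - F) ?R (meets_or_contains B A)"
      using insert D by (intro tree_prob_contract_edge IH c) auto
    then show ?case unfolding E using finite_graph_contract[OF IH(1)] IH(2) by simp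
  qed
  then show ?thesis by simp
qed

lemma tree_prob_either:
  assumes "finite E"
  shows "tree_prob c V E R (meets_or_contains {a} K) =
    tree_prob c V E R (\<lambda>T. {a} \<subseteq> T) + tree_prob c V E R (\<lambda>T. K \<subseteq> T) - tree_prob c V E R (\<lambda>T. insert a K \<subseteq> T)"
proof -
  let ?S = "tree_sum c V E R"
  have "?S (meets_or_contains {a} K) = ?S (\<lambda>T. {a} \<subseteq> T) + ?S (\<lambda>T. K \<subseteq> T \<and> a \<notin> T)"
    by (subst tree_sum_split[OF assms, of _ _ _ _ "\<lambda>T. a \<in> T"])
      (intro arg_cong2[of _ _ _ _ "(+)"] tree_sum_cong; auto simp: meets_or_contains_def)
  moreover have "?S (\<lambda>T. K \<subseteq> T) = ?S (\<lambda>T. insert a K \<subseteq> T) + ?S (\<lambda>T. K \<subseteq> T \<and> a \<notin> T)"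
    by (subst tree_sum_split[OF assms, of _ _ _ _ "\<lambda>T. a \<in> T"])
      (intro arg_cong2[of _ _ _ _ "(+)"] tree_sum_cong; auto)
  ultimately have "?S (meets_or_contains {a} K) =
      ?S (\<lambda>T. {a} \<subseteq> T) + ?S (\<lambda>T. K \<subseteq> T) - ?S (\<lambda>T. insert a K \<subseteq> T)" by linarith
  then show ?thesis unfolding tree_prob_def by (simp only: add_divide_distrib diff_divide_distrib)
qed

lemma meets_or_contains_empty: "meets_or_contains {} K = (\<lambda>T. K \<subseteq> T)"
  by (rule ext) (simp add: meets_or_contains_def)

lemma tree_prob_eq_0: "(\<And>T. T \<in> trees V E R \<Longrightarrow> \<not> D T) \<Longrightarrow> tree_prob c V E R D = 0"
  using tree_sum_cong[of V E R D "\<lambda>_. False" c] by (simp add: tree_prob_def tree_sum_def)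

lemma joined_empty: "joined {} (C \<times> C) = Id \<union> C \<times> C"
proof (intro equalityI subrelI)
  fix x y assume "(x, y) \<in> joined {} (C \<times> C)"
  then show "(x, y) \<in> Id \<union> C \<times> C" by (induction rule: joined_induct) auto
next
  fix x y assume "(x, y) \<in> Id \<union> C \<times> C"
  then show "(x, y) \<in> joined {} (C \<times> C)" by (auto intro: joined_rel)
qed

lemma quotient_block:
  assumes "V \<inter> C = {}" "C \<noteq> {}"
  shows "(V \<union> C) // joined {} (C \<times> C) = insert C ((\<lambda>v. {v}) ` V)"
proof -
  have "joined {} (C \<times> C) `` {x} = (if x \<in> C then C else {x})" for x
    unfolding joined_empty by auto
  then have "(V \<union> C) // joined {} (C \<times> C) = (\<lambda>x. if x \<in> C then C else {x}) ` (V \<union> C)"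
    by (auto simp: quotient_def)
  also have "\<dots> = insert C ((\<lambda>v. {v}) ` V)"
  proof -
    have "(\<lambda>x. if x \<in> C then C else {x}) ` V = (\<lambda>v. {v}) ` V"
      using assms(1) by (intro image_cong) auto
    moreover have "(\<lambda>x. if x \<in> C then C else {x}) ` C = {C}" using assms(2) by auto
    ultimately show ?thesis by (simp only: image_Un Un_insert_right Un_empty_right)
  qed
  finally show ?thesis .
qed

lemma quotient_discrete: "V // joined {} {} = (\<lambda>v. {v}) ` V"
  using joined_empty[of "{}"] by (auto simp: quotient_def)

lemma finite_graph_discrete:
  "finite_graph V E {} \<longleftrightarrow> finite E \<and> V \<noteq> {} \<and> finite V \<and> (\<forall>e\<in>E. src e \<in> V \<and> tgt e \<in> V)"
  unfolding finite_graph_def quotient_discrete by (auto dest: finite_imageD)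

text \<open>
  Mapping all of \<open>C\<close> to the end \<open>u\<close> of the single edge \<open>g\<close> between \<open>V\<close> and \<open>C\<close> sends walks to walks that
  do not use \<open>g\<close>.
\<close>

lemma pendant_retract:
  assumes V: "V \<inter> C = {}" and E: "\<And>e. e \<in> E \<Longrightarrow> src e \<in> V \<and> tgt e \<in> V"
    and g: "{src g, tgt g} = {u, w}" "u \<in> V" "w \<in> C" and T: "T \<subseteq> insert g E"
    and xy: "(x, y) \<in> joined T (C \<times> C)"
  shows "(if x \<in> C then u else x, if y \<in> C then u else y) \<in> joined (T - {g}) {}"
  using xy
proof (induction rule: joined_induct)
  case (edge e)
  show ?case
  proof (cases "e = g")
    case True
    then show ?thesis using g V by (auto simp: doubleton_eq_iff)
  next
    case False
    then have "src e \<notin> C" "tgt e \<notin> C" using edge T E[of e] V by auto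
    then show ?thesis using False edge by (auto intro: joined_edge)
  qed
qed (auto intro: joined_sym dest: joined_trans)

text \<open>
  With \<open>C\<close> contracted to one vertex, \<open>g\<close> is a pendant edge, and every spanning tree must contain it.
\<close>

lemma trees_pendant:
  assumes V: "finite V" "V \<inter> C = {}" and E: "finite E" "\<And>e. e \<in> E \<Longrightarrow> src e \<in> V \<and> tgt e \<in> V"
    and g: "{src g, tgt g} = {u, w}" "u \<in> V" "w \<in> C"
  shows "trees (V \<union> C) (insert g E) (C \<times> C) = insert g ` trees V E {}"
proof -
  have gE: "g \<notin> E" using E(2)[of g] g V by (auto simp: doubleton_eq_iff)
  have cards: "card ((V \<union> C) // joined {} (C \<times> C)) = Suc (card V)" "card (V // joined {} {}) = card V"
  proof -
    have "C \<notin> (\<lambda>v. {v}) ` V" using V g by auto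
    then show "card ((V \<union> C) // joined {} (C \<times> C)) = Suc (card V)"
      using V g by (subst quotient_block) (auto simp: card_image)
    show "card (V // joined {} {}) = card V" by (simp add: quotient_discrete card_image)
  qed
  have gT: "g \<in> T" if "T \<in> trees (V \<union> C) (insert g E) (C \<times> C)" for T
  proof (rule ccontr)
    assume "g \<notin> T"
    then have "T \<subseteq> E" using that by (auto simp: trees_def)
    have "(u, w) \<in> joined T (C \<times> C)" using that g by (auto simp: trees_def)
    then have "(u \<in> C) = (w \<in> C)"
      by (rule joined_const) (use \<open>T \<subseteq> E\<close> E(2) V in blast)+
    then show False using g V by auto
  qed
  have iff: "insert g T \<in> trees (V \<union> C) (insert g E) (C \<times> C) \<longleftrightarrow> T \<in> trees V E {}" if T: "T \<subseteq> E" for T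
  proof -
    have gT: "g \<notin> T" and "finite T" using T gE E(1) by (auto intro: finite_subset)
    have "(V \<union> C) \<times> (V \<union> C) \<subseteq> joined (insert g T) (C \<times> C) \<longleftrightarrow> V \<times> V \<subseteq> joined T {}"
    proof
      assume span: "(V \<union> C) \<times> (V \<union> C) \<subseteq> joined (insert g T) (C \<times> C)"
      show "V \<times> V \<subseteq> joined T {}"
      proof clarify
        fix x y assume xy: "x \<in> V" "y \<in> V"
        then have "(x, y) \<in> joined (insert g T) (C \<times> C)" using span by auto
        moreover have "insert g T \<subseteq> insert g E" using T by auto
        ultimately have "(if x \<in> C then u else x, if y \<in> C then u else y) \<in> joined (insert g T - {g}) {}"
          using pendant_retract[OF V(2) E(2) g] by blast
        moreover have "x \<notin> C" "y \<notin> C" using xy V by auto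
        moreover have "insert g T - {g} = T" using gT by auto
        ultimately show "(x, y) \<in> joined T {}" by simp
      qed
    next
      assume span: "V \<times> V \<subseteq> joined T {}"
      have uw: "(u, w) \<in> joined (insert g T) (C \<times> C)"
        using joined_edge[of g "insert g T" "C \<times> C"] joined_sym[of "src g" "tgt g"] g(1)
        by (auto simp: doubleton_eq_iff)
      have "(u, x) \<in> joined (insert g T) (C \<times> C)" if "x \<in> V \<union> C" for x
      proof (cases "x \<in> C")
        case True
        then show ?thesis using g by (intro joined_trans[OF uw] joined_rel) auto
      next
        case False
        then have "(u, x) \<in> joined T {}" using that g span by auto
        then show ?thesis by (rule joined_monoD) auto
      qed
      then show "(V \<union> C) \<times> (V \<union> C) \<subseteq> joined (insert g T) (C \<times> C)"
        using joined_sym joined_trans by blast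
    qed
    then show ?thesis using cards gT T \<open>finite T\<close> by (auto simp: trees_def)
  qed
  show ?thesis
  proof (intro equalityI subsetI)
    fix T assume T: "T \<in> trees (V \<union> C) (insert g E) (C \<times> C)"
    have "T - {g} \<in> trees V E {}"
      using iff[of "T - {g}"] T gT[OF T] by (auto simp: trees_def insert_absorb)
    then show "T \<in> insert g ` trees V E {}"
      using gT[OF T] by (intro image_eqI[of _ _ "T - {g}"]) auto
  next
    fix T assume "T \<in> insert g ` trees V E {}"
    then show "T \<in> trees (V \<union> C) (insert g E) (C \<times> C)"
      using iff by (auto simp: trees_def)
  qed
qed

lemma tree_sum_pendant:
  assumes V: "finite V" "V \<inter> C = {}" and E: "finite E" "\<And>e. e \<in> E \<Longrightarrow> src e \<in> V \<and> tgt e \<in> V"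
    and g: "{src g, tgt g} = {u, w}" "u \<in> V" "w \<in> C"
    and D: "\<And>T. D (insert g T) \<longleftrightarrow> D T"
  shows "tree_sum c (V \<union> C) (insert g E) (C \<times> C) D = c g * tree_sum c V E {} D"
proof -
  have gT: "g \<notin> T" "finite T" if "T \<in> trees V E {}" for T
  proof -
    show "g \<notin> T" using that E(2)[of g] g V by (auto simp: doubleton_eq_iff trees_def)
    show "finite T" using that E(1) by (auto simp: trees_def intro: finite_subset)
  qed
  have "{T. T \<in> trees (V \<union> C) (insert g E) (C \<times> C) \<and> D T} =
      insert g ` {T. T \<in> trees V E {} \<and> D T}"
    using trees_pendant[OF V(1,2) E g] by (auto simp: D)
  then have "tree_sum c (V \<union> C) (insert g E) (C \<times> C) D =
      (\<Sum>T\<in>insert g ` {T. T \<in> trees V E {} \<and> D T}. prod c T)"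
    unfolding tree_sum_def by (rule arg_cong)
  also have "\<dots> = (\<Sum>T | T \<in> trees V E {} \<and> D T. c g * prod c T)"
    using gT by (subst sum.reindex) (auto intro!: inj_onI simp: insert_ident)
  finally show ?thesis by (simp add: tree_sum_def sum_distrib_left)
qed

text \<open>
  Delete all edges between \<open>V\<close> and the new vertex but one; the remaining one is pendant and does not
  influence the rest of the tree. The new vertex is represented by a contracted set \<open>C\<close>, which is a
  singleton when a free graph grows and the complement of \<open>V\<close> when the boundary vertex of a wired graph
  is added.
\<close>

lemma tree_prob_grow:
  assumes V: "finite V" "V \<inter> C = {}" "V \<noteq> {}"
    and E: "finite E" "\<And>e. e \<in> E \<Longrightarrow> src e \<in> V \<and> tgt e \<in> V"
    and F: "finite F" "F \<noteq> {}" "\<And>g. g \<in> F \<Longrightarrow> \<exists>u\<in>V. \<exists>w\<in>C. {src g, tgt g} = {u, w}"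
    and D: "A \<subseteq> E" "B \<subseteq> E" "A \<inter> B = {}" and c: "\<And>x. c x > 0"
    and ne: "trees V E {} \<noteq> {}"
  shows "tree_prob c (V \<union> C) (E \<union> F) (C \<times> C) (meets_or_contains B A)
    \<le> tree_prob c V E {} (meets_or_contains B A)"
    and "trees (V \<union> C) (E \<union> F) (C \<times> C) \<noteq> {}"
proof -
  let ?D = "meets_or_contains B A"
  \<comment> \<open>the edge that is kept and becomes pendant\<close>
  obtain g where gF: "g \<in> F" using F(2) by auto
  then obtain u w where g: "{src g, tgt g} = {u, w}" "u \<in> V" "w \<in> C" using F(3) by blast
  have EF: "E \<inter> F = {}"
  proof (rule ccontr)
    assume "E \<inter> F \<noteq> {}"
    then obtain h where h: "h \<in> E" "h \<in> F" by auto
    then obtain u w where "{src h, tgt h} = {u, w}" "w \<in> C" using F(3) by blast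
    then show False using E(2)[OF h(1)] V(2) by (auto simp: doubleton_eq_iff)
  qed
  have del: "E \<union> F - (F - {g}) = insert g E" using EF gF by auto
  have ne': "trees (V \<union> C) (insert g E) (C \<times> C) \<noteq> {}"
    using ne by (simp add: trees_pendant[OF V(1,2) E g])
  have "trees (V \<union> C) (E \<union> F - (F - {g})) (C \<times> C) \<noteq> {}" using ne' del by simp
  then show "trees (V \<union> C) (E \<union> F) (C \<times> C) \<noteq> {}"
    unfolding trees_delete by blast
  have "finite ((V \<union> C) // joined {} (C \<times> C))"
    using V g by (subst quotient_block) auto
  then have fg: "finite_graph (V \<union> C) (E \<union> F) (C \<times> C)"
    using V E F unfolding finite_graph_def
    by (fastforce simp: doubleton_eq_iff)
  have DF: "(F - {g}) \<inter> A = {}" "(F - {g}) \<inter> B = {}" "F - {g} \<subseteq> E \<union> F" and DE: "A \<subseteq> E \<union> F" "B \<subseteq> E \<union> F"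
    using D EF by auto
  have "tree_prob c (V \<union> C) (E \<union> F) (C \<times> C) ?D \<le> tree_prob c (V \<union> C) (insert g E) (C \<times> C) ?D"
    using tree_prob_delete[OF fg DE D(3) DF, of c] c ne' unfolding del by blast
  also have "\<dots> = tree_prob c V E {} ?D"
  proof -
    have "?D (insert g T) = ?D T" for T
      using D EF gF by (auto simp: meets_or_contains_def)
    then show ?thesis
      using tree_sum_pendant[OF V(1,2) E g, of ?D c] tree_sum_pendant[OF V(1,2) E g, of "\<lambda>_. True" c] c[of g]
      unfolding tree_prob_def by simp
  qed
  finally show "tree_prob c (V \<union> C) (E \<union> F) (C \<times> C) ?D \<le> tree_prob c V E {} ?D" .
qed

section \<open>Edge counts and automorphisms\<close>

text \<open>
  All spanning trees have the same number of edges.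
\<close>

lemma sum_tree_prob_edges:
  assumes fin: "finite E" and c: "\<And>x. c x > 0" and ne: "trees V E R \<noteq> {}"
  shows "(\<Sum>e\<in>E. tree_prob c V E R (\<lambda>T. e \<in> T)) = real (card (V // joined {} R)) - 1"
proof -
  let ?n = "real (card (V // joined {} R)) - 1"
  have finT: "finite (trees V E R)" using finite_trees[OF fin] .
  have T: "T \<subseteq> E" "real (card T) = ?n" if "T \<in> trees V E R" for T
    using that by (auto simp: trees_def)
  have "(\<Sum>e\<in>E. tree_sum c V E R (\<lambda>T. e \<in> T)) = (\<Sum>e\<in>E. \<Sum>T\<in>trees V E R. if e \<in> T then prod c T else 0)"
    unfolding tree_sum_def by (intro sum.cong refl sum.inter_filter finT)
  also have "\<dots> = (\<Sum>T\<in>trees V E R. \<Sum>e\<in>E. if e \<in> T then prod c T else 0)" by (rule sum.swap)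
  also have "\<dots> = (\<Sum>T\<in>trees V E R. ?n * prod c T)"
  proof (intro sum.cong refl)
    fix T assume "T \<in> trees V E R"
    note T = T[OF this]
    have "(\<Sum>e\<in>E. if e \<in> T then prod c T else 0) = (\<Sum>e\<in>{e \<in> E. e \<in> T}. prod c T)"
      using fin by (rule sum.inter_filter[symmetric])
    also have "{e \<in> E. e \<in> T} = T" using T by auto
    finally show "(\<Sum>e\<in>E. if e \<in> T then prod c T else 0) = ?n * prod c T" using T by simp
  qed
  also have "\<dots> = ?n * tree_sum c V E R (\<lambda>_. True)"
    unfolding tree_sum_def by (simp add: sum_distrib_left)
  finally show ?thesis
    using tree_sum_pos_iff[of E c V R] fin c ne
    unfolding tree_prob_def sum_divide_distrib[symmetric] by (simp add: field_simps)
qed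

lemma tree_prob_cong_weight:
  assumes "\<And>e. e \<in> E \<Longrightarrow> c e = c' e"
  shows "tree_prob c V E R D = tree_prob c' V E R D"
proof -
  have "prod c T = prod c' T" if "T \<in> trees V E R" for T
    using that assms by (intro prod.cong) (auto simp: trees_def)
  then have "tree_sum c V E R D = tree_sum c' V E R D" for D
    unfolding tree_sum_def by (intro sum.cong) auto
  then show ?thesis unfolding tree_prob_def by simp
qed

lemma tree_prob_cong_rel:
  assumes "joined {} R = joined {} R'"
  shows "tree_prob c V E R D = tree_prob c V E R' D"
  unfolding tree_prob_def tree_sum_def trees_cong_rel[OF assms] ..

lemma joined_automorphism:
  assumes g: "bij g" and h: "\<And>e. e \<in> T \<Longrightarrow> {src (h e), tgt (h e)} = {g (src e), g (tgt e)}"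
  shows "(g x, g y) \<in> joined (h ` T) (map_prod g g ` R) \<longleftrightarrow> (x, y) \<in> joined T R"
proof
  assume "(g x, g y) \<in> joined (h ` T) (map_prod g g ` R)"
  then have "(inv g (g x), inv g (g y)) \<in> joined T R"
  proof (induction rule: joined_induct)
    case (rel x y)
    then show ?case using g by (auto simp: bij_is_inj intro: joined_rel)
  next
    case (edge e)
    then obtain f where f: "f \<in> T" "e = h f" by auto
    have "src e = g (src f) \<and> tgt e = g (tgt f) \<or> src e = g (tgt f) \<and> tgt e = g (src f)"
      using h[OF f(1)] unfolding f(2) doubleton_eq_iff .
    then show ?case using joined_edge[OF f(1)] g by (auto simp: bij_is_inj intro: joined_sym)
  qed (auto intro: joined_sym dest: joined_trans)
  then show "(x, y) \<in> joined T R" using g by (simp add: bij_is_inj)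
next
  assume "(x, y) \<in> joined T R"
  then show "(g x, g y) \<in> joined (h ` T) (map_prod g g ` R)"
  proof (induction rule: joined_induct)
    case (edge f)
    have "g (src f) = src (h f) \<and> g (tgt f) = tgt (h f) \<or> g (src f) = tgt (h f) \<and> g (tgt f) = src (h f)"
      using h[OF edge] by (auto simp: doubleton_eq_iff)
    moreover have "(src (h f), tgt (h f)) \<in> joined (h ` T) (map_prod g g ` R)"
      using edge by (intro joined_edge) auto
    ultimately show ?case by (auto intro: joined_sym)
  qed (auto intro: joined_sym joined_rel dest: joined_trans)
qed

lemma trees_automorphism:
  assumes g: "bij g" and h: "inj_on h E" "\<And>e. e \<in> E \<Longrightarrow> {src (h e), tgt (h e)} = {g (src e), g (tgt e)}"
  shows "trees (g ` V) (h ` E) (map_prod g g ` R) = (`) h ` trees V E R"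
proof -
  let ?R = "map_prod g g ` R"
  have iff: "h ` T \<in> trees (g ` V) (h ` E) ?R \<longleftrightarrow> T \<in> trees V E R" if T: "T \<subseteq> E" for T
  proof -
    have hT: "\<And>e. e \<in> T \<Longrightarrow> {src (h e), tgt (h e)} = {g (src e), g (tgt e)}" using T h(2) by blast
    have "g ` V \<times> g ` V \<subseteq> joined (h ` T) ?R \<longleftrightarrow> (\<forall>x\<in>V. \<forall>y\<in>V. (g x, g y) \<in> joined (h ` T) ?R)"
      by blast
    also have "\<dots> \<longleftrightarrow> V \<times> V \<subseteq> joined T R"
    proof -
      have "(g x, g y) \<in> joined (h ` T) ?R \<longleftrightarrow> (x, y) \<in> joined T R" for x y
        by (rule joined_automorphism[OF g hT])
      then show ?thesis by blast
    qed
    finally have 1: "g ` V \<times> g ` V \<subseteq> joined (h ` T) ?R \<longleftrightarrow> V \<times> V \<subseteq> joined T R" .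
    have "bij_betw ((`) g) (V // joined {} R) (g ` V // joined {} ?R)"
    proof -
      have "joined {} ?R `` {g x} = g ` (joined {} R `` {x})" for x
      proof (rule set_eqI)
        fix z
        obtain y where z: "z = g y" using g by (metis bij_is_surj surjD)
        show "z \<in> joined {} ?R `` {g x} \<longleftrightarrow> z \<in> g ` (joined {} R `` {x})"
          using joined_automorphism[of g "{}" h x y R] g
          by (auto simp: z inj_image_mem_iff bij_is_inj)
      qed
      then have "g ` V // joined {} ?R = (`) g ` (V // joined {} R)"
        unfolding quotient_def by auto
      moreover have "inj_on ((`) g) (V // joined {} R)"
        using g by (auto intro!: inj_onI simp: inj_image_eq_iff bij_is_inj)
      ultimately show ?thesis by (simp add: bij_betw_def)
    qed
    then have 2: "card (g ` V // joined {} ?R) = card (V // joined {} R)"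
      by (simp add: bij_betw_same_card)
    have 3: "card (h ` T) = card T" using h(1) T by (intro card_image) (rule inj_on_subset)
    show ?thesis using 1 2 3 T by (auto simp: trees_def)
  qed
  show ?thesis
  proof (intro equalityI subsetI)
    fix S assume S: "S \<in> trees (g ` V) (h ` E) ?R"
    then have "S \<subseteq> h ` E" by (auto simp: trees_def)
    then obtain T where "T \<subseteq> E" "S = h ` T" by (auto simp: subset_image_iff)
    then show "S \<in> (`) h ` trees V E R" using iff S by auto
  next
    fix S assume "S \<in> (`) h ` trees V E R"
    then obtain T where "T \<in> trees V E R" "S = h ` T" by blast
    moreover from this have "T \<subseteq> E" by (simp add: trees_def)
    ultimately show "S \<in> trees (g ` V) (h ` E) ?R" using iff by simp
  qed
qed

lemma tree_prob_automorphism: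
  assumes g: "bij g" and h: "inj_on h E" "\<And>e. e \<in> E \<Longrightarrow> {src (h e), tgt (h e)} = {g (src e), g (tgt e)}"
  shows "tree_prob c (g ` V) (h ` E) (map_prod g g ` R) D =
    tree_prob (\<lambda>e. c (h e)) V E R (\<lambda>T. D (h ` T))"
proof -
  have "tree_sum c (g ` V) (h ` E) (map_prod g g ` R) D =
    tree_sum (\<lambda>e. c (h e)) V E R (\<lambda>T. D (h ` T))" for D
  proof -
    have inj: "inj_on h T" if "T \<in> trees V E R" for T
      using that h(1) by (auto simp: trees_def intro: inj_on_subset)
    have "trees (g ` V) (h ` E) (map_prod g g ` R) = (`) h ` trees V E R"
      by (rule trees_automorphism[OF g h])
    then have "{T. T \<in> trees (g ` V) (h ` E) (map_prod g g ` R) \<and> D T} =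
        (`) h ` {T. T \<in> trees V E R \<and> D (h ` T)}"
      by auto
    then have "tree_sum c (g ` V) (h ` E) (map_prod g g ` R) D =
        (\<Sum>S\<in>(`) h ` {T. T \<in> trees V E R \<and> D (h ` T)}. prod c S)"
      unfolding tree_sum_def by (rule arg_cong)
    also have "\<dots> = (\<Sum>T | T \<in> trees V E R \<and> D (h ` T). prod c (h ` T))"
    proof (rule sum.reindex_cong[OF _ refl refl])
      show "inj_on ((`) h) {T. T \<in> trees V E R \<and> D (h ` T)}"
        using inj_on_image_Pow[OF h(1)] by (rule inj_on_subset) (auto simp: trees_def)
    qed
    also have "\<dots> = (\<Sum>T | T \<in> trees V E R \<and> D (h ` T). prod (\<lambda>e. c (h e)) T)"
      using inj by (intro sum.cong refl prod.reindex_cong) auto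
    finally show ?thesis by (simp add: tree_sum_def)
  qed
  then show ?thesis unfolding tree_prob_def by simp
qed

section \<open>Acyclic connected edge sets as spanning trees\<close>

text \<open>
  When a step leads back to the path built so far, the loop is cut off.
\<close>

lemma simple_path:
  fixes incidence :: "'b \<Rightarrow> 'a set"
  assumes "(x, y) \<in> {(x, y). \<exists>e\<in>T. incidence e = {x, y}}\<^sup>*"
  shows "\<exists>vs es. length vs = Suc (length es) \<and> hd vs = x \<and> last vs = y \<and> distinct vs \<and> set es \<subseteq> T \<and>
    (\<forall>i<length es. incidence (es ! i) = {vs ! i, vs ! Suc i})"
  using assms
proof (induction rule: converse_rtrancl_induct)
  case base
  show ?case by (rule exI[of _ "[y]"], rule exI[of _ "[]"]) simp
next
  case (step x z)
  then obtain vs es where p: "length vs = Suc (length es)" "hd vs = z" "last vs = y" "distinct vs" "set es \<subseteq> T"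
    "\<forall>i<length es. incidence (es ! i) = {vs ! i, vs ! Suc i}" by blast
  from step(1) obtain e where e: "e \<in> T" "incidence e = {x, z}" by auto
  show ?case
  proof (cases "x \<in> set vs")
    case True
    then obtain k where k: "k < length vs" "vs ! k = x" by (auto simp: in_set_conv_nth)
    have "length (drop k vs) = Suc (length (drop k es))" "hd (drop k vs) = x" "last (drop k vs) = y"
      "distinct (drop k vs)" "set (drop k es) \<subseteq> T"
      using k p by (auto simp: hd_drop_conv_nth dest: in_set_dropD)
    moreover have "\<forall>i<length (drop k es). incidence (drop k es ! i) = {drop k vs ! i, drop k vs ! Suc i}"
      using k p by auto
    ultimately show ?thesis by blast
  next
    case False
    have "vs \<noteq> []" using p(1) by auto
    have "\<forall>i<length (e # es). incidence ((e # es) ! i) = {(x # vs) ! i, (x # vs) ! Suc i}"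
    proof (intro allI impI)
      fix i assume "i < length (e # es)"
      then show "incidence ((e # es) ! i) = {(x # vs) ! i, (x # vs) ! Suc i}"
        using p e \<open>vs \<noteq> []\<close> by (cases i) (auto simp: hd_conv_nth)
    qed
    moreover have "length (x # vs) = Suc (length (e # es))" "hd (x # vs) = x" "last (x # vs) = y"
      "distinct (x # vs)" "set (e # es) \<subseteq> T"
      using p e False \<open>vs \<noteq> []\<close> by auto
    ultimately show ?thesis by blast
  qed
qed

lemma joined_eq_walks:
  assumes "\<And>e. e \<in> T \<Longrightarrow> incidence e = {src e, tgt e}"
  shows "joined T {} = {(x, y). \<exists>e\<in>T. incidence e = {x, y}}\<^sup>*"
proof -
  have "{(x, y). \<exists>e\<in>T. incidence e = {x, y}} = {(x, y). \<exists>e\<in>T. {src e, tgt e} = {x, y}}"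
    using assms by blast
  then show ?thesis by (simp add: joined_def)
qed

text \<open>
  A simple path between the ends of \<open>e\<close> in \<open>T - {e}\<close> closes up with \<open>e\<close> to a cycle; conversely a cycle
  joins the ends of its last edge by its other edges.
\<close>

lemma cycle_free_iff_independent:
  fixes G :: "('v, 'e) multigraph"
  assumes ends: "\<And>e. e \<in> T \<Longrightarrow> ends G e = {src e, tgt e}"
  shows "cycle_free G T \<longleftrightarrow> independent T {}"
proof
  assume cf: "cycle_free G T"
  show "independent T {}"
    unfolding independent_def
  proof (intro ballI notI)
    fix e assume e: "e \<in> T" "(src e, tgt e) \<in> joined (T - {e}) {}"
    then have "(src e, tgt e) \<in> {(x, y). \<exists>f\<in>T - {e}. ends G f = {x, y}}\<^sup>*"
      using ends by (subst (asm) joined_eq_walks[of _ "ends G"]) auto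
    from simple_path[OF this] obtain vs es where
      p: "length vs = Suc (length es)" "hd vs = src e" "last vs = tgt e" "distinct vs" "set es \<subseteq> T - {e}"
        "\<forall>i<length es. ends G (es ! i) = {vs ! i, vs ! Suc i}" by blast
    have "vs \<noteq> []" using p(1) by auto
    have "distinct es"
      unfolding distinct_conv_nth
    proof (intro allI impI notI)
      fix i j assume ij: "i < length es" "j < length es" "i \<noteq> j" "es ! i = es ! j"
      then have "{vs ! i, vs ! Suc i} = {vs ! j, vs ! Suc j}" using p(6) by metis
      then show False using ij p(1,4) by (auto simp: doubleton_eq_iff nth_eq_iff_index_eq)
    qed
    moreover have "ends G ((es @ [e]) ! i) = {vs ! i, vs ! (Suc i mod length (es @ [e]))}"
      if "i < length (es @ [e])" for i
    proof (cases "i = length es")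
      case True
      then show ?thesis
        using p(1,2,3) \<open>vs \<noteq> []\<close> ends[OF e(1)] by (simp add: hd_conv_nth last_conv_nth insert_commute)
    next
      case False
      then show ?thesis using that p(6) by (simp add: nth_append)
    qed
    ultimately have "is_cycle G vs (es @ [e])"
      unfolding is_cycle_def using p by auto
    moreover have "set (es @ [e]) \<subseteq> T" using p e by auto
    ultimately show False using cf unfolding cycle_free_def by blast
  qed
next
  assume ind: "independent T {}"
  show "cycle_free G T"
    unfolding cycle_free_def
  proof
    assume "\<exists>vs es. set es \<subseteq> T \<and> is_cycle G vs es"
    then obtain vs es where es: "set es \<subseteq> T" "is_cycle G vs es" by blast
    then have c: "es \<noteq> []" "length vs = length es" "distinct es"
      "\<And>i. i < length es \<Longrightarrow> ends G (es ! i) = {vs ! i, vs ! (Suc i mod length es)}"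
      by (auto simp: is_cycle_def)
    define n where "n = length es - 1"
    have n: "length es = Suc n" using c(1) by (simp add: n_def)
    define e where "e = es ! n"
    have e: "e \<in> T" using es(1) n unfolding e_def by auto
    have "(vs ! 0, vs ! i) \<in> joined (T - {e}) {}" if "i \<le> n" for i
      using that
    proof (induction i)
      case (Suc i)
      let ?f = "es ! i"
      have f: "?f \<in> T - {e}"
        using Suc.prems n c(3) es(1) unfolding e_def by (auto simp: nth_eq_iff_index_eq)
      have "{src ?f, tgt ?f} = {vs ! i, vs ! Suc i}"
        using c(4)[of i] Suc.prems n f ends[of ?f] by auto
      then have "(vs ! i, vs ! Suc i) \<in> joined (T - {e}) {}"
        using joined_edge[OF f] joined_sym[OF joined_edge[OF f]] by (auto simp: doubleton_eq_iff)
      then show ?case using Suc by (auto intro: joined_trans)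
    qed simp
    from this[of n] have 1: "(vs ! 0, vs ! n) \<in> joined (T - {e}) {}" by simp
    have "{src e, tgt e} = {vs ! n, vs ! 0}"
      using c(4)[of n] n ends[OF e] unfolding e_def by simp
    then have "(src e, tgt e) \<in> joined (T - {e}) {}"
      using 1 joined_sym[OF 1] by (auto simp: doubleton_eq_iff)
    then show False using ind e unfolding independent_def by blast
  qed
qed

lemma spanning_trees_eq_trees:
  fixes G :: "('v, 'e) multigraph"
  assumes fg: "finite_graph (verts G) (edges G) {}"
    and ends: "\<And>e. e \<in> edges G \<Longrightarrow> ends G e = {src e, tgt e}"
  shows "spanning_trees G = trees (verts G) (edges G) {}"
proof -
  have "connected_via G T \<longleftrightarrow> verts G \<times> verts G \<subseteq> joined T {}" "cycle_free G T \<longleftrightarrow> independent T {}"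
    if "T \<subseteq> edges G" for T
  proof -
    have "joined T {} = {(x, y). \<exists>e\<in>T. ends G e = {x, y}}\<^sup>*"
      by (rule joined_eq_walks) (use that ends in auto)
    then show "connected_via G T \<longleftrightarrow> verts G \<times> verts G \<subseteq> joined T {}"
      unfolding connected_via_def by (simp only:) blast
    show "cycle_free G T \<longleftrightarrow> independent T {}"
      by (rule cycle_free_iff_independent) (use that ends in auto)
  qed
  then show ?thesis unfolding spanning_trees_def trees_eq_independent[OF fg] by auto
qed

text \<open>
  Contraction by a map on the vertices agrees with contraction by the kernel of this map.
\<close>

lemma joined_image:
  assumes q: "\<And>e. src' e = q (src e)" "\<And>e. tgt' e = q (tgt e)"
  shows "(q x, q y) \<in> oriented_edges.joined src' tgt' T {} \<longleftrightarrow>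
    (x, y) \<in> joined T {(x, y). q x = q y}"
proof -
  interpret Q: oriented_edges src' tgt' .
  let ?R = "{(x, y). q x = q y}"
  have "\<forall>x y. q x = a \<longrightarrow> q y = b \<longrightarrow> (x, y) \<in> joined T ?R" if "(a, b) \<in> Q.joined T {}" "a \<in> range q" for a b
  proof -
    have "(a \<in> range q \<longleftrightarrow> b \<in> range q) \<and> (\<forall>x y. q x = a \<longrightarrow> q y = b \<longrightarrow> (x, y) \<in> joined T ?R)"
      using that(1)
    proof (induction rule: Q.joined_induct)
      case (edge e)
      have "(x, y) \<in> joined T ?R" if "q x = q (src e)" "q y = q (tgt e)" for x y
        using that by (intro joined_trans[OF joined_rel joined_trans[OF joined_edge[OF edge] joined_rel]]) auto
      then show ?case by (auto simp: q)
    next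
      case (trans a b d)
      show ?case
      proof (intro conjI allI impI)
        fix x y assume "q x = a" "q y = d"
        then obtain z where "q z = b" using trans by blast
        then show "(x, y) \<in> joined T ?R" using trans \<open>q x = a\<close> \<open>q y = d\<close> by (blast intro: joined_trans)
      qed (use trans in blast)
    qed (auto intro: joined_rel joined_sym)
    then show ?thesis by blast
  qed
  moreover have "(q x, q y) \<in> Q.joined T {}" if "(x, y) \<in> joined T ?R"
    using that
  proof (induction rule: joined_induct)
    case (edge e)
    then show ?case using Q.joined_edge[of e T "{}"] q(1)[of e] q(2)[of e] by metis
  qed (auto intro: Q.joined_sym dest: Q.joined_trans)
  ultimately show ?thesis by blast
qed

lemma trees_image:
  assumes q: "\<And>e. src' e = q (src e)" "\<And>e. tgt' e = q (tgt e)"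
  shows "oriented_edges.trees src' tgt' (range q) E {} = trees UNIV E {(x, y). q x = q y}"
proof -
  interpret Q: oriented_edges src' tgt' .
  let ?R = "{(x, y). q x = q y}"
  have "bij_betw (\<lambda>v. {x. q x = v}) (range q) (UNIV // joined {} ?R)"
  proof -
    have "joined {} ?R `` {x} = {y. q y = q x}" for x
      using joined_image[of src' q tgt' x _ "{}", OF q] Q.joined_empty[of "{}"] by auto
    then have "UNIV // joined {} ?R = (\<lambda>v. {x. q x = v}) ` range q"
      by (auto simp: quotient_def)
    moreover have "inj_on (\<lambda>v. {x. q x = v}) (range q)" by (rule inj_onI) auto
    ultimately show ?thesis by (simp add: bij_betw_def)
  qed
  then have "card (UNIV // joined {} ?R) = card (range q // Q.joined {} {})"
    using bij_betw_same_card by (fastforce simp: Q.quotient_discrete card_image)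
  moreover have "range q \<times> range q \<subseteq> Q.joined T {} \<longleftrightarrow> UNIV \<times> UNIV \<subseteq> joined T ?R" for T
  proof -
    have "range q \<times> range q \<subseteq> Q.joined T {} \<longleftrightarrow> (\<forall>x y. (q x, q y) \<in> Q.joined T {})" by blast
    then show ?thesis unfolding joined_image[of src' q tgt', OF q] by blast
  qed
  ultimately show ?thesis by (simp add: Q.trees_def trees_def)
qed

end

section \<open>The lattice and its cubes\<close>

definition lattice_src :: "(int ^ 'd) set \<Rightarrow> int ^ 'd" where
  "lattice_src e = (SOME x. \<exists>y. e = {x, y})"

definition lattice_tgt :: "(int ^ 'd) set \<Rightarrow> int ^ 'd" where
  "lattice_tgt e = (SOME y. e = {lattice_src e, y})"

lemma lattice_ends:
  assumes "e \<in> lattice_edges" shows "{lattice_src e, lattice_tgt e} = e"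
proof -
  have "\<exists>x y. e = {x, y}" using assms by (auto simp: lattice_edges_def)
  then have "\<exists>y. e = {lattice_src e, y}" unfolding lattice_src_def by (rule someI_ex)
  then show ?thesis unfolding lattice_tgt_def by (rule someI_ex[THEN sym])
qed

interpretation lat: oriented_edges lattice_src lattice_tgt .

text \<open>
  Every lattice edge has exactly one such representation, which identifies the edges with pairs of a
  lattice point and a direction.
\<close>

definition edge_at :: "int ^ 'd \<Rightarrow> 'd \<Rightarrow> (int ^ 'd) set" where
  "edge_at x i = {x, x + axis i 1}"

lemma edge_at_lattice: "edge_at x i \<in> lattice_edges"
proof -
  have "(\<Sum>j\<in>UNIV. \<bar>x $ j - (x + axis i 1) $ j\<bar>) = (\<Sum>j\<in>UNIV. if j = i then 1 else 0 :: int)"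
    by (intro sum.cong) (auto simp: axis_def)
  then have "(\<Sum>j\<in>UNIV. \<bar>x $ j - (x + axis i 1) $ j\<bar>) = 1" by simp
  then show ?thesis unfolding lattice_edges_def edge_at_def by blast
qed

lemma lattice_edgeE:
  assumes "e \<in> lattice_edges" obtains x i where "e = edge_at x i"
proof -
  obtain u v where uv: "e = {u, v}" "(\<Sum>i\<in>UNIV. \<bar>u $ i - v $ i\<bar>) = 1"
    using assms by (auto simp: lattice_edges_def)
  have "\<exists>i. u $ i \<noteq> v $ i"
  proof (rule ccontr)
    assume "\<nexists>i. u $ i \<noteq> v $ i"
    then show False using uv(2) by simp
  qed
  then obtain i where i: "u $ i \<noteq> v $ i" by blast
  have s: "\<bar>u $ i - v $ i\<bar> + (\<Sum>j\<in>UNIV - {i}. \<bar>u $ j - v $ j\<bar>) = 1"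
    using uv(2) by (subst (asm) sum.remove[of _ i]) auto
  moreover have "(\<Sum>j\<in>UNIV - {i}. \<bar>u $ j - v $ j\<bar>) \<ge> 0" by (intro sum_nonneg) auto
  ultimately have 1: "\<bar>u $ i - v $ i\<bar> = 1" and "(\<Sum>j\<in>UNIV - {i}. \<bar>u $ j - v $ j\<bar>) = 0"
    using i by linarith+
  then have j: "u $ j = v $ j" if "j \<noteq> i" for j
    using that by (subst (asm) sum_nonneg_eq_0_iff) auto
  have "v = u + axis i 1 \<or> u = v + axis i 1"
  proof (cases "v $ i = u $ i + 1")
    case True
    then have "v = u + axis i 1" using j by (auto simp: vec_eq_iff axis_def)
    then show ?thesis ..
  next
    case False
    then have "u $ i = v $ i + 1" using 1 by auto
    then have "u = v + axis i 1" using j by (auto simp: vec_eq_iff axis_def)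
    then show ?thesis ..
  qed
  then show ?thesis using that uv(1) unfolding edge_at_def by (auto simp: insert_commute)
qed

lemma edge_at_inject: "edge_at x i = edge_at y j \<longleftrightarrow> x = y \<and> i = j"
proof
  assume *: "edge_at x i = edge_at y j"
  have "x = y \<and> axis i (1 :: int) = axis j 1 \<or> axis i (1 :: int) + axis j 1 = 0"
    using * by (auto simp: edge_at_def doubleton_eq_iff algebra_simps)
  moreover have "axis i (1 :: int) + axis j 1 \<noteq> 0"
  proof
    assume "axis i (1 :: int) + axis j 1 = 0"
    then have "(axis i (1 :: int) + axis j 1) $ i = 0" by simp
    then show False by (simp add: axis_def split: if_splits)
  qed
  ultimately show "x = y \<and> i = j" by (simp add: axis_eq_axis)
qed simp

lemma lattice_edge_distinct: "x + axis i (1 :: int) \<noteq> x"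
proof
  assume "x + axis i (1 :: int) = x"
  then have "(x + axis i (1 :: int)) $ i = x $ i" by simp
  then show False by simp
qed

definition inner_edges :: "(int ^ 'd) set \<Rightarrow> (int ^ 'd) set set" where
  "inner_edges A = {e \<in> lattice_edges. e \<subseteq> A}"

definition touching_edges :: "(int ^ 'd) set \<Rightarrow> (int ^ 'd) set set" where
  "touching_edges A = {e \<in> lattice_edges. e \<inter> A \<noteq> {}}"

lemma inner_subset_touching: "inner_edges A \<subseteq> touching_edges A"
  using lattice_ends by (fastforce simp: inner_edges_def touching_edges_def)

lemma finite_inner_edges: "finite A \<Longrightarrow> finite (inner_edges A)"
  by (rule finite_subset[of _ "Pow A"]) (auto simp: inner_edges_def)

lemma finite_touching_edges:
  fixes A :: "(int ^ 'd) set"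
  assumes "finite A" shows "finite (touching_edges A)"
proof (rule finite_subset)
  show "touching_edges A \<subseteq> (\<lambda>(x, i). edge_at x i) ` ((A \<union> (\<Union>i. (\<lambda>x. x - axis i 1) ` A)) \<times> UNIV)"
  proof
    fix e assume e: "e \<in> touching_edges A"
    then have "e \<in> lattice_edges" by (simp add: touching_edges_def)
    then obtain x i where xi: "e = edge_at x i" by (rule lattice_edgeE)
    then have "x \<in> A \<or> x + axis i 1 \<in> A" using e by (auto simp: touching_edges_def edge_at_def)
    moreover have "x = (x + axis i 1) - axis i 1" by simp
    ultimately have "x \<in> A \<union> (\<Union>i. (\<lambda>x. x - axis i 1) ` A)" by blast
    then show "e \<in> (\<lambda>(x, i). edge_at x i) ` ((A \<union> (\<Union>i. (\<lambda>x. x - axis i 1) ` A)) \<times> UNIV)"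
      using xi by force
  qed
  show "finite ((\<lambda>(x, i). edge_at x i) ` ((A \<union> (\<Union>i. (\<lambda>x. x - axis i 1) ` A)) \<times> UNIV))"
    using assms by simp
qed

lemma inner_edge_ends: "e \<in> inner_edges A \<Longrightarrow> lattice_src e \<in> A \<and> lattice_tgt e \<in> A"
  using lattice_ends[of e] by (auto simp: inner_edges_def)

text \<open>
  Choose a point of \<open>A\<close> with maximal \<open>i\<close>-th coordinate.
\<close>

lemma exit_edge:
  fixes A :: "(int ^ 'd) set"
  assumes "finite A" "A \<noteq> {}" shows "\<exists>x\<in>A. x + axis i 1 \<notin> A"
proof -
  obtain x where x: "x \<in> A" "Max ((\<lambda>y. y $ i) ` A) = x $ i"
    using obtains_MAX[OF assms] .
  then have le: "y $ i \<le> x $ i" if "y \<in> A" for y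
    using assms that Max_ge[of "(\<lambda>y. y $ i) ` A" "y $ i"] by auto
  have "x + axis i 1 \<notin> A" using le[of "x + axis i 1"] by auto
  then show ?thesis using x(1) by blast
qed

lemma finite_graph_inner:
  "finite A \<Longrightarrow> A \<noteq> {} \<Longrightarrow> lat.finite_graph A (inner_edges A) {}"
  by (simp add: lat.finite_graph_discrete finite_inner_edges inner_edge_ends)

lemma finite_graph_touching:
  assumes "finite A" shows "lat.finite_graph UNIV (touching_edges A) ((- A) \<times> (- A))"
proof -
  have "UNIV = A \<union> - A" by auto
  moreover have "- A \<noteq> {}" using exit_edge[OF assms] by (cases "A = {}") auto
  ultimately have "finite (UNIV // lat.joined {} ((- A) \<times> (- A)))"
    using lat.quotient_block[of A "- A"] assms by auto
  then show ?thesis using assms by (simp add: lat.finite_graph_def finite_touching_edges)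
qed

lemma spanning_trees_free:
  assumes "finite A" "A \<noteq> {}"
  shows "spanning_trees (free_graph A) = lat.trees A (inner_edges A) {}"
proof -
  have "verts (free_graph A) = A" "edges (free_graph A) = inner_edges A"
    by (simp_all add: free_graph_def inner_edges_def)
  then show ?thesis
    using lat.spanning_trees_eq_trees[of "free_graph A"] finite_graph_inner[OF assms] lattice_ends
    by (auto simp: free_graph_def inner_edges_def)
qed

lemma contract_eq_iff: "contract A x = contract A y \<longleftrightarrow> x = y \<or> x \<notin> A \<and> y \<notin> A"
  by (auto simp: contract_def)

lemma joined_contract:
  "lat.joined {} {(x, y). contract A x = contract A y} = lat.joined {} ((- A) \<times> (- A))"
proof -
  have "{(x, y). contract A x = contract A y} = lat.joined {} ((- A) \<times> (- A))"
    unfolding lat.joined_empty by (auto simp: contract_eq_iff)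
  then show ?thesis by (simp add: lat.joined_joined)
qed

text \<open>
  The edges of the wired graph keep their identity as lattice edges, so its trees are those of the
  lattice with the complement of \<open>A\<close> contracted.
\<close>

lemma spanning_trees_wired:
  fixes A :: "(int ^ 'd) set"
  assumes "finite A"
  shows "spanning_trees (wired_graph A) = lat.trees UNIV (touching_edges A) ((- A) \<times> (- A))"
proof -
  define s where "s e = contract A (lattice_src e)" for e
  define t where "t e = contract A (lattice_tgt e)" for e
  interpret W: oriented_edges s t .
  have ct: "contract A ` e = {None} \<longleftrightarrow> e \<inter> A = {}" if "e \<in> lattice_edges" for e
  proof -
    have "e \<noteq> {}" using lattice_ends[OF that] by auto
    then show ?thesis by (auto simp: contract_def split: if_splits) 
  qed
  have G: "verts (wired_graph A) = range (contract A)" "edges (wired_graph A) = touching_edges A"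
    "ends (wired_graph A) = (\<lambda>e. contract A ` e)"
    using ct by (simp_all add: wired_graph_def touching_edges_def cong: conj_cong)
  have "range (contract A) \<subseteq> insert None (Some ` A)" by (auto simp: contract_def)
  then have "finite (range (contract A))" using assms by (meson finite.insertI finite_imageI finite_subset)
  then have "W.finite_graph (verts (wired_graph A)) (edges (wired_graph A)) {}"
    unfolding G W.finite_graph_discrete using finite_touching_edges[OF assms] by (auto simp: s_def t_def)
  moreover have "ends (wired_graph A) e = {s e, t e}" if "e \<in> edges (wired_graph A)" for e
  proof -
    have "e = {lattice_src e, lattice_tgt e}"
      using that lattice_ends[of e] unfolding G by (simp add: touching_edges_def)
    then have "contract A ` e = contract A ` {lattice_src e, lattice_tgt e}" by (rule arg_cong)
    then show ?thesis unfolding G s_def t_def by simp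
  qed
  ultimately have "spanning_trees (wired_graph A) = W.trees (range (contract A)) (touching_edges A) {}"
    using W.spanning_trees_eq_trees[of "wired_graph A"] unfolding G by blast
  also have "\<dots> = lat.trees UNIV (touching_edges A) {(x, y). contract A x = contract A y}"
    by (rule lat.trees_image) (simp_all add: s_def t_def)
  also have "\<dots> = lat.trees UNIV (touching_edges A) ((- A) \<times> (- A))"
    by (rule lat.trees_cong_rel[OF joined_contract])
  finally show ?thesis .
qed

text \<open>
  Boxes with arbitrary centres are needed because averaging moves boxes around.
\<close>

definition cube :: "int ^ 'd \<Rightarrow> nat \<Rightarrow> (int ^ 'd) set" where
  "cube a n = {x. \<forall>i. \<bar>x $ i - a $ i\<bar> \<le> int n}"

lemma lattice_box_eq: "lattice_box n = cube 0 n"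
  by (simp add: lattice_box_def cube_def)

lemma cube_bij:
  "bij_betw (\<lambda>f. \<chi> i. f i) (\<Pi>\<^sub>E i\<in>(UNIV :: 'd set). {a $ i - int n..a $ i + int n}) (cube (a :: int ^ 'd) n)"
proof (rule bij_betw_byWitness[where f' = "\<lambda>x i. x $ i"])
  show "(\<lambda>f. \<chi> i. f i) ` (\<Pi>\<^sub>E i\<in>UNIV. {a $ i - int n..a $ i + int n}) \<subseteq> cube a n"
    by (auto simp: cube_def PiE_iff abs_le_iff) (smt (verit))+
  show "(\<lambda>x i. x $ i) ` cube a n \<subseteq> (\<Pi>\<^sub>E i\<in>UNIV. {a $ i - int n..a $ i + int n})"
    by (auto simp: cube_def PiE_iff abs_le_iff) (smt (verit))+
qed auto

lemma finite_cube: "finite (cube a n)"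
  using bij_betw_finite[OF cube_bij[of a n]] by (simp add: finite_PiE)

lemma card_cube: "card (cube (a :: int ^ 'd) n) = (2 * n + 1) ^ CARD('d)"
proof -
  have "card (cube a n) = card (\<Pi>\<^sub>E i\<in>(UNIV :: 'd set). {a $ i - int n..a $ i + int n})"
    using bij_betw_same_card[OF cube_bij] by metis
  also have "\<dots> = (\<Prod>i\<in>(UNIV :: 'd set). 2 * n + 1)"
    unfolding card_PiE[OF finite] by (intro prod.cong) auto
  finally show ?thesis by simp
qed

lemma center_in_cube: "a \<in> cube a n"
  by (simp add: cube_def)

lemma cube_mono: "m \<le> n \<Longrightarrow> cube a m \<subseteq> cube a n"
proof
  fix x assume "m \<le> n" "x \<in> cube a m"
  then have "\<bar>x $ i - a $ i\<bar> \<le> int n" for i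
    unfolding cube_def using of_nat_mono[OF \<open>m \<le> n\<close>, where 'a = int] order_trans by blast
  then show "x \<in> cube a n" by (simp add: cube_def)
qed

lemma cube_subset_centered: "\<exists>k. \<forall>m\<ge>k. cube a n \<subseteq> cube 0 m"
proof -
  define k where "k = n + (\<Sum>i\<in>UNIV. nat \<bar>a $ i\<bar>)"
  have "cube a n \<subseteq> cube 0 m" if "m \<ge> k" for m
  proof
    fix x assume x: "x \<in> cube a n"
    have "\<bar>x $ i\<bar> \<le> int m" for i
    proof -
      have "\<bar>x $ i - a $ i\<bar> \<le> int n" using x by (simp add: cube_def)
      moreover have "nat \<bar>a $ i\<bar> \<le> (\<Sum>i\<in>UNIV. nat \<bar>a $ i\<bar>)" by (rule member_le_sum) auto
      ultimately show ?thesis using that unfolding k_def by linarith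
    qed
    then show "x \<in> cube 0 m" by (simp add: cube_def)
  qed
  then show ?thesis by blast
qed

lemma finite_subset_cube:
  fixes A :: "(int ^ 'd) set"
  assumes "finite A" shows "\<exists>k. \<forall>m\<ge>k. A \<subseteq> cube 0 m"
  using assms
proof (induction A)
  case (insert a A)
  then obtain k where k: "\<forall>m\<ge>k. A \<subseteq> cube 0 m" by blast
  obtain l where "\<forall>m\<ge>l. cube a 0 \<subseteq> cube 0 m" using cube_subset_centered by blast
  then have "\<forall>m\<ge>max k l. insert a A \<subseteq> cube 0 m" using k center_in_cube[of a 0] by auto
  then show ?case by blast
qed simp

lemma joined_step:
  assumes "edge_at x i \<in> T"
  shows "(x, x + axis i 1) \<in> lat.joined T R"
proof -
  have "{lattice_src (edge_at x i), lattice_tgt (edge_at x i)} = {x, x + axis i 1}"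
    using lattice_ends[OF edge_at_lattice] by (simp add: edge_at_def)
  then show ?thesis
    using lat.joined_edge[OF assms, of R] lat.joined_sym[OF lat.joined_edge[OF assms, of R]]
    by (auto simp: doubleton_eq_iff)
qed

lemma cube_connected: "cube a n \<times> cube a n \<subseteq> lat.joined (inner_edges (cube a n)) {}"
proof -
  have "(a, x) \<in> lat.joined (inner_edges (cube a n)) {}" if "x \<in> cube a n" for x
    using that
  proof (induction "\<Sum>i\<in>UNIV. nat \<bar>x $ i - a $ i\<bar>" arbitrary: x rule: less_induct)
    case less
    show ?case
    proof (cases "x = a")
      case False
      then obtain i where i: "x $ i \<noteq> a $ i" by (auto simp: vec_eq_iff)
      define y where "y = (if x $ i < a $ i then x + axis i 1 else x - axis i 1)"
      have y: "y $ j = (if j = i then (if x $ i < a $ i then x $ i + 1 else x $ i - 1) else x $ j)" for j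
        by (auto simp: y_def axis_def)
      have "y \<in> cube a n"
        using less.prems i unfolding cube_def by (auto simp: y) (smt (verit))+
      moreover have "(\<Sum>i\<in>UNIV. nat \<bar>y $ i - a $ i\<bar>) < (\<Sum>i\<in>UNIV. nat \<bar>x $ i - a $ i\<bar>)"
        by (rule sum_strict_mono_ex1) (use i in \<open>auto simp: y intro!: exI[of _ i]\<close>)
      ultimately have "(a, y) \<in> lat.joined (inner_edges (cube a n)) {}" using less.hyps by blast
      moreover have "(y, x) \<in> lat.joined (inner_edges (cube a n)) {}"
      proof (cases "x $ i < a $ i")
        case True
        then have "edge_at x i \<in> inner_edges (cube a n)"
          using less.prems \<open>y \<in> cube a n\<close> by (simp add: inner_edges_def edge_at_lattice) (simp add: edge_at_def y_def)
        then show ?thesis using lat.joined_sym[OF joined_step] True by (simp add: y_def)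
      next
        case False
        then have "edge_at y i \<in> inner_edges (cube a n)"
          using less.prems \<open>y \<in> cube a n\<close> by (simp add: inner_edges_def edge_at_lattice) (simp add: edge_at_def y_def)
        then show ?thesis using joined_step[of y i] False by (simp add: y_def)
      qed
      ultimately show ?thesis by (rule lat.joined_trans)
    qed simp
  qed
  then show ?thesis using lat.joined_trans[OF lat.joined_sym] by fast
qed

section \<open>Monotonicity in the domain and translations\<close>

definition free_prob :: "((int ^ 'd) set \<Rightarrow> real) \<Rightarrow> (int ^ 'd) set \<Rightarrow> ((int ^ 'd) set set \<Rightarrow> bool) \<Rightarrow> real" where
  "free_prob c A = lat.tree_prob c A (inner_edges A) {}"

definition wired_prob :: "((int ^ 'd) set \<Rightarrow> real) \<Rightarrow> (int ^ 'd) set \<Rightarrow> ((int ^ 'd) set set \<Rightarrow> bool) \<Rightarrow> real" where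
  "wired_prob c A = lat.tree_prob c UNIV (touching_edges A) ((- A) \<times> (- A))"

abbreviation "free_trees A \<equiv> lat.trees A (inner_edges A) {}"
abbreviation "wired_trees A \<equiv> lat.trees UNIV (touching_edges A) ((- A) \<times> (- A))"

lemma free_trees_cube: "free_trees (cube a n) \<noteq> {}"
  using center_in_cube[of a n]
  by (intro lat.trees_nonempty finite_graph_inner finite_cube cube_connected) auto

text \<open>
  The special case \<open>C = {v}\<close> of \<open>tree_prob_grow\<close>, in which the contraction of \<open>C\<close> is trivial.
\<close>

lemma grow_vertex:
  assumes V: "finite V" "V \<noteq> {}" "v \<notin> V" and ne: "free_trees V \<noteq> {}"
    and e: "e \<in> lattice_edges" "e \<subseteq> insert v V" "v \<in> e"
    and D: "A \<subseteq> inner_edges V" "B \<subseteq> inner_edges V" "A \<inter> B = {}" and c: "\<And>x. c x > 0"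
  shows "free_prob c (insert v V) (lat.meets_or_contains B A) \<le> free_prob c V (lat.meets_or_contains B A)"
    and "free_trees (insert v V) \<noteq> {}"
proof -
  define F where "F = inner_edges (insert v V) - inner_edges V"
  have un: "V \<union> {v} = insert v V" "inner_edges V \<union> F = inner_edges (insert v V)"
    by (auto simp: F_def inner_edges_def)
  have 0: "lat.joined {} ({v} \<times> {v}) = lat.joined {} {}"
    using lat.joined_empty[of "{v}"] lat.joined_empty[of "{}"] by auto
  have F: "\<exists>u\<in>V. \<exists>w\<in>{v}. {lattice_src g, lattice_tgt g} = {u, w}" if "g \<in> F" for g
  proof -
    have g: "g \<in> lattice_edges" "g \<subseteq> insert v V" "\<not> g \<subseteq> V"
      using that by (auto simp: F_def inner_edges_def)
    obtain x i where xi: "g = {x, x + axis i 1}"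
      using g(1) unfolding edge_at_def[symmetric] by (rule lattice_edgeE)
    have "\<exists>u\<in>V. g = {u, v}"
      using g(2,3) lattice_edge_distinct[of x i] unfolding xi by (auto simp: insert_commute)
    then show ?thesis using lattice_ends[OF g(1)] by auto
  qed
  have "F \<noteq> {}" using e V(3) by (auto simp: F_def inner_edges_def)
  have *: "finite V" "V \<inter> {v} = {}" "V \<noteq> {}" "finite (inner_edges V)"
    "\<And>e. e \<in> inner_edges V \<Longrightarrow> lattice_src e \<in> V \<and> lattice_tgt e \<in> V" "finite F" "F \<noteq> {}"
    using V finite_inner_edges inner_edge_ends \<open>F \<noteq> {}\<close> by (auto simp: F_def finite_inner_edges)
  note grow = lat.tree_prob_grow[OF * F D _ ne, of c, unfolded un]
  show "free_prob c (insert v V) (lat.meets_or_contains B A) \<le> free_prob c V (lat.meets_or_contains B A)"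
    using grow(1) c unfolding free_prob_def lat.tree_prob_cong_rel[OF 0] by blast
  show "free_trees (insert v V) \<noteq> {}"
    using grow(2) c unfolding lat.trees_cong_rel[OF 0] by blast
qed

text \<open>
  The set \<open>V\<close> grows to \<open>V'\<close> by one adjacent vertex at a time; connectedness of \<open>V'\<close> provides the next
  vertex.
\<close>

lemma free_prob_antimono:
  assumes V': "finite V'" "V' \<times> V' \<subseteq> lat.joined (inner_edges V') {}"
    and V: "V \<subseteq> V'" "V \<noteq> {}" "free_trees V \<noteq> {}"
    and D: "A \<subseteq> inner_edges V" "B \<subseteq> inner_edges V" "A \<inter> B = {}" and c: "\<And>x. c x > 0"
  shows "free_prob c V' (lat.meets_or_contains B A) \<le> free_prob c V (lat.meets_or_contains B A)"
  using V D
proof (induction "card (V' - V)" arbitrary: V)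
  case 0
  then have "V' = V" using V' by auto
  then show ?case by simp
next
  case (Suc n)
  have "\<exists>e\<in>inner_edges V'. \<not> (lattice_src e \<in> V \<longleftrightarrow> lattice_tgt e \<in> V)"
  proof (rule ccontr)
    assume *: "\<not> ?thesis"
    obtain x y where xy: "x \<in> V' - V" "y \<in> V"
      using Suc.hyps(2) Suc.prems by (metis card.empty ex_in_conv nat.distinct(1))
    then have "(x, y) \<in> lat.joined (inner_edges V') {}" using V' Suc.prems by auto
    then have "(x \<in> V) = (y \<in> V)" by (rule lat.joined_const) (use * in auto)
    then show False using xy by auto
  qed
  then obtain e where e: "e \<in> inner_edges V'" "\<not> (lattice_src e \<in> V \<longleftrightarrow> lattice_tgt e \<in> V)" by blast
  have ends: "{lattice_src e, lattice_tgt e} = e" "e \<in> lattice_edges" "e \<subseteq> V'"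
    using e lattice_ends by (auto simp: inner_edges_def)
  \<comment> \<open>the end of \<open>e\<close> outside \<open>V\<close>\<close>
  define v where "v = (if lattice_src e \<in> V then lattice_tgt e else lattice_src e)"
  have v: "v \<notin> V" "v \<in> V'" "v \<in> e" "e \<subseteq> insert v V"
  proof -
    have "lattice_src e \<in> e" "lattice_tgt e \<in> e" "e \<subseteq> {lattice_src e, lattice_tgt e}"
      using ends(1) by blast+
    then show "v \<notin> V" "v \<in> V'" "v \<in> e" "e \<subseteq> insert v V"
      using e(2) ends(3) unfolding v_def by (auto split: if_splits)
  qed
  have fin: "finite V" using V' Suc.prems finite_subset by blast
  note grow = grow_vertex[OF fin Suc.prems(2) v(1) Suc.prems(3) ends(2) v(4,3) Suc.prems(4-6), of c]
  have "n = card (V' - insert v V)"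
    using Suc.hyps(2) v V' by (metis DiffI Diff_insert card_Diff_singleton diff_Suc_1)
  then have "free_prob c V' (lat.meets_or_contains B A) \<le> free_prob c (insert v V) (lat.meets_or_contains B A)"
    by (rule Suc.hyps(1)) (use Suc.prems v grow(2) c in \<open>auto simp: inner_edges_def\<close>)
  also have "\<dots> \<le> free_prob c V (lat.meets_or_contains B A)"
    using grow(1) c by blast
  finally show ?case .
qed

text \<open>
  The wired graph is the free graph with one more vertex, the contracted complement.
\<close>

lemma wired_le_free:
  fixes V :: "(int ^ 'd) set"
  assumes V: "finite V" "V \<noteq> {}" and ne: "free_trees V \<noteq> {}"
    and D: "A \<subseteq> inner_edges V" "B \<subseteq> inner_edges V" "A \<inter> B = {}" and c: "\<And>x. c x > 0"
  shows "wired_prob c V (lat.meets_or_contains B A) \<le> free_prob c V (lat.meets_or_contains B A)"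
    and "wired_trees V \<noteq> {}"
proof -
  define F where "F = touching_edges V - inner_edges V"
  have un: "V \<union> (- V) = UNIV" "inner_edges V \<union> F = touching_edges V"
    using inner_subset_touching by (auto simp: F_def)
  have F: "\<exists>u\<in>V. \<exists>w\<in>-V. {lattice_src g, lattice_tgt g} = {u, w}" if "g \<in> F" for g
  proof -
    have g: "g \<in> lattice_edges" "g \<inter> V \<noteq> {}" "\<not> g \<subseteq> V"
      using that by (auto simp: F_def touching_edges_def inner_edges_def)
    obtain x i where xi: "g = {x, x + axis i 1}"
      using g(1) unfolding edge_at_def[symmetric] by (rule lattice_edgeE)
    have "\<exists>u\<in>V. \<exists>w\<in>-V. g = {u, w}"
      using g(2,3) unfolding xi by (auto simp: insert_commute)
    then show ?thesis using lattice_ends[OF g(1)] by auto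
  qed
  have "F \<noteq> {}"
  proof -
    obtain x where "x \<in> V" "x + axis undefined 1 \<notin> V" using exit_edge[OF V] by blast
    then have "edge_at x undefined \<in> F"
      by (simp add: F_def touching_edges_def inner_edges_def edge_at_lattice) (simp add: edge_at_def)
    then show ?thesis by blast
  qed
  have *: "finite V" "V \<inter> - V = {}" "V \<noteq> {}" "finite (inner_edges V)"
    "\<And>e. e \<in> inner_edges V \<Longrightarrow> lattice_src e \<in> V \<and> lattice_tgt e \<in> V" "finite F" "F \<noteq> {}"
    using V finite_inner_edges inner_edge_ends \<open>F \<noteq> {}\<close> by (auto simp: F_def finite_touching_edges)
  note grow = lat.tree_prob_grow[OF * F D _ ne, of c, unfolded un]
  show "wired_prob c V (lat.meets_or_contains B A) \<le> free_prob c V (lat.meets_or_contains B A)"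
    using grow(1) c unfolding free_prob_def wired_prob_def by blast
  show "wired_trees V \<noteq> {}" using grow(2) c by blast
qed

lemma wired_trees_cube: "wired_trees (cube a n) \<noteq> {}"
  using wired_le_free(2)[OF finite_cube _ free_trees_cube, of a n "{}" "{}" "\<lambda>_. 1"] center_in_cube[of a n]
  by auto

text \<open>
  From a point outside the small cube, walk away from its centre in a coordinate direction in which
  the point lies beyond it. This walk never meets the small cube and eventually leaves the large one.
\<close>

lemma escape_cube:
  assumes sub: "cube a n \<subseteq> cube b m" and x: "x \<notin> cube a n"
  shows "\<exists>y. y \<notin> cube b m \<and>
    (x, y) \<in> lat.joined (touching_edges (cube b m) - touching_edges (cube a n)) ((- cube b m) \<times> (- cube b m))"
    (is "\<exists>y. _ \<and> (x, y) \<in> ?J")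
proof -
  obtain i where i: "\<bar>x $ i - a $ i\<bar> > int n" using x by (auto simp: cube_def not_le)
  define s :: int where "s = (if x $ i < a $ i then -1 else 1)"
  have s: "\<bar>s\<bar> = 1" by (simp add: s_def)
  define p where "p k = x + axis i (s * int k)" for k
  have p_i: "p k $ i = x $ i + s * int k" for k by (simp add: p_def)
  have p_far: "\<bar>p k $ i - a $ i\<bar> > int n" for k
    unfolding p_i using i by (auto simp: s_def split: if_splits)
  then have p_out: "p k \<notin> cube a n" for k using p_far[of k] by (auto simp: cube_def not_le)
  have p_Suc: "p (Suc k) = p k + axis i s" for k
    by (auto simp: p_def vec_eq_iff axis_def algebra_simps)
  have step: "(p k, p (Suc k)) \<in> ?J" for k
  proof -
    define z where "z = (if s = 1 then p k else p (Suc k))"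
    have z: "edge_at z i = {p k, p (Suc k)}"
    proof (cases "s = 1")
      case True
      then show ?thesis by (simp add: z_def edge_at_def p_Suc)
    next
      case False
      then have "s = -1" using s by auto
      then have "p (Suc k) + axis i 1 = p k" by (auto simp: p_Suc vec_eq_iff axis_def)
      then show ?thesis using False by (simp add: z_def edge_at_def insert_commute)
    qed
    have sym: "(z, z + axis i 1) \<in> ?J \<Longrightarrow> (p k, p (Suc k)) \<in> ?J"
      using z lat.joined_sym[of z "z + axis i 1"] unfolding edge_at_def by (auto simp: doubleton_eq_iff)
    show ?thesis
    proof (cases "edge_at z i \<in> touching_edges (cube b m)")
      case True
      then have "edge_at z i \<in> touching_edges (cube b m) - touching_edges (cube a n)"
        using p_out z by (auto simp: touching_edges_def)
      then show ?thesis by (intro sym joined_step)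
    next
      case False
      then have "p k \<notin> cube b m" "p (Suc k) \<notin> cube b m"
        using z edge_at_lattice[of z i] by (auto simp: touching_edges_def)
      then show ?thesis by (intro lat.joined_rel) auto
    qed
  qed
  have "(x, p k) \<in> ?J" for k
  proof (induction k)
    case 0
    have "p 0 = x" by (auto simp: p_def vec_eq_iff axis_def)
    then show ?case by simp
  next
    case (Suc k)
    then show ?case using step by (rule lat.joined_trans)
  qed
  moreover have "\<exists>k. p k \<notin> cube b m"
  proof -
    define k where "k = nat (\<bar>x $ i\<bar> + \<bar>b $ i\<bar> + int m + 1)"
    have "\<bar>p k $ i - b $ i\<bar> > int m"
      unfolding p_i k_def by (auto simp: s_def)
    then show ?thesis by (auto simp: cube_def not_le intro!: exI[of _ k] exI[of _ i])
  qed
  ultimately show ?thesis by blast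
qed

text \<open>
  Once all edges that do not touch the small cube are contracted, everything outside the small cube is
  identified, as it is in the wired graph of the small cube.
\<close>

lemma joined_outside:
  assumes sub: "cube a n \<subseteq> cube b m"
  shows "lat.joined {} ((\<lambda>e. (lattice_src e, lattice_tgt e)) ` (touching_edges (cube b m) - touching_edges (cube a n))
      \<union> (- cube b m) \<times> (- cube b m)) = lat.joined {} ((- cube a n) \<times> (- cube a n))"
    (is "lat.joined {} (?q ` ?F \<union> ?R) = ?J'")
proof (intro equalityI subrelI)
  fix x y assume "(x, y) \<in> lat.joined {} (?q ` ?F \<union> ?R)"
  then show "(x, y) \<in> ?J'"
  proof (induction rule: lat.joined_induct)
    case (rel x y)
    have "x \<notin> cube a n \<and> y \<notin> cube a n"
      using rel
    proof
      assume "(x, y) \<in> ?q ` ?F"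
      then obtain e where e: "e \<in> ?F" "x = lattice_src e" "y = lattice_tgt e" by auto
      then show ?thesis using lattice_ends[of e] by (auto simp: touching_edges_def)
    qed (use sub in auto)
    then show ?case by (intro lat.joined_rel) auto
  qed (auto intro: lat.joined_sym dest: lat.joined_trans)
next
  have eq: "(x, y) \<in> lat.joined {} (?q ` ?F \<union> ?R)" if "(x, y) \<in> lat.joined ?F ?R" for x y
    using that
  proof (induction rule: lat.joined_induct)
    case (rel x y)
    then show ?case by (intro lat.joined_rel) auto
  next
    case (edge e)
    then show ?case by (intro lat.joined_rel) auto
  qed (auto intro: lat.joined_sym dest: lat.joined_trans)
  fix x y assume "(x, y) \<in> ?J'"
  then have "x = y \<or> x \<notin> cube a n \<and> y \<notin> cube a n" by (auto simp: lat.joined_empty)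
  then show "(x, y) \<in> lat.joined {} (?q ` ?F \<union> ?R)"
  proof
    assume "x \<notin> cube a n \<and> y \<notin> cube a n"
    then obtain x' y' where x': "x' \<notin> cube b m" "(x, x') \<in> lat.joined ?F ?R"
      and y': "y' \<notin> cube b m" "(y, y') \<in> lat.joined ?F ?R"
      using escape_cube[OF sub, of x] escape_cube[OF sub, of y] by blast
    have "(x', y') \<in> lat.joined ?F ?R" using x' y' by (intro lat.joined_rel) auto
    then show ?thesis
      by (intro eq lat.joined_trans[OF x'(2)] lat.joined_trans[OF _ lat.joined_sym[OF y'(2)]])
  qed simp
qed

text \<open>
  By \<open>joined_outside\<close>, the wired graph of the small cube is a contraction of that of the large cube.
\<close>

lemma wired_prob_mono:
  assumes sub: "cube a n \<subseteq> cube b m"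
    and D: "A \<subseteq> touching_edges (cube a n)" "B \<subseteq> touching_edges (cube a n)" "A \<inter> B = {}"
    and c: "\<And>x. c x > 0"
  shows "wired_prob c (cube a n) (lat.meets_or_contains B A) \<le> wired_prob c (cube b m) (lat.meets_or_contains B A)"
proof -
  let ?F = "touching_edges (cube b m) - touching_edges (cube a n)"
  have s: "touching_edges (cube a n) \<subseteq> touching_edges (cube b m)"
    using sub by (auto simp: touching_edges_def)
  then have E: "touching_edges (cube b m) - ?F = touching_edges (cube a n)" by auto
  have "A \<subseteq> touching_edges (cube b m)" "B \<subseteq> touching_edges (cube b m)" "?F \<inter> A = {}" "?F \<inter> B = {}"
    "?F \<subseteq> touching_edges (cube b m)"
    using s D by auto
  from lat.tree_prob_contract[OF finite_graph_touching[OF finite_cube] this(1,2) D(3) this(3-5), of c] c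
  show ?thesis unfolding E wired_prob_def lat.tree_prob_cong_rel[OF joined_outside[OF sub]] by blast
qed

lemma sum_free_prob:
  assumes "\<And>x. c x > 0"
  shows "(\<Sum>e\<in>inner_edges (cube a n). free_prob c (cube a n) (\<lambda>T. e \<in> T)) = real (card (cube a n)) - 1"
  unfolding free_prob_def
  using lat.sum_tree_prob_edges[OF finite_inner_edges[OF finite_cube] _ free_trees_cube, of c] assms
  by (simp add: lat.quotient_discrete card_image)

lemma sum_wired_prob:
  assumes "\<And>x. c x > 0"
  shows "(\<Sum>e\<in>touching_edges (cube a n). wired_prob c (cube a n) (\<lambda>T. e \<in> T)) = real (card (cube a n))"
proof -
  let ?C = "- cube a n"
  have "?C \<noteq> {}" using exit_edge[OF finite_cube[of a n]] center_in_cube[of a n] by fastforce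
  moreover have "cube a n \<union> ?C = UNIV" by auto
  ultimately have "UNIV // lat.joined {} (?C \<times> ?C) = insert ?C ((\<lambda>v. {v}) ` cube a n)"
    using lat.quotient_block[of "cube a n" ?C] by simp
  moreover have "?C \<notin> (\<lambda>v. {v}) ` cube a n" by auto
  ultimately have "card (UNIV // lat.joined {} (?C \<times> ?C)) = Suc (card (cube a n))"
    using card_insert_disjoint[of "(\<lambda>v. {v}) ` cube a n" ?C] finite_cube[of a n]
      card_image[of "\<lambda>v. {v}" "cube a n"] by simp
  then show ?thesis
    unfolding wired_prob_def
    using lat.sum_tree_prob_edges[OF finite_touching_edges[OF finite_cube] _ wired_trees_cube, of c] assms
    by simp
qed

lemma image_lattice_edge:
  fixes z :: "int ^ 'd"
  shows "(+) z ` e \<in> lattice_edges \<longleftrightarrow> e \<in> lattice_edges"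
proof -
  have *: "(+) z ` e \<in> lattice_edges" if e: "e \<in> lattice_edges" for z :: "int ^ 'd" and e
  proof -
    obtain x i where "e = edge_at x i" using e by (rule lattice_edgeE)
    then have "(+) z ` e = edge_at (z + x) i" by (simp add: edge_at_def add.assoc)
    then show ?thesis by (simp add: edge_at_lattice)
  qed
  have "(+) (- z) ` ((+) z ` e) = e" by (simp add: image_image)
  then show ?thesis using * by metis
qed

lemma translate_edge_at: "(+) z ` edge_at x i = edge_at (z + x) i"
  by (simp add: edge_at_def add.assoc)

lemma inj_translate: "inj ((`) ((+) (z :: int ^ 'd)))"
  by (intro injI) (simp add: inj_image_eq_iff)

lemma edges_translate:
  fixes z :: "int ^ 'd"
  shows
  "inner_edges ((+) z ` A) = (`) ((+) z) ` inner_edges A"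
  "touching_edges ((+) z ` A) = (`) ((+) z) ` touching_edges A"
proof -
  have surj: "\<exists>e'. e = (+) z ` e'" for e :: "(int ^ 'd) set"
    by (rule exI[of _ "(+) (- z) ` e"]) (simp add: image_image)
  have "e \<in> (`) ((+) z) ` inner_edges A" if "e \<in> inner_edges ((+) z ` A)" for e
  proof -
    obtain e' where e': "e = (+) z ` e'" using surj by blast
    then have "e' \<in> inner_edges A"
      using that by (simp add: inner_edges_def image_lattice_edge inj_image_subset_iff)
    then show ?thesis using e' by blast
  qed
  then show "inner_edges ((+) z ` A) = (`) ((+) z) ` inner_edges A"
    by (auto simp: inner_edges_def image_lattice_edge)
  have "e \<in> (`) ((+) z) ` touching_edges A" if "e \<in> touching_edges ((+) z ` A)" for e
  proof -
    obtain e' where e': "e = (+) z ` e'" using surj by blast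
    then have "e' \<in> touching_edges A"
      using that by (simp add: touching_edges_def image_lattice_edge image_Int[symmetric])
    then show ?thesis using e' by blast
  qed
  then show "touching_edges ((+) z ` A) = (`) ((+) z) ` touching_edges A"
    by (auto simp: touching_edges_def image_lattice_edge)
qed

lemma ends_translate:
  assumes "e \<in> lattice_edges"
  shows "{lattice_src ((+) z ` e), lattice_tgt ((+) z ` e)} = {z + lattice_src e, z + lattice_tgt e}"
proof -
  have "{lattice_src ((+) z ` e), lattice_tgt ((+) z ` e)} = (+) z ` e"
    using assms by (intro lattice_ends) (simp add: image_lattice_edge)
  also have "\<dots> = (+) z ` {lattice_src e, lattice_tgt e}"
    using lattice_ends[OF assms] by simp
  finally show ?thesis by simp
qed

text \<open>
  The probability of a translated edge in a translated graph is the original one for the translated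
  conductances.
\<close>

lemma prob_translate:
  fixes z :: "int ^ 'd"
  shows
  "free_prob c ((+) z ` A) (\<lambda>T. (+) z ` e \<in> T) = free_prob (\<lambda>e. c ((+) z ` e)) A (\<lambda>T. e \<in> T)"
  "wired_prob c ((+) z ` A) (\<lambda>T. (+) z ` e \<in> T) = wired_prob (\<lambda>e. c ((+) z ` e)) A (\<lambda>T. e \<in> T)"
proof -
  have mem: "(+) z ` e \<in> (`) ((+) z) ` T \<longleftrightarrow> e \<in> T" for T :: "(int ^ 'd) set set"
    by (rule inj_image_mem_iff[OF inj_translate])
  have bij: "bij ((+) z)" by (rule bij_plus)
  have inj: "inj_on ((`) ((+) z)) E" for E :: "(int ^ 'd) set set"
    using inj_translate inj_on_subset by blast
  have tp: "lat.tree_prob c ((+) z ` V) ((`) ((+) z) ` E) (map_prod ((+) z) ((+) z) ` R) (\<lambda>T. (+) z ` e \<in> T) =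
      lat.tree_prob (\<lambda>e. c ((+) z ` e)) V E R (\<lambda>T. e \<in> T)" if "E \<subseteq> lattice_edges" for V E R
  proof -
    have ends: "{lattice_src ((+) z ` f), lattice_tgt ((+) z ` f)} = {z + lattice_src f, z + lattice_tgt f}"
      if "f \<in> E" for f
      using that \<open>E \<subseteq> lattice_edges\<close> by (intro ends_translate) auto
    show ?thesis
      using lat.tree_prob_automorphism[OF bij inj ends, where D = "\<lambda>T. (+) z ` e \<in> T"] unfolding mem by blast
  qed
  show "free_prob c ((+) z ` A) (\<lambda>T. (+) z ` e \<in> T) = free_prob (\<lambda>e. c ((+) z ` e)) A (\<lambda>T. e \<in> T)"
    using tp[of "inner_edges A" A "{}"] unfolding free_prob_def edges_translate
    by (simp add: inner_edges_def)
  have "map_prod ((+) z) ((+) z) ` ((- A) \<times> (- A)) = (- (+) z ` A) \<times> (- (+) z ` A)"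
  proof -
    have "map_prod f f ` (X \<times> X) = f ` X \<times> f ` X" for f :: "int ^ 'd \<Rightarrow> int ^ 'd" and X by force
    then show ?thesis using bij_image_Compl_eq[OF bij, of A] by simp
  qed
  moreover have "(+) z ` UNIV = UNIV" using bij by (rule bij_is_surj)
  moreover have "touching_edges A \<subseteq> lattice_edges" by (auto simp: touching_edges_def)
  ultimately show "wired_prob c ((+) z ` A) (\<lambda>T. (+) z ` e \<in> T) = wired_prob (\<lambda>e. c ((+) z ` e)) A (\<lambda>T. e \<in> T)"
    using tp[of "touching_edges A" UNIV "(- A) \<times> (- A)"] unfolding wired_prob_def edges_translate
    by metis
qed

lemma cube_translate: "(+) z ` cube a n = cube (z + a) n"
proof (intro equalityI subsetI)
  fix x assume "x \<in> cube (z + a) n"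
  then have "x - z \<in> cube a n" by (simp add: cube_def algebra_simps)
  moreover have "x = z + (x - z)" by simp
  ultimately show "x \<in> (+) z ` cube a n" by blast
qed (auto simp: cube_def)

section \<open>Infinite-volume limits of the tree probabilities\<close>

lemma finite_edges_subset_cube:
  assumes "finite K" "K \<subseteq> lattice_edges"
  shows "\<exists>k. \<forall>n\<ge>k. K \<subseteq> inner_edges (cube 0 n)"
proof -
  have "finite e" if "e \<in> K" for e
  proof -
    have "{lattice_src e, lattice_tgt e} = e" using that assms lattice_ends by blast
    then show ?thesis by (metis finite.emptyI finite.insertI)
  qed
  then have "finite (\<Union>K)" using assms by auto
  then obtain k where "\<forall>n\<ge>k. \<Union>K \<subseteq> cube 0 n" using finite_subset_cube by blast
  then show ?thesis using assms(2) unfolding inner_edges_def by blast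
qed

context
  fixes c :: "(int ^ 'd) set \<Rightarrow> real"
  assumes c: "\<And>e. c e > 0"
begin

lemma prob_bounds:
  "0 \<le> free_prob c (cube a n) D" "free_prob c (cube a n) D \<le> 1"
  "0 \<le> wired_prob c (cube a n) D" "wired_prob c (cube a n) D \<le> 1"
  unfolding free_prob_def wired_prob_def
  using lat.tree_prob_nonneg[of c] lat.tree_prob_le_1[of _ c] c
    finite_inner_edges[OF finite_cube] finite_touching_edges[OF finite_cube] by blast+

lemma free_prob_cube_antimono:
  assumes "cube a m \<subseteq> cube b n" "K \<subseteq> inner_edges (cube a m)"
  shows "free_prob c (cube b n) (\<lambda>T. K \<subseteq> T) \<le> free_prob c (cube a m) (\<lambda>T. K \<subseteq> T)"
  using free_prob_antimono[OF finite_cube cube_connected assms(1) _ free_trees_cube assms(2), of "{}" c]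
    c center_in_cube[of a m] by (auto simp: lat.meets_or_contains_empty)

lemma wired_prob_cube_mono:
  assumes "cube a m \<subseteq> cube b n" "K \<subseteq> touching_edges (cube a m)"
  shows "wired_prob c (cube a m) (\<lambda>T. K \<subseteq> T) \<le> wired_prob c (cube b n) (\<lambda>T. K \<subseteq> T)"
  using wired_prob_mono[OF assms, of "{}" c] c by (auto simp: lat.meets_or_contains_empty)

lemma free_prob_convergent:
  assumes "finite K" "K \<subseteq> lattice_edges"
  shows "convergent (\<lambda>n. free_prob c (cube 0 n) (\<lambda>T. K \<subseteq> T))"
proof -
  obtain k where k: "\<forall>n\<ge>k. K \<subseteq> inner_edges (cube 0 n)" using finite_edges_subset_cube[OF assms] by blast
  have "decseq (\<lambda>n. free_prob c (cube 0 (n + k)) (\<lambda>T. K \<subseteq> T))"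
    using k by (intro decseq_SucI free_prob_cube_antimono cube_mono) auto
  then have "convergent (\<lambda>n. free_prob c (cube 0 (n + k)) (\<lambda>T. K \<subseteq> T))"
    using prob_bounds(1) decseq_convergent unfolding convergent_def by metis
  then show ?thesis
    using convergent_ignore_initial_segment[of "\<lambda>n. free_prob c (cube 0 n) (\<lambda>T. K \<subseteq> T)" k] by simp
qed

lemma wired_prob_convergent:
  assumes "finite K" "K \<subseteq> lattice_edges"
  shows "convergent (\<lambda>n. wired_prob c (cube 0 n) (\<lambda>T. K \<subseteq> T))"
proof -
  obtain k where k: "\<forall>n\<ge>k. K \<subseteq> inner_edges (cube 0 n)" using finite_edges_subset_cube[OF assms] by blast
  have "K \<subseteq> touching_edges (cube 0 n)" if "n \<ge> k" for n using k that inner_subset_touching by blast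
  then have "incseq (\<lambda>n. wired_prob c (cube 0 (n + k)) (\<lambda>T. K \<subseteq> T))"
    by (intro incseq_SucI wired_prob_cube_mono cube_mono) auto
  then have "convergent (\<lambda>n. wired_prob c (cube 0 (n + k)) (\<lambda>T. K \<subseteq> T))"
    using prob_bounds(4) incseq_convergent unfolding convergent_def by metis
  then show ?thesis
    using convergent_ignore_initial_segment[of "\<lambda>n. wired_prob c (cube 0 n) (\<lambda>T. K \<subseteq> T)" k] by simp
qed

definition free_limit :: "(int ^ 'd) set set \<Rightarrow> real" where
  "free_limit K = lim (\<lambda>n. free_prob c (cube 0 n) (\<lambda>T. K \<subseteq> T))"

definition wired_limit :: "(int ^ 'd) set set \<Rightarrow> real" where
  "wired_limit K = lim (\<lambda>n. wired_prob c (cube 0 n) (\<lambda>T. K \<subseteq> T))"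

lemma free_limit:
  "finite K \<Longrightarrow> K \<subseteq> lattice_edges \<Longrightarrow> (\<lambda>n. free_prob c (cube 0 n) (\<lambda>T. K \<subseteq> T)) \<longlonglongrightarrow> free_limit K"
  unfolding free_limit_def using free_prob_convergent by (simp add: convergent_LIMSEQ_iff)

lemma wired_limit:
  "finite K \<Longrightarrow> K \<subseteq> lattice_edges \<Longrightarrow> (\<lambda>n. wired_prob c (cube 0 n) (\<lambda>T. K \<subseteq> T)) \<longlonglongrightarrow> wired_limit K"
  unfolding wired_limit_def using wired_prob_convergent by (simp add: convergent_LIMSEQ_iff)

lemma free_limit_le:
  assumes "finite K" "K \<subseteq> inner_edges (cube a m)"
  shows "free_limit K \<le> free_prob c (cube a m) (\<lambda>T. K \<subseteq> T)"
proof (rule LIMSEQ_le_const2[OF free_limit])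
  show "K \<subseteq> lattice_edges" using assms by (auto simp: inner_edges_def)
  show "\<exists>N. \<forall>n\<ge>N. free_prob c (cube 0 n) (\<lambda>T. K \<subseteq> T) \<le> free_prob c (cube a m) (\<lambda>T. K \<subseteq> T)"
    using cube_subset_centered[of a m] free_prob_cube_antimono[OF _ assms(2)] by blast
qed fact

lemma wired_limit_ge:
  assumes "finite K" "K \<subseteq> touching_edges (cube a m)"
  shows "wired_prob c (cube a m) (\<lambda>T. K \<subseteq> T) \<le> wired_limit K"
proof (rule LIMSEQ_le_const[OF wired_limit])
  show "K \<subseteq> lattice_edges" using assms by (auto simp: touching_edges_def)
  show "\<exists>N. \<forall>n\<ge>N. wired_prob c (cube a m) (\<lambda>T. K \<subseteq> T) \<le> wired_prob c (cube 0 n) (\<lambda>T. K \<subseteq> T)"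
    using cube_subset_centered[of a m] wired_prob_cube_mono[OF _ assms(2)] by blast
qed fact

lemma wired_le_free_cube:
  assumes "A \<subseteq> inner_edges (cube a n)" "B \<subseteq> inner_edges (cube a n)" "A \<inter> B = {}"
  shows "wired_prob c (cube a n) (lat.meets_or_contains B A) \<le> free_prob c (cube a n) (lat.meets_or_contains B A)"
  using wired_le_free(1)[OF finite_cube _ free_trees_cube assms, of c] c center_in_cube[of a n] by blast

lemma wired_limit_le_free_limit:
  assumes "finite K" "K \<subseteq> lattice_edges"
  shows "wired_limit K \<le> free_limit K"
proof (rule LIMSEQ_le[OF wired_limit free_limit])
  obtain k where k: "\<forall>n\<ge>k. K \<subseteq> inner_edges (cube 0 n)" using finite_edges_subset_cube[OF assms] by blast
  then show "\<exists>N. \<forall>n\<ge>N. wired_prob c (cube 0 n) (\<lambda>T. K \<subseteq> T) \<le> free_prob c (cube 0 n) (\<lambda>T. K \<subseteq> T)"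
    using wired_le_free_cube[of K 0 _ "{}"] by (intro exI[of _ k]) (auto simp: lat.meets_or_contains_empty)
qed (use assms in auto)

text \<open>
  By inclusion-exclusion, this is the limit of the comparison of the free and the wired probability of
  the increasing event that \<open>a\<close> is present or all of \<open>K\<close> is present.
\<close>

lemma limit_defect_insert:
  assumes K: "finite K" "K \<subseteq> lattice_edges" and a: "a \<in> lattice_edges" "a \<notin> K"
  shows "free_limit (insert a K) - wired_limit (insert a K) \<le>
    (free_limit {a} - wired_limit {a}) + (free_limit K - wired_limit K)"
proof -
  have aK: "finite (insert a K)" "insert a K \<subseteq> lattice_edges" using K a by auto
  obtain k where k: "\<forall>n\<ge>k. insert a K \<subseteq> inner_edges (cube 0 n)"
    using finite_edges_subset_cube[OF aK] by blast
  let ?f = "\<lambda>K n. free_prob c (cube 0 n) (\<lambda>T. K \<subseteq> T)" and ?w = "\<lambda>K n. wired_prob c (cube 0 n) (\<lambda>T. K \<subseteq> T)"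
  have "?w {a} n + ?w K n - ?w (insert a K) n \<le> ?f {a} n + ?f K n - ?f (insert a K) n" if "n \<ge> k" for n
  proof -
    have "K \<subseteq> inner_edges (cube 0 n)" "{a} \<subseteq> inner_edges (cube 0 n)" "K \<inter> {a} = {}"
      using k that a by auto
    from wired_le_free_cube[OF this] show ?thesis
      unfolding free_prob_def wired_prob_def
        lat.tree_prob_either[OF finite_inner_edges[OF finite_cube]]
        lat.tree_prob_either[OF finite_touching_edges[OF finite_cube]] .
  qed
  then have "wired_limit {a} + wired_limit K - wired_limit (insert a K) \<le>
      free_limit {a} + free_limit K - free_limit (insert a K)"
    using K a aK
    by (intro LIMSEQ_le[OF tendsto_diff[OF tendsto_add[OF wired_limit wired_limit] wired_limit]
          tendsto_diff[OF tendsto_add[OF free_limit free_limit] free_limit]]) auto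
  then show ?thesis by simp
qed

lemma limits_eq_if_edges_eq:
  assumes edges: "\<And>e. e \<in> lattice_edges \<Longrightarrow> free_limit {e} = wired_limit {e}"
    and K: "finite K" "K \<subseteq> lattice_edges"
  shows "free_limit K = wired_limit K"
  using K
proof (induction K)
  case empty
  have "free_prob c (cube 0 n) (\<lambda>T. {} \<subseteq> T) = 1" "wired_prob c (cube 0 n) (\<lambda>T. {} \<subseteq> T) = 1" for n
  proof -
    have "lat.tree_sum c (cube 0 n) (inner_edges (cube 0 n)) {} (\<lambda>_. True) > 0"
      by (rule lat.tree_sum_pos_iff[THEN iffD2, OF finite_inner_edges[OF finite_cube] c free_trees_cube])
    then show "free_prob c (cube 0 n) (\<lambda>T. {} \<subseteq> T) = 1"
      by (simp add: free_prob_def lat.tree_prob_def)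
    have "lat.tree_sum c UNIV (touching_edges (cube 0 n)) ((- cube 0 n) \<times> (- cube 0 n)) (\<lambda>_. True) > 0"
      by (rule lat.tree_sum_pos_iff[THEN iffD2, OF finite_touching_edges[OF finite_cube] c wired_trees_cube])
    then show "wired_prob c (cube 0 n) (\<lambda>T. {} \<subseteq> T) = 1"
      by (simp add: wired_prob_def lat.tree_prob_def)
  qed
  then show ?case by (simp only: free_limit_def wired_limit_def)
next
  case (insert a K)
  then have "free_limit (insert a K) - wired_limit (insert a K) \<le> 0"
    using limit_defect_insert[of K a] edges[of a] by auto
  moreover have "wired_limit (insert a K) \<le> free_limit (insert a K)"
    using insert by (intro wired_limit_le_free_limit) auto
  ultimately show ?case by simp
qed

end

section \<open>Weak limits of measures on binary configurations\<close>

abbreviation bool_space :: "'i set \<Rightarrow> ('i \<Rightarrow> bool) measure" where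
  "bool_space I \<equiv> Pi\<^sub>M I (\<lambda>_. count_space UNIV)"

text \<open>
  Coordinates in \<open>K\<close> are prescribed to be true, those in \<open>Z\<close> to be false.
\<close>

definition cylinder :: "'i set \<Rightarrow> 'i set \<Rightarrow> 'i set \<Rightarrow> ('i \<Rightarrow> bool) set" where
  "cylinder I K Z = {\<eta> \<in> space (bool_space I). (\<forall>i\<in>K. \<eta> i) \<and> (\<forall>i\<in>Z. \<not> \<eta> i)}"

lemma sets_cylinder:
  assumes "finite K" "finite Z" "K \<subseteq> I" "Z \<subseteq> I"
  shows "cylinder I K Z \<in> sets (bool_space I)"
proof -
  have [measurable]: "(\<lambda>\<eta>. \<eta> i) \<in> measurable (bool_space I) (count_space UNIV)" if "i \<in> I" for i
    using that by measurable
  have "{\<eta> \<in> space (bool_space I). \<forall>i\<in>K. \<eta> i} \<in> sets (bool_space I)"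
    using assms by (intro sets.sets_Collect_finite_All) auto
  moreover have "{\<eta> \<in> space (bool_space I). \<forall>i\<in>Z. \<not> \<eta> i} \<in> sets (bool_space I)"
    using assms by (intro sets.sets_Collect_finite_All) auto
  moreover have "cylinder I K Z = {\<eta> \<in> space (bool_space I). \<forall>i\<in>K. \<eta> i} \<inter> {\<eta> \<in> space (bool_space I). \<forall>i\<in>Z. \<not> \<eta> i}"
    by (auto simp: cylinder_def)
  ultimately show ?thesis by simp
qed

lemma measure_cylinder_insert:
  assumes M: "finite_measure M" "sets M = sets (bool_space I)"
    and fin: "finite K" "finite Z" "K \<subseteq> I" "Z \<subseteq> I" "z \<in> I"
  shows "measure M (cylinder I K (insert z Z)) = measure M (cylinder I K Z) - measure M (cylinder I (insert z K) Z)"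
proof -
  interpret finite_measure M by fact
  have eq: "cylinder I K (insert z Z) = cylinder I K Z - cylinder I (insert z K) Z"
    and "cylinder I (insert z K) Z \<subseteq> cylinder I K Z" by (auto simp: cylinder_def)
  moreover have "cylinder I K Z \<in> sets M" "cylinder I (insert z K) Z \<in> sets M"
    unfolding M(2) using fin by (auto intro!: sets_cylinder)
  ultimately show ?thesis unfolding eq by (intro finite_measure_Diff)
qed

text \<open>
  Prescribed false coordinates are removed one at a time by inclusion-exclusion; every box in the
  product of two-point spaces is a cylinder or empty.
\<close>

lemma measure_eqI_cylinder:
  assumes M: "prob_space M" "sets M = sets (bool_space I)" and N: "prob_space N" "sets N = sets (bool_space I)"
    and eq: "\<And>K. finite K \<Longrightarrow> K \<subseteq> I \<Longrightarrow> measure M (cylinder I K {}) = measure N (cylinder I K {})"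
  shows "M = N"
proof (rule measure_eqI_PiM_infinite)
  interpret M: prob_space M by fact
  interpret N: prob_space N by fact
  show "sets M = sets (bool_space I)" "sets N = sets (bool_space I)" "finite_measure M"
    using M N by (auto intro: M.finite_measure_axioms)
  have eq': "measure M (cylinder I K Z) = measure N (cylinder I K Z)" if "finite Z" "finite K" "K \<subseteq> I" "Z \<subseteq> I" for K Z
    using that
  proof (induction Z arbitrary: K)
    case (insert z Z)
    then show ?case
      using measure_cylinder_insert[OF M.finite_measure_axioms M(2), of K Z z]
        measure_cylinder_insert[OF N.finite_measure_axioms N(2), of K Z z] by simp
  qed (use eq in simp)
  fix A :: "'a \<Rightarrow> bool set" and J assume J: "finite J" "J \<subseteq> I"
  have "measure M (prod_emb I (\<lambda>_. count_space UNIV) J (Pi\<^sub>E J A)) =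
        measure N (prod_emb I (\<lambda>_. count_space UNIV) J (Pi\<^sub>E J A))"
  proof (cases "\<exists>i\<in>J. A i = {}")
    case True
    then have "Pi\<^sub>E J A = {}" by (auto simp: PiE_eq_empty_iff)
    then show ?thesis by simp
  next
    case False
    have *: "b \<in> A i \<longleftrightarrow> (A i = {True} \<longrightarrow> b) \<and> (A i = {False} \<longrightarrow> \<not> b)" if "i \<in> J" for b i
    proof -
      have "A i \<noteq> {}" using False that by auto
      then show ?thesis by (cases "True \<in> A i"; cases "False \<in> A i"; cases b) (auto, (metis (full_types))+)
    qed
    have "prod_emb I (\<lambda>_. count_space UNIV) J (Pi\<^sub>E J A) = {\<eta> \<in> space (bool_space I). \<forall>i\<in>J. \<eta> i \<in> A i}"
      unfolding prod_emb_def space_PiM vimage_def by (simp only: restrict_PiE_iff mem_Collect_eq) blast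
    also have "\<dots> = cylinder I {i \<in> J. A i = {True}} {i \<in> J. A i = {False}}"
      unfolding cylinder_def using * by blast
    finally show ?thesis using eq' J by (auto intro!: eq')
  qed
  then show "emeasure M (prod_emb I (\<lambda>_. count_space UNIV) J (Pi\<^sub>E J A)) =
      emeasure N (prod_emb I (\<lambda>_. count_space UNIV) J (Pi\<^sub>E J A))"
    by (simp add: M.emeasure_eq_measure N.emeasure_eq_measure)
qed

lemma measure_cylinder_refine:
  assumes M: "finite_measure M" "sets M = sets (bool_space I)"
    and JH: "J \<subseteq> H" "finite H" "H \<subseteq> I" "\<zeta> \<subseteq> J"
  shows "measure M (cylinder I \<zeta> (J - \<zeta>)) = (\<Sum>\<xi> | \<xi> \<subseteq> H \<and> \<xi> \<inter> J = \<zeta>. measure M (cylinder I \<xi> (H - \<xi>)))"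
proof -
  interpret finite_measure M by fact
  let ?X = "{\<xi>. \<xi> \<subseteq> H \<and> \<xi> \<inter> J = \<zeta>}"
  have "finite ?X" using JH by (intro finite_subset[of ?X "Pow H"]) auto
  moreover have "(\<lambda>\<xi>. cylinder I \<xi> (H - \<xi>)) ` ?X \<subseteq> sets M"
    using JH M(2) by (auto intro!: sets_cylinder intro: finite_subset)
  moreover have "disjoint_family_on (\<lambda>\<xi>. cylinder I \<xi> (H - \<xi>)) ?X"
    unfolding disjoint_family_on_def cylinder_def by blast
  ultimately have "measure M (\<Union>\<xi>\<in>?X. cylinder I \<xi> (H - \<xi>)) = (\<Sum>\<xi>\<in>?X. measure M (cylinder I \<xi> (H - \<xi>)))"
    by (rule finite_measure_finite_Union)
  moreover have "(\<Union>\<xi>\<in>?X. cylinder I \<xi> (H - \<xi>)) = cylinder I \<zeta> (J - \<zeta>)"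
  proof (intro equalityI subsetI)
    fix \<eta> assume "\<eta> \<in> cylinder I \<zeta> (J - \<zeta>)"
    then have "\<eta> \<in> cylinder I {i \<in> H. \<eta> i} (H - {i \<in> H. \<eta> i})" "{i \<in> H. \<eta> i} \<in> ?X"
      using JH by (auto simp: cylinder_def)
    then show "\<eta> \<in> (\<Union>\<xi>\<in>?X. cylinder I \<xi> (H - \<xi>))" by blast
  qed (use JH in \<open>auto simp: cylinder_def\<close>)
  ultimately show ?thesis by simp
qed

text \<open>
  The limits of the probabilities of all patterns on a finite index set define a consistent family of
  finite-dimensional distributions. The Daniell-Kolmogorov theorem applies to real coordinates, so
  truth values are encoded as 0 and 1 and decoded again by the threshold 1/2.
\<close>

lemma weak_limit_exists:
  fixes \<nu>s :: "nat \<Rightarrow> ('i \<Rightarrow> bool) measure"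
  assumes prob: "\<And>n. prob_space (\<nu>s n)" and sets: "\<And>n. sets (\<nu>s n) = sets (bool_space I)"
    and conv: "\<And>K. finite K \<Longrightarrow> K \<subseteq> I \<Longrightarrow> convergent (\<lambda>n. measure (\<nu>s n) (cylinder I K {}))"
  shows "\<exists>\<nu>. prob_space \<nu> \<and> sets \<nu> = sets (bool_space I) \<and>
    (\<forall>K. finite K \<and> K \<subseteq> I \<longrightarrow> (\<lambda>n. measure (\<nu>s n) (cylinder I K {})) \<longlonglongrightarrow> measure \<nu> (cylinder I K {}))"
proof -
  have fm: "finite_measure (\<nu>s n)" for n using prob[of n] by (rule prob_space.finite_measure)
  have conv': "convergent (\<lambda>n. measure (\<nu>s n) (cylinder I K Z))"
    if "finite Z" "finite K" "K \<subseteq> I" "Z \<subseteq> I" for K Z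
    using that
  proof (induction Z arbitrary: K)
    case (insert z Z)
    then show ?case
      unfolding measure_cylinder_insert[OF fm sets] by (subst measure_cylinder_insert[OF fm sets]) (auto intro!: convergent_diff)
  qed (use conv in simp)
  define p where "p J \<zeta> = lim (\<lambda>n. measure (\<nu>s n) (cylinder I \<zeta> (J - \<zeta>)))" for J \<zeta>
  have p: "(\<lambda>n. measure (\<nu>s n) (cylinder I \<zeta> (J - \<zeta>))) \<longlonglongrightarrow> p J \<zeta>" if "finite J" "J \<subseteq> I" "\<zeta> \<subseteq> J" for J \<zeta>
    unfolding p_def using that by (intro convergent_LIMSEQ_iff[THEN iffD1] conv') (auto intro: finite_subset)
  have p_nonneg: "0 \<le> p J \<zeta>" if "finite J" "J \<subseteq> I" "\<zeta> \<subseteq> J" for J \<zeta>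
    using p[OF that] by (rule LIMSEQ_le_const) (auto intro!: exI[of _ 0])
  have p_sum: "p J \<zeta> = (\<Sum>\<xi> | \<xi> \<subseteq> H \<and> \<xi> \<inter> J = \<zeta>. p H \<xi>)"
    if "J \<subseteq> H" "finite H" "H \<subseteq> I" "\<zeta> \<subseteq> J" for J H \<zeta>
  proof (rule LIMSEQ_unique)
    show "(\<lambda>n. measure (\<nu>s n) (cylinder I \<zeta> (J - \<zeta>))) \<longlonglongrightarrow> p J \<zeta>"
      using that by (intro p) (auto intro: finite_subset)
    show "(\<lambda>n. measure (\<nu>s n) (cylinder I \<zeta> (J - \<zeta>))) \<longlonglongrightarrow> (\<Sum>\<xi> | \<xi> \<subseteq> H \<and> \<xi> \<inter> J = \<zeta>. p H \<xi>)"
      unfolding measure_cylinder_refine[OF fm sets that] using that by (intro tendsto_sum p) auto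
  qed
  have p_total: "(\<Sum>\<xi>\<in>Pow H. p H \<xi>) = 1" if "finite H" "H \<subseteq> I" for H
  proof -
    have "measure (\<nu>s n) (cylinder I {} ({} - {})) = 1" for n
    proof -
      have "cylinder I {} ({} - {}) = space (\<nu>s n)" using sets_eq_imp_space_eq[OF sets[of n]] by (simp add: cylinder_def)
      then show ?thesis using prob_space.prob_space[OF prob[of n]] by simp
    qed
    then have "p {} {} = 1" unfolding p_def by simp
    moreover have "{\<xi>. \<xi> \<subseteq> H \<and> \<xi> \<inter> {} = {}} = Pow H" by auto
    ultimately show ?thesis using p_sum[of "{}" H "{}"] that by simp
  qed
  define f where "f J \<zeta> = (if \<zeta> \<subseteq> J then p J \<zeta> else 0)" for J \<zeta>
  \<comment> \<open>the law of the set of true coordinates in \<open>J\<close>\<close>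
  define q where "q J = embed_pmf (f J)" for J
  have q: "pmf (q J) \<zeta> = f J \<zeta>" if J: "finite J" "J \<subseteq> I" for J \<zeta>
    unfolding q_def
  proof (rule pmf_embed_pmf)
    show "0 \<le> f J x" for x using p_nonneg[OF J] by (simp add: f_def)
    have "(\<integral>\<^sup>+ x. ennreal (f J x) \<partial>count_space UNIV) = (\<integral>\<^sup>+ x. ennreal (f J x) \<partial>count_space (Pow J))"
      by (rule nn_integral_count_space_eq) (auto simp: f_def)
    also have "\<dots> = (\<Sum>x\<in>Pow J. ennreal (f J x))"
      using J by (intro nn_integral_count_space_finite) simp
    also have "\<dots> = ennreal (\<Sum>x\<in>Pow J. p J x)"
      using p_nonneg[OF J] by (subst sum_ennreal[symmetric]) (auto simp: f_def intro!: sum.cong)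
    finally show "(\<integral>\<^sup>+ x. ennreal (f J x) \<partial>count_space UNIV) = 1" using p_total[OF J] by simp
  qed
  have q_supp: "set_pmf (q J) \<subseteq> Pow J" if J: "finite J" "J \<subseteq> I" for J
    using q[OF J] by (auto simp: set_pmf_eq f_def split: if_splits)
  have q_map: "map_pmf (\<lambda>\<xi>. \<xi> \<inter> J) (q H) = q J" if JH: "J \<subseteq> H" "finite H" "H \<subseteq> I" for J H
  proof (rule pmf_eqI)
    fix \<zeta>
    have J: "finite J" "J \<subseteq> I" using JH finite_subset by auto
    let ?S = "{\<xi>. \<xi> \<subseteq> H \<and> \<xi> \<inter> J = \<zeta>}"
    have "pmf (map_pmf (\<lambda>\<xi>. \<xi> \<inter> J) (q H)) \<zeta> = measure (q H) (((\<lambda>\<xi>. \<xi> \<inter> J) -` {\<zeta>}) \<inter> set_pmf (q H))"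
      by (simp add: pmf_map measure_Int_set_pmf)
    also have "((\<lambda>\<xi>. \<xi> \<inter> J) -` {\<zeta>}) \<inter> set_pmf (q H) = ?S \<inter> set_pmf (q H)"
      using q_supp[OF JH(2,3)] by auto
    also have "measure (q H) \<dots> = measure (q H) ?S" by (rule measure_Int_set_pmf)
    also have "\<dots> = (\<Sum>\<xi>\<in>?S. pmf (q H) \<xi>)"
      using JH by (intro measure_measure_pmf_finite finite_subset[of ?S "Pow H"]) auto
    also have "\<dots> = (\<Sum>\<xi>\<in>?S. p H \<xi>)" by (intro sum.cong) (auto simp: q[OF JH(2,3)] f_def)
    also have "\<dots> = pmf (q J) \<zeta>"
    proof (cases "\<zeta> \<subseteq> J")
      case True
      then show ?thesis using p_sum[OF JH True] by (simp add: q[OF J] f_def)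
    next
      case False
      then have "?S = {}" by auto
      then show ?thesis using False by (simp only: sum.empty q[OF J] f_def if_False)
    qed
    finally show "pmf (map_pmf (\<lambda>\<xi>. \<xi> \<inter> J) (q H)) \<zeta> = pmf (q J) \<zeta>" .
  qed
  define ind where "ind J \<zeta> = (\<lambda>i\<in>J. of_bool (i \<in> \<zeta>) :: real)" for J :: "'i set" and \<zeta>
  define P where "P J = distr (measure_pmf (q J)) (Pi\<^sub>M J (\<lambda>_. borel)) (ind J)" for J
  have ind[measurable]: "ind J \<in> measurable (count_space UNIV) (Pi\<^sub>M J (\<lambda>_. borel))" for J
    by (auto simp: ind_def space_PiM)
  have ind_pmf[measurable]: "ind J \<in> measurable (measure_pmf r) (Pi\<^sub>M J (\<lambda>_. borel))" for J r
    by (auto simp: ind_def space_PiM)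
  have "projective_family I P (\<lambda>_. borel)"
  proof (rule projective_family.intro)
    fix J H assume JH: "J \<subseteq> H" "finite H" "H \<subseteq> (I :: 'i set)"
    have "P J = distr (distr (measure_pmf (q H)) (count_space UNIV) (\<lambda>\<xi>. \<xi> \<inter> J)) (Pi\<^sub>M J (\<lambda>_. borel)) (ind J)"
      unfolding P_def q_map[OF JH, symmetric] map_pmf_rep_eq ..
    also have "\<dots> = distr (measure_pmf (q H)) (Pi\<^sub>M J (\<lambda>_. borel)) (ind J \<circ> (\<lambda>\<xi>. \<xi> \<inter> J))"
      by (rule distr_distr[OF ind]) simp
    also have "ind J \<circ> (\<lambda>\<xi>. \<xi> \<inter> J) = (\<lambda>x. restrict x J) \<circ> ind H"
      using JH by (auto simp: ind_def fun_eq_iff)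
    also have "distr (measure_pmf (q H)) (Pi\<^sub>M J (\<lambda>_. borel)) ((\<lambda>x. restrict x J) \<circ> ind H) =
        distr (P H) (Pi\<^sub>M J (\<lambda>_. borel)) (\<lambda>x. restrict x J)"
      unfolding P_def using JH by (intro distr_distr[symmetric] measurable_restrict_subset ind_pmf)
    finally show "P J = distr (P H) (Pi\<^sub>M J (\<lambda>_. borel)) (\<lambda>x. restrict x J)" .
  next
    fix J :: "'i set" assume "finite J" "J \<subseteq> I"
    show "prob_space (P J)" unfolding P_def
      by (intro prob_space.prob_space_distr ind_pmf) (rule prob_space_measure_pmf)
  qed
  then interpret polish_projective I P by (rule polish_projective.intro)
  define dec where "dec x = (\<lambda>i\<in>I. x i > (1/2 :: real))" for x
  define \<nu> where "\<nu> = distr lim (bool_space I) dec"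
  have dec: "dec \<in> measurable lim (bool_space I)"
    unfolding dec_def
  proof (rule measurable_restrict)
    fix i assume "i \<in> I"
    then have "(\<lambda>x. x i) \<in> borel_measurable (Pi\<^sub>M I (\<lambda>_. borel :: real measure))"
      by (rule measurable_component_singleton)
    then have [measurable]: "(\<lambda>x. x i) \<in> borel_measurable lim"
      by (simp cong: measurable_cong_sets)
    show "(\<lambda>x. 1 / 2 < x i) \<in> measurable lim (count_space UNIV)" by measurable
  qed
  have 1: "prob_space \<nu>" unfolding \<nu>_def by (rule P.prob_space_distr[OF dec])
  have 2: "sets \<nu> = sets (bool_space I)" by (simp add: \<nu>_def)
  have 3: "(\<lambda>n. measure (\<nu>s n) (cylinder I K {})) \<longlonglongrightarrow> measure \<nu> (cylinder I K {})" if K: "finite K" "K \<subseteq> I" for K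
  proof -
    let ?X = "Pi\<^sub>E K (\<lambda>_. {1/2<..}) :: ('i \<Rightarrow> real) set"
    have X: "?X \<in> sets (Pi\<^sub>M K (\<lambda>_. borel))" using K by (intro sets_PiM_I_finite) auto
    have "measure \<nu> (cylinder I K {}) = measure lim (dec -` cylinder I K {} \<inter> space lim)"
      unfolding \<nu>_def using K by (intro measure_distr dec sets_cylinder) auto
    also have "dec -` cylinder I K {} \<inter> space lim = emb I K ?X"
    proof -
      have "dec x i \<longleftrightarrow> 1/2 < x i" if "i \<in> K" for x i using that K by (auto simp: dec_def)
      moreover have "dec x \<in> space (bool_space I)" for x by (simp add: dec_def space_PiM)
      ultimately have "dec x \<in> cylinder I K {} \<longleftrightarrow> (\<forall>i\<in>K. x i \<in> {1/2<..})" for x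
        by (simp add: cylinder_def)
      then show ?thesis
        unfolding prod_emb_def vimage_def space_lim space_PiM by (simp only: restrict_PiE_iff mem_Collect_eq)
    qed
    also have "measure lim \<dots> = measure (P K) ?X" using K X by (intro measure_lim_emb)
    also have "\<dots> = measure (q K) (ind K -` ?X)"
      unfolding P_def using X by (subst measure_distr[OF ind_pmf]) auto
    also have "ind K -` ?X = {\<zeta>. K \<subseteq> \<zeta>}"
      by (auto simp: ind_def PiE_iff of_bool_def split: if_splits)
    also have "measure (q K) \<dots> = measure (q K) (\<dots> \<inter> set_pmf (q K))" by (rule measure_Int_set_pmf[symmetric])
    also have "{\<zeta>. K \<subseteq> \<zeta>} \<inter> set_pmf (q K) = {K} \<inter> set_pmf (q K)" using q_supp[OF K] by auto
    also have "measure (q K) \<dots> = measure (q K) {K}" by (rule measure_Int_set_pmf)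
    also have "\<dots> = p K K" using q[OF K] by (simp add: measure_pmf_single f_def)
    finally show ?thesis using p[OF K order_refl] by simp
  qed
  show ?thesis using 1 2 3 by blast
qed

section \<open>The random spanning tree measures\<close>

definition conductance :: "real \<Rightarrow> ((int ^ 'd) set \<Rightarrow> real) \<Rightarrow> (int ^ 'd) set \<Rightarrow> real" where
  "conductance \<beta> \<omega> e = exp (- \<beta> * \<omega> e)"

lemma conductance_pos: "conductance \<beta> \<omega> e > 0"
  by (simp add: conductance_def)

lemma config_space_eq: "config_space = bool_space lattice_edges"
  by (simp add: config_space_def)

lemma spanning_tree_measure:
  fixes G :: "('v, (int ^ 'd) set) multigraph"
  assumes S: "spanning_trees G = lat.trees V E R" and E: "finite E" and ne: "lat.trees V E R \<noteq> {}"
  shows "prob_space (spanning_tree_measure G \<omega> \<beta>)"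
    and "sets (spanning_tree_measure G \<omega> \<beta>) = sets (bool_space lattice_edges)"
    and "finite K \<Longrightarrow> K \<subseteq> lattice_edges \<Longrightarrow>
      measure (spanning_tree_measure G \<omega> \<beta>) (cylinder lattice_edges K {}) =
        lat.tree_prob (conductance \<beta> \<omega>) V E R (\<lambda>T. K \<subseteq> T)"
proof -
  let ?S = "spanning_trees G"
  let ?c = "conductance \<beta> \<omega>"
  let ?Z = "\<Sum>S\<in>?S. tree_weight \<omega> \<beta> S"
  have fin: "finite ?S" unfolding S by (rule lat.finite_trees[OF E])
  have w: "tree_weight \<omega> \<beta> T = prod ?c T" for T
    by (simp add: tree_weight_def conductance_def)
  have Z: "?Z = lat.tree_sum ?c V E R (\<lambda>_. True)" unfolding w S by (simp add: lat.tree_sum_def)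
  have Zpos: "?Z > 0" unfolding Z using lat.tree_sum_pos_iff[OF E, of ?c V R] ne conductance_pos by blast
  have wpos: "tree_weight \<omega> \<beta> T > 0" for T unfolding w using conductance_pos by (intro prod_pos) auto
  define P where "P = point_measure ?S (\<lambda>T. ennreal (tree_weight \<omega> \<beta> T / ?Z))"
  have meas: "config_of \<in> measurable P config_space"
    unfolding P_def by (auto simp: config_space_def config_of_def space_PiM)
  have P: "emeasure P X = ennreal ((\<Sum>T\<in>X. tree_weight \<omega> \<beta> T) / ?Z)" if "X \<subseteq> ?S" for X
  proof -
    have "emeasure P X = (\<Sum>T\<in>X. ennreal (tree_weight \<omega> \<beta> T / ?Z))"
      unfolding P_def using fin that by (rule emeasure_point_measure_finite)
    also have "\<dots> = ennreal (\<Sum>T\<in>X. tree_weight \<omega> \<beta> T / ?Z)"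
      using wpos Zpos by (intro sum_ennreal) (simp add: less_imp_le)
    finally show ?thesis by (simp add: sum_divide_distrib)
  qed
  have spP: "space P = ?S" by (simp add: P_def space_point_measure)
  have "prob_space P"
    by (rule prob_spaceI) (use P[of ?S] Zpos in \<open>simp add: spP\<close>)
  then show "prob_space (spanning_tree_measure G \<omega> \<beta>)"
    unfolding spanning_tree_measure_def P_def[symmetric] by (rule prob_space.prob_space_distr[OF _ meas])
  show "sets (spanning_tree_measure G \<omega> \<beta>) = sets (bool_space lattice_edges)"
    by (simp add: spanning_tree_measure_def config_space_def)
  show "measure (spanning_tree_measure G \<omega> \<beta>) (cylinder lattice_edges K {}) =
        lat.tree_prob ?c V E R (\<lambda>T. K \<subseteq> T)" if K: "finite K" "K \<subseteq> lattice_edges"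
  proof -
    have "measure (spanning_tree_measure G \<omega> \<beta>) (cylinder lattice_edges K {}) =
        measure P (config_of -` cylinder lattice_edges K {} \<inter> space P)"
      unfolding spanning_tree_measure_def P_def[symmetric] using K
      by (intro measure_distr meas) (simp add: config_space_def sets_cylinder)
    also have "config_of -` cylinder lattice_edges K {} \<inter> space P = {T. T \<in> lat.trees V E R \<and> K \<subseteq> T}"
    proof -
      have "config_of T e \<longleftrightarrow> e \<in> T" if "e \<in> K" for T e using K that by (auto simp: config_of_def)
      moreover have "config_of T \<in> space (bool_space lattice_edges)" for T
        by (simp add: config_of_def space_PiM)
      ultimately show ?thesis unfolding spP S cylinder_def by auto
    qed
    also have "measure P \<dots> = (\<Sum>T | T \<in> lat.trees V E R \<and> K \<subseteq> T. tree_weight \<omega> \<beta> T) / ?Z"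
    proof -
      have "0 \<le> (\<Sum>T | T \<in> lat.trees V E R \<and> K \<subseteq> T. tree_weight \<omega> \<beta> T) / ?Z"
        using wpos Zpos by (intro divide_nonneg_nonneg sum_nonneg) (simp_all add: less_imp_le)
      moreover have "{T. T \<in> lat.trees V E R \<and> K \<subseteq> T} \<subseteq> ?S" unfolding S by auto
      ultimately show ?thesis unfolding measure_def using P by (simp add: enn2real_ennreal)
    qed
    also have "\<dots> = lat.tree_prob ?c V E R (\<lambda>T. K \<subseteq> T)"
      unfolding Z by (simp add: lat.tree_prob_def lat.tree_sum_def w)
    finally show ?thesis .
  qed
qed

lemma free_measure:
  shows "prob_space (spanning_tree_measure (free_graph (lattice_box n)) \<omega> \<beta>)"
    and "sets (spanning_tree_measure (free_graph (lattice_box n)) \<omega> \<beta>) = sets (bool_space lattice_edges)"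
    and "finite K \<Longrightarrow> K \<subseteq> lattice_edges \<Longrightarrow>
      measure (spanning_tree_measure (free_graph (lattice_box n)) \<omega> \<beta>) (cylinder lattice_edges K {}) =
        free_prob (conductance \<beta> \<omega>) (cube 0 n) (\<lambda>T. K \<subseteq> T)"
  unfolding lattice_box_eq free_prob_def
  using center_in_cube[of 0 n]
  by (intro spanning_tree_measure[OF spanning_trees_free[OF finite_cube]
        finite_inner_edges[OF finite_cube] free_trees_cube]; auto)+

lemma wired_measure:
  shows "prob_space (spanning_tree_measure (wired_graph (lattice_box n)) \<omega> \<beta>)"
    and "sets (spanning_tree_measure (wired_graph (lattice_box n)) \<omega> \<beta>) = sets (bool_space lattice_edges)"
    and "finite K \<Longrightarrow> K \<subseteq> lattice_edges \<Longrightarrow>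
      measure (spanning_tree_measure (wired_graph (lattice_box n)) \<omega> \<beta>) (cylinder lattice_edges K {}) =
        wired_prob (conductance \<beta> \<omega>) (cube 0 n) (\<lambda>T. K \<subseteq> T)"
  unfolding lattice_box_eq wired_prob_def
  by (intro spanning_tree_measure[OF spanning_trees_wired[OF finite_cube]
        finite_touching_edges[OF finite_cube] wired_trees_cube]; auto)+

lemma cylinder_event:
  assumes "sets M = sets (bool_space lattice_edges)"
  shows "{\<eta> \<in> space M. \<forall>e\<in>K. \<eta> e} = cylinder lattice_edges K {}"
  using sets_eq_imp_space_eq[OF assms] by (simp add: cylinder_def)

lemma converges_weakly_iff:
  assumes "\<And>n. sets (\<nu>s n) = sets (bool_space lattice_edges)" "sets \<nu> = sets (bool_space lattice_edges)"
  shows "converges_weakly \<nu>s \<nu> \<longleftrightarrow>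
    (\<forall>K. finite K \<and> K \<subseteq> lattice_edges \<longrightarrow>
      (\<lambda>n. measure (\<nu>s n) (cylinder lattice_edges K {})) \<longlonglongrightarrow> measure \<nu> (cylinder lattice_edges K {}))"
  unfolding converges_weakly_def cylinder_event[OF assms(1)] cylinder_event[OF assms(2)] ..

lemma countable_lattice_edges: "countable (lattice_edges :: (int ^ 'd) set set)"
proof -
  have "lattice_edges \<subseteq> (\<Union>n. inner_edges (cube 0 n) :: (int ^ 'd) set set)"
  proof
    fix e :: "(int ^ 'd) set" assume "e \<in> lattice_edges"
    then show "e \<in> (\<Union>n. inner_edges (cube 0 n))"
      using finite_edges_subset_cube[of "{e}"] by auto
  qed
  moreover have "countable (\<Union>n. inner_edges (cube 0 n) :: (int ^ 'd) set set)"
    by (rule countable_UN) (auto intro: countable_finite finite_inner_edges finite_cube)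
  ultimately show ?thesis by (rule countable_subset)
qed

lemma cycle_free_free_graph: "cycle_free (free_graph A) = cycle_free lattice"
  by (intro ext) (simp add: cycle_free_def is_cycle_def free_graph_def lattice_def)

text \<open>
  A cycle of the lattice inside a box is a cycle of the free graph of this box, and is therefore never
  contained in a spanning tree. There are only countably many finite sets of edges.
\<close>

lemma weak_limit_cycle_free:
  fixes \<nu> :: "((int ^ 'd) set \<Rightarrow> bool) measure"
  assumes \<nu>: "prob_space \<nu>" "sets \<nu> = sets (bool_space lattice_edges)"
    and conv: "converges_weakly (\<lambda>n. spanning_tree_measure (free_graph (lattice_box n)) \<omega> \<beta>) \<nu>"
  shows "AE \<eta> in \<nu>. cycle_free lattice (open_edges \<eta>)"
proof -
  interpret prob_space \<nu> by fact
  let ?\<K> = "{K :: (int ^ 'd) set set. finite K \<and> K \<subseteq> lattice_edges \<and> \<not> cycle_free lattice K}"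
  have null: "measure \<nu> (cylinder lattice_edges K {}) = 0" if K: "K \<in> ?\<K>" for K
  proof -
    have "free_prob (conductance \<beta> \<omega>) (cube 0 n) (\<lambda>T. K \<subseteq> T) = 0" for n
      unfolding free_prob_def
    proof (rule lat.tree_prob_eq_0)
      fix T assume "T \<in> free_trees (cube (0 :: int ^ 'd) n)"
      then have "T \<in> spanning_trees (free_graph (cube 0 n))"
        using spanning_trees_free[OF finite_cube, of 0 n] center_in_cube[of 0 n] by auto
      then have "cycle_free lattice T" by (simp add: spanning_trees_def cycle_free_free_graph)
      then show "\<not> K \<subseteq> T" using K by (auto simp: cycle_free_def)
    qed
    then have "(\<lambda>n. 0) \<longlonglongrightarrow> measure \<nu> (cylinder lattice_edges K {})"
      using conv K unfolding converges_weakly_iff[OF free_measure(2) \<nu>(2)]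
      by (auto simp: free_measure(3))
    then show ?thesis by (simp add: LIMSEQ_const_iff)
  qed
  have "countable {K :: (int ^ 'd) set set. finite K \<and> K \<subseteq> lattice_edges}"
    using countable_Collect_finite_subset[OF countable_lattice_edges] by (simp add: conj_commute)
  then have "countable ?\<K>" by (rule countable_subset[rotated]) auto
  moreover have "AE \<eta> in \<nu>. \<not> K \<subseteq> open_edges \<eta>" if K: "K \<in> ?\<K>" for K
  proof -
    have "cylinder lattice_edges K {} \<in> sets \<nu>" unfolding \<nu>(2) using K by (intro sets_cylinder) auto
    then have "cylinder lattice_edges K {} \<in> null_sets \<nu>"
      using null[OF K] by (simp add: null_setsI emeasure_eq_measure)
    then show ?thesis
      by (rule AE_I') (use sets_eq_imp_space_eq[OF \<nu>(2)] in \<open>auto simp: cylinder_def open_edges_def\<close>)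
  qed
  ultimately have "AE \<eta> in \<nu>. \<forall>K\<in>?\<K>. \<not> K \<subseteq> open_edges \<eta>" by (subst AE_ball_countable) auto
  then show ?thesis
  proof (rule AE_mp, intro AE_I2 impI)
    fix \<eta> assume *: "\<forall>K\<in>?\<K>. \<not> K \<subseteq> open_edges \<eta>"
    show "cycle_free lattice (open_edges \<eta>)"
      unfolding cycle_free_def
    proof
      assume "\<exists>vs es. set es \<subseteq> open_edges \<eta> \<and> is_cycle lattice vs es"
      then obtain vs es where es: "set es \<subseteq> open_edges \<eta>" "is_cycle lattice vs es" by blast
      then have "set es \<in> ?\<K>" by (auto simp: open_edges_def cycle_free_def)
      then show False using * es(1) by blast
    qed
  qed
qed

section \<open>Averaging over the environment\<close>

abbreviation environment :: "real measure \<Rightarrow> ((int ^ 'd) set \<Rightarrow> real) measure" where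
  "environment \<mu> \<equiv> Pi\<^sub>M lattice_edges (\<lambda>_. \<mu>)"

lemmas conductance_bounds = prob_bounds[where c = "conductance \<beta> \<omega>" for \<beta> \<omega>, OF conductance_pos]
  and conductance_free_limit = free_limit[where c = "conductance \<beta> \<omega>" for \<beta> \<omega>, OF conductance_pos]
  and conductance_wired_limit = wired_limit[where c = "conductance \<beta> \<omega>" for \<beta> \<omega>, OF conductance_pos]
  and conductance_free_limit_le = free_limit_le[where c = "conductance \<beta> \<omega>" for \<beta> \<omega>, OF conductance_pos]
  and conductance_wired_limit_ge = wired_limit_ge[where c = "conductance \<beta> \<omega>" for \<beta> \<omega>, OF conductance_pos]
  and conductance_limit_le =
    wired_limit_le_free_limit[where c = "conductance \<beta> \<omega>" for \<beta> \<omega>, OF conductance_pos]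
  and conductance_limits_eq =
    limits_eq_if_edges_eq[where c = "conductance \<beta> \<omega>" for \<beta> \<omega>, OF conductance_pos]
  and conductance_sum_free = sum_free_prob[where c = "conductance \<beta> \<omega>" for \<beta> \<omega>, OF conductance_pos]
  and conductance_sum_wired = sum_wired_prob[where c = "conductance \<beta> \<omega>" for \<beta> \<omega>, OF conductance_pos]

lemma tree_prob_measurable:
  assumes \<mu>: "sets \<mu> = sets borel" and E: "E \<subseteq> lattice_edges"
  shows "(\<lambda>\<omega>. lat.tree_prob (conductance \<beta> \<omega>) V E R D) \<in> borel_measurable (environment \<mu>)"
proof -
  have "(\<lambda>\<omega>. conductance \<beta> \<omega> e) \<in> borel_measurable (environment \<mu>)" if "e \<in> lattice_edges" for e
  proof -
    have "(\<lambda>\<omega>. \<omega> e) \<in> measurable (environment \<mu>) \<mu>"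
      using that by (rule measurable_component_singleton)
    then have [measurable]: "(\<lambda>\<omega>. \<omega> e) \<in> borel_measurable (environment \<mu>)"
      using measurable_cong_sets[OF refl \<mu>] by blast
    show ?thesis unfolding conductance_def by measurable
  qed
  then have "(\<lambda>\<omega>. prod (conductance \<beta> \<omega>) T) \<in> borel_measurable (environment \<mu>)"
    if "T \<in> lat.trees V E R" for T
    using that E by (intro borel_measurable_prod) (auto simp: lat.trees_def)
  then have "(\<lambda>\<omega>. lat.tree_sum (conductance \<beta> \<omega>) V E R D) \<in> borel_measurable (environment \<mu>)" for D
    unfolding lat.tree_sum_def by (intro borel_measurable_sum) auto
  then show ?thesis unfolding lat.tree_prob_def by (intro borel_measurable_divide)
qed

lemma inner_edges_lattice: "inner_edges A \<subseteq> lattice_edges"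
  and touching_edges_lattice: "touching_edges A \<subseteq> lattice_edges"
  by (auto simp: inner_edges_def touching_edges_def)

text \<open>
  Independent and identically distributed environments are stationary.
\<close>

lemma environment_shift:
  fixes z :: "int ^ 'd"
  assumes "prob_space \<mu>"
  shows "distr (environment \<mu>) (environment \<mu>) (\<lambda>\<omega>. \<lambda>e\<in>lattice_edges. \<omega> ((+) z ` e)) = environment \<mu>"
proof -
  have "inj_on ((`) ((+) z)) lattice_edges" using inj_translate inj_on_subset by blast
  moreover have "(`) ((+) z) \<in> lattice_edges \<rightarrow> lattice_edges" by (auto simp: image_lattice_edge)
  ultimately show ?thesis
    using distr_PiM_reindex[of lattice_edges "\<lambda>_. \<mu>" "(`) ((+) z)" lattice_edges] assms by simp
qed

lemma environment_shift_measurable: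
  fixes z :: "int ^ 'd"
  shows "(\<lambda>\<omega>. \<lambda>e\<in>lattice_edges. \<omega> ((+) z ` e)) \<in> measurable (environment \<mu>) (environment \<mu>)"
  by (intro measurable_restrict measurable_component_singleton) (simp add: image_lattice_edge)

lemma prob_shift:
  fixes z :: "int ^ 'd"
  defines "moved \<equiv> \<lambda>\<omega>. \<lambda>e\<in>lattice_edges. \<omega> ((+) z ` e)"
  shows "free_prob (conductance \<beta> \<omega>) ((+) z ` A) (\<lambda>T. (+) z ` e \<in> T) =
      free_prob (conductance \<beta> (moved \<omega>)) A (\<lambda>T. e \<in> T)"
    and "wired_prob (conductance \<beta> \<omega>) ((+) z ` A) (\<lambda>T. (+) z ` e \<in> T) =
      wired_prob (conductance \<beta> (moved \<omega>)) A (\<lambda>T. e \<in> T)"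
proof -
  have c: "conductance \<beta> \<omega> ((+) z ` e) = conductance \<beta> (moved \<omega>) e" if "e \<in> lattice_edges" for e
    using that by (simp add: conductance_def moved_def)
  show "free_prob (conductance \<beta> \<omega>) ((+) z ` A) (\<lambda>T. (+) z ` e \<in> T) =
      free_prob (conductance \<beta> (moved \<omega>)) A (\<lambda>T. e \<in> T)"
    unfolding prob_translate(1) unfolding free_prob_def
    by (rule lat.tree_prob_cong_weight) (rule c, simp add: inner_edges_def)
  show "wired_prob (conductance \<beta> \<omega>) ((+) z ` A) (\<lambda>T. (+) z ` e \<in> T) =
      wired_prob (conductance \<beta> (moved \<omega>)) A (\<lambda>T. e \<in> T)"
    unfolding prob_translate(2) unfolding wired_prob_def
    by (rule lat.tree_prob_cong_weight) (rule c, simp add: touching_edges_def)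
qed

context
  fixes \<mu> :: "real measure" and \<beta> :: real
  assumes \<mu>: "real_distribution \<mu>"
begin

interpretation real_distribution \<mu> by (rule \<mu>)

lemma prob_space_environment: "prob_space (environment \<mu>)"
  by (intro prob_space_PiM prob_space_axioms)

lemma sets_\<mu>: "sets \<mu> = sets borel"
  by (rule events_eq_borel)

definition mean_free :: "(int ^ 'd) set \<Rightarrow> (int ^ 'd) set \<Rightarrow> real" where
  "mean_free A e = (\<integral>\<omega>. free_prob (conductance \<beta> \<omega>) A (\<lambda>T. e \<in> T) \<partial>environment \<mu>)"

definition mean_wired :: "(int ^ 'd) set \<Rightarrow> (int ^ 'd) set \<Rightarrow> real" where
  "mean_wired A e = (\<integral>\<omega>. wired_prob (conductance \<beta> \<omega>) A (\<lambda>T. e \<in> T) \<partial>environment \<mu>)"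

lemma free_prob_measurable:
  "(\<lambda>\<omega>. free_prob (conductance \<beta> \<omega>) A D) \<in> borel_measurable (environment \<mu>)"
  unfolding free_prob_def by (rule tree_prob_measurable[OF sets_\<mu> inner_edges_lattice])

lemma wired_prob_measurable:
  "(\<lambda>\<omega>. wired_prob (conductance \<beta> \<omega>) A D) \<in> borel_measurable (environment \<mu>)"
  unfolding wired_prob_def by (rule tree_prob_measurable[OF sets_\<mu> touching_edges_lattice])

lemma integrable_prob:
  fixes f :: "((int ^ 'd) set \<Rightarrow> real) \<Rightarrow> real"
  assumes "f \<in> borel_measurable (environment \<mu>)" "\<And>\<omega>. 0 \<le> f \<omega>" "\<And>\<omega>. f \<omega> \<le> 1"
  shows "integrable (environment \<mu>) f"
  using assms
  by (intro finite_measure.integrable_const_bound[of _ _ 1] prob_space.finite_measure prob_space_environment) auto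

lemma integrable_free_prob:
  "integrable (environment \<mu>) (\<lambda>\<omega>. free_prob (conductance \<beta> \<omega>) (cube a n) D)"
  by (intro integrable_prob free_prob_measurable conductance_bounds)

lemma integrable_wired_prob:
  "integrable (environment \<mu>) (\<lambda>\<omega>. wired_prob (conductance \<beta> \<omega>) (cube a n) D)"
  by (intro integrable_prob wired_prob_measurable conductance_bounds)

lemma mean_translate:
  fixes z :: "int ^ 'd"
  shows "mean_free ((+) z ` A) ((+) z ` e) = mean_free A e"
    and "mean_wired ((+) z ` A) ((+) z ` e) = mean_wired A e"
proof -
  let ?s = "\<lambda>\<omega>. \<lambda>e\<in>lattice_edges. \<omega> ((+) z ` e)"
  have "(\<integral>\<omega>. g (?s \<omega>) \<partial>environment \<mu>) = (\<integral>\<omega>. g \<omega> \<partial>environment \<mu>)"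
    if "g \<in> borel_measurable (environment \<mu>)" for g :: "((int ^ 'd) set \<Rightarrow> real) \<Rightarrow> real"
    using integral_distr[OF environment_shift_measurable[of z \<mu>] that]
      environment_shift[OF prob_space_axioms, of z] by simp
  then show "mean_free ((+) z ` A) ((+) z ` e) = mean_free A e"
    "mean_wired ((+) z ` A) ((+) z ` e) = mean_wired A e"
    unfolding mean_free_def mean_wired_def prob_shift
    using free_prob_measurable wired_prob_measurable by blast+
qed

definition free_mean_limit :: "(int ^ 'd) set \<Rightarrow> real" where
  "free_mean_limit e = (\<integral>\<omega>. free_limit (conductance \<beta> \<omega>) {e} \<partial>environment \<mu>)"

definition wired_mean_limit :: "(int ^ 'd) set \<Rightarrow> real" where
  "wired_mean_limit e = (\<integral>\<omega>. wired_limit (conductance \<beta> \<omega>) {e} \<partial>environment \<mu>)"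

lemma integrable_limit:
  fixes e :: "(int ^ 'd) set"
  assumes e: "e \<in> lattice_edges"
  shows "integrable (environment \<mu>) (\<lambda>\<omega>. free_limit (conductance \<beta> \<omega>) {e})"
    and "integrable (environment \<mu>) (\<lambda>\<omega>. wired_limit (conductance \<beta> \<omega>) {e})"
proof -
  have f: "(\<lambda>n. free_prob (conductance \<beta> \<omega>) (cube 0 n) (\<lambda>T. {e} \<subseteq> T)) \<longlonglongrightarrow> free_limit (conductance \<beta> \<omega>) {e}" for \<omega>
    using e by (intro conductance_free_limit) auto
  have w: "(\<lambda>n. wired_prob (conductance \<beta> \<omega>) (cube 0 n) (\<lambda>T. {e} \<subseteq> T)) \<longlonglongrightarrow> wired_limit (conductance \<beta> \<omega>) {e}" for \<omega>
    using e by (intro conductance_wired_limit) auto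
  show "integrable (environment \<mu>) (\<lambda>\<omega>. free_limit (conductance \<beta> \<omega>) {e})"
  proof (rule integrable_prob)
    show "(\<lambda>\<omega>. free_limit (conductance \<beta> \<omega>) {e}) \<in> borel_measurable (environment \<mu>)"
      by (rule borel_measurable_LIMSEQ_real[OF f free_prob_measurable])
    show "0 \<le> free_limit (conductance \<beta> \<omega>) {e}" for \<omega>
      by (rule LIMSEQ_le_const[OF f]) (intro exI allI impI conductance_bounds)
    show "free_limit (conductance \<beta> \<omega>) {e} \<le> 1" for \<omega>
      by (rule LIMSEQ_le_const2[OF f]) (intro exI allI impI conductance_bounds)
  qed
  show "integrable (environment \<mu>) (\<lambda>\<omega>. wired_limit (conductance \<beta> \<omega>) {e})"
  proof (rule integrable_prob)
    show "(\<lambda>\<omega>. wired_limit (conductance \<beta> \<omega>) {e}) \<in> borel_measurable (environment \<mu>)"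
      by (rule borel_measurable_LIMSEQ_real[OF w wired_prob_measurable])
    show "0 \<le> wired_limit (conductance \<beta> \<omega>) {e}" for \<omega>
      by (rule LIMSEQ_le_const[OF w]) (intro exI allI impI conductance_bounds)
    show "wired_limit (conductance \<beta> \<omega>) {e} \<le> 1" for \<omega>
      by (rule LIMSEQ_le_const2[OF w]) (intro exI allI impI conductance_bounds)
  qed
qed

text \<open>
  By stationarity, \<open>y\<close> may be moved to \<open>x\<close> together with the cube; the moved cube is contained in all large
  centred cubes, along which the probabilities decrease.
\<close>

lemma free_mean_limit_le:
  assumes "edge_at y i \<in> inner_edges (cube a n)"
  shows "free_mean_limit (edge_at x i) \<le> mean_free (cube a n) (edge_at y i)"
proof -
  have t: "cube (x - y + a) n = (+) (x - y) ` cube a n" "edge_at x i = (+) (x - y) ` edge_at y i"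
    by (simp_all add: cube_translate translate_edge_at)
  have "{edge_at x i} \<subseteq> inner_edges (cube (x - y + a) n)"
    unfolding t edges_translate using assms by blast
  then have "free_limit (conductance \<beta> \<omega>) {edge_at x i} \<le>
      free_prob (conductance \<beta> \<omega>) (cube (x - y + a) n) (\<lambda>T. edge_at x i \<in> T)" for \<omega>
    using conductance_free_limit_le[of "{edge_at x i}" "x - y + a" n \<beta> \<omega>] by simp
  then have "free_mean_limit (edge_at x i) \<le> mean_free (cube (x - y + a) n) (edge_at x i)"
    unfolding free_mean_limit_def mean_free_def
    by (intro integral_mono integrable_limit integrable_free_prob edge_at_lattice)
  also have "\<dots> = mean_free (cube a n) (edge_at y i)"
    unfolding t by (rule mean_translate)
  finally show ?thesis .
qed

text \<open>
  As for the free case; an edge that does not touch the cube has probability zero.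
\<close>

lemma wired_mean_limit_ge:
  "mean_wired (cube a n) (edge_at y i) \<le> wired_mean_limit (edge_at x i)"
proof -
  have t: "cube (x - y + a) n = (+) (x - y) ` cube a n" "edge_at x i = (+) (x - y) ` edge_at y i"
    by (simp_all add: cube_translate translate_edge_at)
  have "wired_prob (conductance \<beta> \<omega>) (cube (x - y + a) n) (\<lambda>T. edge_at x i \<in> T) \<le>
      wired_limit (conductance \<beta> \<omega>) {edge_at x i}" for \<omega>
  proof (cases "edge_at x i \<in> touching_edges (cube (x - y + a) n)")
    case True
    then show ?thesis
      using conductance_wired_limit_ge[of "{edge_at x i}" "x - y + a" n \<beta> \<omega>] by simp
  next
    case False
    then have "wired_prob (conductance \<beta> \<omega>) (cube (x - y + a) n) (\<lambda>T. edge_at x i \<in> T) = 0"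
      unfolding wired_prob_def by (intro lat.tree_prob_eq_0) (auto simp: lat.trees_def)
    also have "0 \<le> wired_limit (conductance \<beta> \<omega>) {edge_at x i}"
    proof (rule LIMSEQ_le_const[OF conductance_wired_limit])
      show "\<exists>N. \<forall>n\<ge>N. 0 \<le> wired_prob (conductance \<beta> \<omega>) (cube 0 n) (\<lambda>T. {edge_at x i} \<subseteq> T)"
        by (intro exI allI impI conductance_bounds)
    qed (simp_all add: edge_at_lattice)
    finally show ?thesis .
  qed
  then have "mean_wired (cube (x - y + a) n) (edge_at x i) \<le> wired_mean_limit (edge_at x i)"
    unfolding wired_mean_limit_def mean_wired_def
    by (intro integral_mono integrable_limit integrable_wired_prob edge_at_lattice)
  moreover have "mean_wired (cube (x - y + a) n) (edge_at x i) = mean_wired (cube a n) (edge_at y i)"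
    unfolding t by (rule mean_translate)
  ultimately show ?thesis by simp
qed

lemma sum_mean_free:
  fixes a :: "int ^ 'd"
  shows "(\<Sum>e\<in>inner_edges (cube a n). mean_free (cube a n) e) = real (card (cube a n)) - 1"
proof -
  have "(\<Sum>e\<in>inner_edges (cube a n). mean_free (cube a n) e) =
    (\<integral>\<omega>. (\<Sum>e\<in>inner_edges (cube a n). free_prob (conductance \<beta> \<omega>) (cube a n) (\<lambda>T. e \<in> T)) \<partial>(environment \<mu> :: ((int ^ 'd) set \<Rightarrow> real) measure))"
    unfolding mean_free_def by (rule Bochner_Integration.integral_sum[symmetric]) (rule integrable_free_prob)
  also have "\<dots> = (\<integral>\<omega>. real (card (cube a n)) - 1 \<partial>(environment \<mu> :: ((int ^ 'd) set \<Rightarrow> real) measure))"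
    by (simp only: conductance_sum_free)
  also have "\<dots> = real (card (cube a n)) - 1"
    by (simp add: prob_space.prob_space[OF prob_space_environment])
  finally show ?thesis .
qed

lemma sum_mean_wired:
  fixes a :: "int ^ 'd"
  shows "(\<Sum>e\<in>touching_edges (cube a n). mean_wired (cube a n) e) = real (card (cube a n))"
proof -
  have "(\<Sum>e\<in>touching_edges (cube a n). mean_wired (cube a n) e) =
    (\<integral>\<omega>. (\<Sum>e\<in>touching_edges (cube a n). wired_prob (conductance \<beta> \<omega>) (cube a n) (\<lambda>T. e \<in> T)) \<partial>(environment \<mu> :: ((int ^ 'd) set \<Rightarrow> real) measure))"
    unfolding mean_wired_def by (rule Bochner_Integration.integral_sum[symmetric]) (rule integrable_wired_prob)
  also have "\<dots> = (\<integral>\<omega>. real (card (cube a n)) \<partial>(environment \<mu> :: ((int ^ 'd) set \<Rightarrow> real) measure))"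
    by (simp only: conductance_sum_wired)
  also have "\<dots> = real (card (cube a n))"
    by (simp add: prob_space.prob_space[OF prob_space_environment])
  finally show ?thesis .
qed

lemma mean_nonneg: "0 \<le> mean_free (cube a n) e" "0 \<le> mean_wired (cube a n) e"
  unfolding mean_free_def mean_wired_def
  by (intro integral_nonneg_AE AE_I2 conductance_bounds)+

lemma cube_Suc:
  "x \<in> cube a n \<Longrightarrow> x + axis i 1 \<in> cube a (Suc n)"
  "x + axis i 1 \<in> cube a n \<Longrightarrow> x \<in> cube a (Suc n)"
proof -
  have d: "\<bar>(x + axis i 1) $ j - x $ j\<bar> \<le> 1" for j by (simp add: axis_def)
  show "x + axis i 1 \<in> cube a (Suc n)" if x: "x \<in> cube a n"
    unfolding cube_def mem_Collect_eq
  proof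
    fix j
    have "\<bar>x $ j - a $ j\<bar> \<le> int n" using x by (simp add: cube_def)
    then show "\<bar>(x + axis i 1) $ j - a $ j\<bar> \<le> int (Suc n)" using d[of j] by linarith
  qed
  show "x \<in> cube a (Suc n)" if x: "x + axis i 1 \<in> cube a n"
    unfolding cube_def mem_Collect_eq
  proof
    fix j
    have "\<bar>(x + axis i 1) $ j - a $ j\<bar> \<le> int n" using x by (simp only: cube_def mem_Collect_eq)
    then show "\<bar>x $ j - a $ j\<bar> \<le> int (Suc n)" using d[of j] by linarith
  qed
qed

text \<open>
  The edges \<open>edge_at y i\<close> with \<open>y\<close> in the cube are distinct inner edges of the next larger cube, whose
  spanning trees have fewer edges than it has vertices.
\<close>

lemma free_mean_limit_cube_bound:
  "real (card (cube x n)) * (\<Sum>i\<in>UNIV. free_mean_limit (edge_at x i)) \<le> real (card (cube x (Suc n)))"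
proof -
  let ?Q = "cube x (Suc n)"
  have inner: "edge_at y i \<in> inner_edges ?Q" if "y \<in> cube x n" for y i
    using that cube_Suc(1)[OF that] cube_mono[of n "Suc n" x]
    by (auto simp: inner_edges_def edge_at_lattice) (auto simp: edge_at_def)
  have "real (card (cube x n)) * (\<Sum>i\<in>UNIV. free_mean_limit (edge_at x i)) =
      (\<Sum>y\<in>cube x n. \<Sum>i\<in>UNIV. free_mean_limit (edge_at x i))" by simp
  also have "\<dots> \<le> (\<Sum>y\<in>cube x n. \<Sum>i\<in>UNIV. mean_free ?Q (edge_at y i))"
    by (intro sum_mono free_mean_limit_le inner)
  also have "\<dots> = (\<Sum>(y, i)\<in>cube x n \<times> UNIV. mean_free ?Q (edge_at y i))"
    by (rule sum.cartesian_product)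
  also have "\<dots> = (\<Sum>e\<in>(\<lambda>(y, i). edge_at y i) ` (cube x n \<times> UNIV). mean_free ?Q e)"
    by (subst sum.reindex) (auto intro!: inj_onI simp: edge_at_inject split_beta)
  also have "\<dots> \<le> (\<Sum>e\<in>inner_edges ?Q. mean_free ?Q e)"
    using inner by (intro sum_mono2 finite_inner_edges finite_cube mean_nonneg) auto
  also have "\<dots> \<le> real (card ?Q)" unfolding sum_mean_free by simp
  finally show ?thesis .
qed

text \<open>
  Every edge that touches the cube is of the form \<open>edge_at y i\<close> with \<open>y\<close> in the next larger cube, and a
  spanning tree of the wired graph has as many edges as the cube has vertices.
\<close>

lemma wired_mean_limit_cube_bound:
  "real (card (cube x n)) \<le> real (card (cube x (Suc n))) * (\<Sum>i\<in>UNIV. wired_mean_limit (edge_at x i))"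
proof -
  let ?Q = "cube x n" and ?f = "\<lambda>(y, i). edge_at y i"
  have "real (card ?Q) = (\<Sum>e\<in>touching_edges ?Q. mean_wired ?Q e)" by (rule sum_mean_wired[symmetric])
  also have "\<dots> \<le> (\<Sum>e\<in>?f ` (cube x (Suc n) \<times> UNIV). mean_wired ?Q e)"
  proof (intro sum_mono2 mean_nonneg)
    show "touching_edges ?Q \<subseteq> ?f ` (cube x (Suc n) \<times> UNIV)"
    proof
      fix e assume e: "e \<in> touching_edges ?Q"
      then have "e \<in> lattice_edges" by (simp add: touching_edges_def)
      then obtain y i where yi: "e = edge_at y i" by (rule lattice_edgeE)
      then have "y \<in> ?Q \<or> y + axis i 1 \<in> ?Q" using e by (auto simp: touching_edges_def edge_at_def)
      then have "y \<in> cube x (Suc n)" using cube_Suc(2) cube_mono[of n "Suc n" x] by auto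
      then show "e \<in> ?f ` (cube x (Suc n) \<times> UNIV)" using yi by force
    qed
  qed (simp add: finite_cube)
  also have "\<dots> = (\<Sum>(y, i)\<in>cube x (Suc n) \<times> UNIV. mean_wired ?Q (edge_at y i))"
    by (subst sum.reindex) (auto intro!: inj_onI simp: edge_at_inject split_beta)
  also have "\<dots> = (\<Sum>y\<in>cube x (Suc n). \<Sum>i\<in>UNIV. mean_wired ?Q (edge_at y i))"
    by (rule sum.cartesian_product[symmetric])
  also have "\<dots> \<le> (\<Sum>y\<in>cube x (Suc n). \<Sum>i\<in>UNIV. wired_mean_limit (edge_at x i))"
    by (intro sum_mono wired_mean_limit_ge)
  finally show ?thesis by simp
qed

lemma card_cube_ratio:
  "(\<lambda>n. real (card (cube (x :: int ^ 'd) (Suc n))) / real (card (cube x n))) \<longlonglongrightarrow> 1"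
proof -
  have "(\<lambda>n. (2 * real (Suc n) + 1) / (2 * real n + 1)) \<longlonglongrightarrow> 1" by real_asymp
  then have "(\<lambda>n. ((2 * real (Suc n) + 1) / (2 * real n + 1)) ^ CARD('d)) \<longlonglongrightarrow> 1 ^ CARD('d)"
    by (rule tendsto_power)
  moreover have "real (card (cube x m)) = (2 * real m + 1) ^ CARD('d)" for m
    by (simp add: card_cube add.commute)
  ultimately show ?thesis by (simp only: power_divide power_one)
qed

text \<open>
  The boundary of a cube is negligible compared with its volume: this is where amenability of the lattice
  enters.
\<close>

lemma sum_mean_limits:
  fixes x :: "int ^ 'd"
  shows "(\<Sum>i\<in>UNIV. free_mean_limit (edge_at x i)) \<le> 1"
    and "1 \<le> (\<Sum>i\<in>UNIV. wired_mean_limit (edge_at x i))"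
proof -
  have pos: "real (card (cube x n)) > 0" for n by (simp add: card_cube)
  show "(\<Sum>i\<in>UNIV. free_mean_limit (edge_at x i)) \<le> 1"
  proof (rule LIMSEQ_le_const[OF card_cube_ratio[of x]])
    have "(\<Sum>i\<in>UNIV. free_mean_limit (edge_at x i)) \<le> real (card (cube x (Suc n))) / real (card (cube x n))" for n
      using free_mean_limit_cube_bound[of x n] pos[of n] by (simp add: pos_le_divide_eq mult.commute)
    then show "\<exists>N. \<forall>n\<ge>N. (\<Sum>i\<in>UNIV. free_mean_limit (edge_at x i)) \<le> real (card (cube x (Suc n))) / real (card (cube x n))"
      by blast
  qed
  have "(\<lambda>n. real (card (cube x (Suc n))) / real (card (cube x n)) * (\<Sum>i\<in>UNIV. wired_mean_limit (edge_at x i)))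
      \<longlonglongrightarrow> 1 * (\<Sum>i\<in>UNIV. wired_mean_limit (edge_at x i))"
    by (intro tendsto_mult card_cube_ratio tendsto_const)
  moreover have "1 \<le> real (card (cube x (Suc n))) / real (card (cube x n)) * (\<Sum>i\<in>UNIV. wired_mean_limit (edge_at x i))" for n
    using wired_mean_limit_cube_bound[of x n] pos[of n] by (simp add: pos_le_divide_eq)
  ultimately have "1 \<le> 1 * (\<Sum>i\<in>UNIV. wired_mean_limit (edge_at x i))"
    by (intro LIMSEQ_le_const) auto
  then show "1 \<le> (\<Sum>i\<in>UNIV. wired_mean_limit (edge_at x i))" by simp
qed

text \<open>
  The expectations of the nonnegative differences, summed over the directions, are at most zero.
\<close>

lemma AE_edge_limits_eq:
  "AE \<omega> in environment \<mu>. free_limit (conductance \<beta> \<omega>) {edge_at x i} = wired_limit (conductance \<beta> \<omega>) {edge_at x i}"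
proof -
  have le: "wired_limit (conductance \<beta> \<omega>) {edge_at x i} \<le> free_limit (conductance \<beta> \<omega>) {edge_at x i}" for \<omega> i
    using conductance_limit_le[of "{edge_at x i}"] edge_at_lattice by auto
  then have mean_le: "wired_mean_limit (edge_at x i) \<le> free_mean_limit (edge_at x i)" for i
    unfolding wired_mean_limit_def free_mean_limit_def
    by (intro integral_mono integrable_limit edge_at_lattice)
  have "(\<Sum>i\<in>UNIV. free_mean_limit (edge_at x i) - wired_mean_limit (edge_at x i)) = 0"
    using sum_mean_limits[of x]
      sum_mono[of UNIV "\<lambda>i. wired_mean_limit (edge_at x i)" "\<lambda>i. free_mean_limit (edge_at x i)"] mean_le
    by (simp add: sum_subtractf)
  then have "free_mean_limit (edge_at x i) = wired_mean_limit (edge_at x i)"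
    using mean_le by (subst (asm) sum_nonneg_eq_0_iff) auto
  then have "(\<integral>\<omega>. free_limit (conductance \<beta> \<omega>) {edge_at x i} - wired_limit (conductance \<beta> \<omega>) {edge_at x i} \<partial>environment \<mu>) = 0"
    unfolding free_mean_limit_def wired_mean_limit_def
    by (subst Bochner_Integration.integral_diff) (auto intro: integrable_limit edge_at_lattice)
  then have "AE \<omega> in environment \<mu>. free_limit (conductance \<beta> \<omega>) {edge_at x i} - wired_limit (conductance \<beta> \<omega>) {edge_at x i} = 0"
    by (subst (asm) integral_nonneg_eq_0_iff_AE)
      (auto intro!: Bochner_Integration.integrable_diff integrable_limit edge_at_lattice simp: le)
  then show ?thesis by simp
qed

lemma AE_all_edge_limits_eq:
  "AE \<omega> in environment \<mu>. \<forall>e\<in>(lattice_edges :: (int ^ 'd) set set).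
     free_limit (conductance \<beta> \<omega>) {e} = wired_limit (conductance \<beta> \<omega>) {e}"
  unfolding AE_ball_countable[OF countable_lattice_edges]
  using AE_edge_limits_eq by (auto elim!: lattice_edgeE)

end

section \<open>The limiting measure\<close>

lemma unique_limit_if_edges_eq:
  fixes \<omega> :: "(int ^ 'd) set \<Rightarrow> real"
  assumes edges: "\<forall>e\<in>lattice_edges. free_limit (conductance \<beta> \<omega>) {e} = wired_limit (conductance \<beta> \<omega>) {e}"
  shows "\<exists>!\<nu>. prob_space \<nu> \<and> sets \<nu> = sets config_space \<and>
      (AE \<eta> in \<nu>. cycle_free lattice (open_edges \<eta>)) \<and>
      converges_weakly (\<lambda>n. spanning_tree_measure (free_graph (lattice_box n)) \<omega> \<beta>) \<nu> \<and>
      converges_weakly (\<lambda>n. spanning_tree_measure (wired_graph (lattice_box n)) \<omega> \<beta>) \<nu>"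
proof -
  let ?F = "\<lambda>n. spanning_tree_measure (free_graph (lattice_box n :: (int ^ 'd) set)) \<omega> \<beta>"
  let ?W = "\<lambda>n. spanning_tree_measure (wired_graph (lattice_box n :: (int ^ 'd) set)) \<omega> \<beta>"
  let ?c = "conductance \<beta> \<omega>"
  have eq: "free_limit ?c K = wired_limit ?c K" if "finite K" "K \<subseteq> lattice_edges" for K
    by (rule conductance_limits_eq) (use edges that in blast)+
  have F: "(\<lambda>n. measure (?F n) (cylinder lattice_edges K {})) \<longlonglongrightarrow> free_limit ?c K"
    if "finite K" "K \<subseteq> lattice_edges" for K
    using conductance_free_limit[OF that, of \<beta> \<omega>] that by (simp add: free_measure(3))
  have W: "(\<lambda>n. measure (?W n) (cylinder lattice_edges K {})) \<longlonglongrightarrow> free_limit ?c K"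
    if "finite K" "K \<subseteq> lattice_edges" for K
    using conductance_wired_limit[OF that, of \<beta> \<omega>] that by (simp add: wired_measure(3) eq)
  obtain \<nu> where \<nu>: "prob_space \<nu>" "sets \<nu> = sets (bool_space lattice_edges)"
    "\<And>K. finite K \<Longrightarrow> K \<subseteq> lattice_edges \<Longrightarrow>
      (\<lambda>n. measure (?F n) (cylinder lattice_edges K {})) \<longlonglongrightarrow> measure \<nu> (cylinder lattice_edges K {})"
    using weak_limit_exists[of ?F lattice_edges] free_measure(1,2) F unfolding convergent_def by metis
  have convF: "converges_weakly ?F \<nu>"
    unfolding converges_weakly_iff[OF free_measure(2) \<nu>(2)] using \<nu>(3) by blast
  have "measure \<nu> (cylinder lattice_edges K {}) = free_limit ?c K" if "finite K" "K \<subseteq> lattice_edges" for K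
    using LIMSEQ_unique[OF \<nu>(3) F] that by blast
  then have convW: "converges_weakly ?W \<nu>"
    unfolding converges_weakly_iff[OF wired_measure(2) \<nu>(2)] using W by simp
  show ?thesis
  proof (rule ex1I[of _ \<nu>])
    show "prob_space \<nu> \<and> sets \<nu> = sets config_space \<and> (AE \<eta> in \<nu>. cycle_free lattice (open_edges \<eta>)) \<and>
        converges_weakly ?F \<nu> \<and> converges_weakly ?W \<nu>"
      using \<nu>(1,2) convF convW weak_limit_cycle_free[OF \<nu>(1,2) convF] by (simp add: config_space_eq)
  next
    fix \<nu>' assume \<nu>': "prob_space \<nu>' \<and> sets \<nu>' = sets config_space \<and>
        (AE \<eta> in \<nu>'. cycle_free lattice (open_edges \<eta>)) \<and> converges_weakly ?F \<nu>' \<and> converges_weakly ?W \<nu>'"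
    then have s: "sets \<nu>' = sets (bool_space lattice_edges)" by (simp add: config_space_eq)
    show "\<nu>' = \<nu>"
    proof (rule measure_eqI_cylinder)
      fix K :: "(int ^ 'd) set set" assume K: "finite K" "K \<subseteq> lattice_edges"
      then have "(\<lambda>n. measure (?F n) (cylinder lattice_edges K {})) \<longlonglongrightarrow> measure \<nu>' (cylinder lattice_edges K {})"
        using \<nu>' unfolding converges_weakly_iff[OF free_measure(2) s] by blast
      then show "measure \<nu>' (cylinder lattice_edges K {}) = measure \<nu> (cylinder lattice_edges K {})"
        using \<nu>(3)[OF K] by (rule LIMSEQ_unique)
    qed (use \<nu> \<nu>' s in auto)
  qed
qed

theorem theorem3p2p3:
  fixes \<mu> :: "real measure" and \<beta> :: real
  assumes "CARD('d::finite) \<ge> 2"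
    and "real_distribution \<mu>"
    and "\<beta> \<ge> 0"
  shows "AE \<omega> in Pi\<^sub>M (lattice_edges :: (int ^ 'd) set set) (\<lambda>_. \<mu>).
    \<exists>!\<nu>. prob_space \<nu> \<and> sets \<nu> = sets config_space \<and>
      (AE \<eta> in \<nu>. cycle_free lattice (open_edges \<eta>)) \<and>
      converges_weakly (\<lambda>n. spanning_tree_measure (free_graph (lattice_box n)) \<omega> \<beta>) \<nu> \<and>
      converges_weakly (\<lambda>n. spanning_tree_measure (wired_graph (lattice_box n)) \<omega> \<beta>) \<nu>"
  using AE_all_edge_limits_eq[OF assms(2)]
  by (rule eventually_mono) (rule unique_limit_if_edges_eq)

end
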